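(* Let $d\ge2$ and $r\ge2$ be integers, and let $G$ be the graph obtained from the integer lattice $\mathbb{Z}^d$ by attaching at each vertex $\mathbf{x}\in\mathbb{Z}^d$ an infinite rooted regular tree $\mathbb{T}_r^{\mathbf{x}}$ rooted at $\mathbf{x}$. Let $C$ be the open connected component of the origin $\mathbf{0}\in\mathbb{Z}^d$ under Bernoulli bond percolation on $G$. Suppose $p_c(\mathbb{Z}^d)>\frac1r$. (a) If $p\in(0,1)$ and $p\neq\frac1r$, then there are $\nu_1(p)<\infty$ and $\nu_2(p)>0$ such that for all $n\ge1$ $$\exp(-\nu_1(p)\,n)\le \mathbb{P}_p(n\le|C|<\infty)\le \exp(-\nu_2(p)\,n).$$ (b) If $p=\frac1r$, then there is a constant $c_1>0$, and for every $\varepsilon>0$ a constant $c_2'=c_2'(\varepsilon)<\infty$, such that for every $\varepsilon>0$ and all $n\ge1$ $$\frac{c_1}{n^{1/2}}\le \mathbb{P}_p(n\le|C|<\infty)\le \frac{c_2'(\varepsilon)}{n^{1/2-\varepsilon}}.$$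
   Context: In the rooted tree $\mathbb{T}_r^{\mathbf{x}}$ the root $\mathbf{x}$ has degree $r$ (within the tree) and every other vertex has degree $r+1$, i.e. every vertex has exactly $r$ children. The trees attached at different lattice points are disjoint, and $\mathbb{T}_r^{\mathbf{x}}$ meets $\mathbb{Z}^d$ only in $\mathbf{x}$. $\mathbb{Z}^d$ carries its usual nearest-neighbour edges. $\mathbb{P}_p$ is the probability measure under which each edge is independently open with probability $p$ and closed otherwise; open connected components are the connected components of the subgraph of open edges. $|C|$ is the number of vertices of $C$. The critical probability of an infinite connected graph $H$ is $p_c(H)=\inf\{p\in[0,1]: \mathbb{P}_p(\text{there is an infinite open cluster in } H)=1\}$.
   Formalization: In (a) the upper bound is not claimed for n = 1 when p < 1/r: there C is almost surely finite, so the probability that 1 ≤ |C| < ∞ equals 1 and no bound exp(-ν_2) with ν_2 > 0 can hold; for p < 1/r the upper bound is stated for n ≥ 2. *)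

theory Defs
  imports "HOL-Probability.Probability"
begin

text \<open>A graph is a pair of a vertex set and a set of (unordered) edges, an edge being the
  two-element set of its endpoints.\<close>

type_synonym 'v graph = "'v set \<times> 'v set set"

abbreviation verts :: "'v graph \<Rightarrow> 'v set" where "verts \<equiv> fst"
abbreviation edges :: "'v graph \<Rightarrow> 'v set set" where "edges \<equiv> snd"

definition lattice :: "(int ^ 'd) graph" where
  "lattice = (UNIV, {{x, y} | x y. (\<Sum>i\<in>UNIV. \<bar>x $ i - y $ i\<bar>) = 1})"

text \<open>The vertices of the rooted tree in which every vertex has exactly \<open>r\<close> children are the
  finite words over \<open>{..<r}\<close>; the root is the empty word and the children of \<open>w\<close> are the
  words \<open>w @ [k]\<close>.\<close>

definition rooted_tree :: "nat \<Rightarrow> nat list graph" where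
  "rooted_tree r =
     (lists {..<r}, {{w, w @ [k]} | w k. w \<in> lists {..<r} \<and> k < r})"

text \<open>The vertex \<open>(x, w)\<close> is the vertex \<open>w\<close> of the copy of the tree attached at \<open>x\<close>;
  the lattice point \<open>x\<close> itself is identified with the root \<open>(x, [])\<close> of its tree.\<close>

definition lattice_with_trees :: "nat \<Rightarrow> ((int ^ 'd) \<times> nat list) graph" where
  "lattice_with_trees r =
     (UNIV \<times> verts (rooted_tree r),
      (\<lambda>e. (\<lambda>x. (x, [])) ` e) ` edges lattice \<union>
      (\<Union>x. (\<lambda>e. Pair x ` e) ` edges (rooted_tree r)))"

text \<open>A configuration maps every edge to \<open>True\<close> (open) or \<open>False\<close> (closed).\<close>

definition percolation :: "'v graph \<Rightarrow> real \<Rightarrow> ('v set \<Rightarrow> bool) measure" where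
  "percolation H p = PiM (edges H) (\<lambda>_. measure_pmf (bernoulli_pmf p))"

definition open_cluster :: "'v graph \<Rightarrow> ('v set \<Rightarrow> bool) \<Rightarrow> 'v \<Rightarrow> 'v set" where
  "open_cluster H \<omega> v = {u. (v, u) \<in> {(a, b). {a, b} \<in> edges H \<and> \<omega> {a, b}}\<^sup>*}"

definition critical_probability :: "'v graph \<Rightarrow> real" where
  "critical_probability H =
     Inf {p \<in> {0..1}. measure (percolation H p)
            {\<omega> \<in> space (percolation H p). \<exists>v\<in>verts H. infinite (open_cluster H \<omega> v)} = 1}"

text \<open>The probability of \<open>n \<le> |C| < \<infinity>\<close>, with \<open>|C|\<close> the number of vertices. Since a cluster
  contains its starting vertex, for \<open>n = 1\<close> this is the probability that the cluster is finite;
  it equals 1 when there is almost surely no infinite cluster, so that no bound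
  \<open>exp (- \<nu> * n)\<close> with \<open>\<nu> > 0\<close> can then hold at \<open>n = 1\<close>.\<close>

definition finite_tail :: "'v graph \<Rightarrow> real \<Rightarrow> 'v \<Rightarrow> nat \<Rightarrow> real" where
  "finite_tail H p v n =
     measure (percolation H p)
       {\<omega> \<in> space (percolation H p).
          finite (open_cluster H \<omega> v) \<and> n \<le> card (open_cluster H \<omega> v)}"

end

theory Submission
  imports Defs
begin

text \<open>
  The cluster of the origin consists of its cluster \<open>C\<^sub>0\<close> in the lattice together with independent
  tree clusters hanging from the points of \<open>C\<^sub>0\<close>. Therefore the generating function of \<open>|C|\<close>, on the
  event that \<open>C\<close> is finite, is the generating function of \<open>|C\<^sub>0|\<close> evaluated at that of a tree cluster
  (\<open>cluster_gf_lattice_with_trees\<close>), and all tail bounds are read off from it.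

  A tree cluster is the total progeny of a branching process with binomial offspring of mean
  \<open>r * p\<close>. Its generating function at \<open>s\<close> is the least solution of \<open>u = s * (1 - p + p * u) ^ r\<close>. For
  \<open>p \<noteq> 1 / r\<close> the right-hand side crosses the diagonal transversally at \<open>s = u = 1\<close>, which leaves room
  for some \<open>s > 1\<close>: the value there is less than \<open>1\<close> if \<open>p > 1 / r\<close>, and finite and close to \<open>1\<close> if
  \<open>p < 1 / r\<close>. For \<open>p = 1 / r\<close> the two curves are tangent, and \<open>1 - u\<close> is of the order of the square
  root of \<open>1 - s\<close> (\<open>critical_tree_gf\<close>).

  For \<open>p > 1 / r\<close> a large finite \<open>C\<^sub>0\<close> is penalised by its trees, each of which is infinite with
  positive probability. For \<open>p \<le> 1 / r\<close> exponential moments of \<open>|C\<^sub>0|\<close> are needed; they exist since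
  \<open>p\<close> is below the critical point of the lattice (\<open>lattice_subcritical_gf\<close>). This sharpness of the phase
  transition is proved by stochastic comparison. Choose \<open>p' > p\<close> below the critical point, where by
  the zero-one law all clusters are finite. Colour every vertex green independently with a small
  probability \<open>1 - s\<close> and condition the cluster at \<open>p'\<close> on containing no green vertex. Exploring it
  edge by edge, each inspected edge is still open with probability at least \<open>p\<close>, provided that an
  unexplored cluster avoids green with probability at least \<open>p / p'\<close>. So the conditioned cluster is
  stochastically larger than the cluster at \<open>p\<close> (\<open>cluster_size_comparison\<close>), while it has size at
  least \<open>k\<close> with probability \<open>O(s ^ k)\<close>.

  Exponential upper bounds now follow from Markov's inequality. In the critical case \<open>|C|\<close> inherits
  the square-root singularity because \<open>|C\<^sub>0|\<close> has a finite mean, and an elementary Tauberian argument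
  (\<open>tail_of_square_root_singularity\<close>) turns it into a tail of order \<open>n\<close> to the power \<open>- 1 / 2\<close>.
  The exponential lower bound comes from forcing the cluster to be a path in the tree of the origin
  (\<open>prob_cluster_card_lower_bound\<close>).
\<close>

section \<open>Clusters of a set of open edges\<close>

text \<open>Starting from a set of vertices rather than a single one, an exploration can record its progress
  by enlarging the starting set.\<close>

definition reach :: "'v set set \<Rightarrow> 'v set \<Rightarrow> 'v set" where
  "reach S A = {(a, b). {a, b} \<in> S}\<^sup>* `` A"

lemma open_cluster_eq_reach: "open_cluster H \<omega> v = reach {e \<in> edges H. \<omega> e} {v}"
  by (auto simp: open_cluster_def reach_def)

lemma reach_mono: "S \<subseteq> S' \<Longrightarrow> A \<subseteq> A' \<Longrightarrow> reach S A \<subseteq> reach S' A'"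
  unfolding reach_def by (intro Image_mono rtrancl_mono) auto

lemma subset_reach: "A \<subseteq> reach S A"
  by (auto simp: reach_def)

lemma reach_step: "a \<in> reach S A \<Longrightarrow> {a, b} \<in> S \<Longrightarrow> b \<in> reach S A"
  by (auto simp: reach_def intro: rtrancl_into_rtrancl)

lemma reach_subsetI:
  assumes "A \<subseteq> B" and "\<And>a b. a \<in> B \<Longrightarrow> {a, b} \<in> S \<Longrightarrow> b \<in> B"
  shows "reach S A \<subseteq> B"
proof
  fix u assume "u \<in> reach S A"
  then obtain a where "a \<in> A" "(a, u) \<in> {(a, b). {a, b} \<in> S}\<^sup>*"
    by (auto simp: reach_def)
  from this(2) show "u \<in> B"
    by induction (use assms \<open>a \<in> A\<close> in auto)
qed

lemma reach_insert_edge: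
  assumes "x \<in> A"
  shows "reach (insert {x, y} S) A = reach S (insert y A)"
proof
  show "reach (insert {x, y} S) A \<subseteq> reach S (insert y A)"
  proof (rule reach_subsetI)
    show "A \<subseteq> reach S (insert y A)" using subset_reach[of "insert y A" S] by auto
    fix a b assume a: "a \<in> reach S (insert y A)" and ab: "{a, b} \<in> insert {x, y} S"
    show "b \<in> reach S (insert y A)"
    proof (cases "{a, b} \<in> S")
      case True then show ?thesis using a by (rule reach_step[rotated])
    next
      case False
      then have "b \<in> insert y A" using ab assms by (auto simp: doubleton_eq_iff)
      then show ?thesis by (rule subsetD[OF subset_reach])
    qed
  qed
  have x: "x \<in> reach (insert {x, y} S) A" by (rule subsetD[OF subset_reach assms])
  have "y \<in> reach (insert {x, y} S) A" by (rule reach_step[OF x]) simp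
  moreover have "A \<subseteq> reach (insert {x, y} S) A" by (rule subset_reach)
  ultimately show "reach S (insert y A) \<subseteq> reach (insert {x, y} S) A"
    by (intro reach_subsetI) (auto intro: reach_step)
qed

lemma reach_Un: "reach S (A \<union> B) = reach S A \<union> reach S B"
  by (auto simp: reach_def)

lemma finite_reach:
  assumes "finite S" and "\<forall>e\<in>S. finite e" and "finite A"
  shows "finite (reach S A)"
proof (rule finite_subset)
  show "reach S A \<subseteq> A \<union> \<Union>S" by (rule reach_subsetI) auto
  show "finite (A \<union> \<Union>S)" using assms by auto
qed

lemma reach_finite_edges:
  assumes "u \<in> reach S A"
  shows "\<exists>F\<subseteq>S. finite F \<and> u \<in> reach F A"
proof -
  have "reach S A \<subseteq> {u. \<exists>F\<subseteq>S. finite F \<and> u \<in> reach F A}"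
  proof (rule reach_subsetI)
    show "A \<subseteq> {u. \<exists>F\<subseteq>S. finite F \<and> u \<in> reach F A}"
      using subset_reach[of A "{}"] by (blast intro: exI[of _ "{}"])
    fix a b assume "a \<in> {u. \<exists>F\<subseteq>S. finite F \<and> u \<in> reach F A}" and ab: "{a, b} \<in> S"
    then obtain F where F: "F \<subseteq> S" "finite F" "a \<in> reach F A" by auto
    have "a \<in> reach (insert {a, b} F) A"
      using F(3) reach_mono[of F "insert {a, b} F" A A] by auto
    then have "b \<in> reach (insert {a, b} F) A" by (rule reach_step) simp
    then show "b \<in> {u. \<exists>F\<subseteq>S. finite F \<and> u \<in> reach F A}"
      using F ab by (intro CollectI exI[of _ "insert {a, b} F"]) auto
  qed
  then show ?thesis using assms by auto
qed

section \<open>Percolation on finitely many edges\<close>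

text \<open>Under \<open>\<P>\<^sub>p\<close> this is the expectation of \<open>F\<close> applied to the set of open edges in the
  finite set \<open>E\<close>.\<close>

definition bernoulli_sum :: "real \<Rightarrow> 'e set \<Rightarrow> ('e set \<Rightarrow> real) \<Rightarrow> real" where
  "bernoulli_sum p E F = (\<Sum>S\<in>Pow E. p ^ card S * (1 - p) ^ card (E - S) * F S)"

lemma bernoulli_sum_insert:
  assumes "finite E" and "e \<notin> E"
  shows "bernoulli_sum p (insert e E) F =
           p * bernoulli_sum p E (\<lambda>S. F (insert e S)) + (1 - p) * bernoulli_sum p E F"
proof -
  let ?t = "\<lambda>S. p ^ card S * (1 - p) ^ card (insert e E - S) * F S"
  have inj: "inj_on (insert e) (Pow E)"
    using assms by (intro inj_onI) (metis PowD insert_ident subsetD)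
  have "bernoulli_sum p (insert e E) F = sum ?t (Pow E) + sum ?t (insert e ` Pow E)"
    unfolding bernoulli_sum_def Pow_insert
    using assms by (intro sum.union_disjoint) auto
  also have "sum ?t (insert e ` Pow E) = (\<Sum>S\<in>Pow E. ?t (insert e S))"
    by (rule sum.reindex[OF inj, unfolded comp_def])
  also have "\<dots> = p * bernoulli_sum p E (\<lambda>S. F (insert e S))"
    unfolding bernoulli_sum_def sum_distrib_left
  proof (intro sum.cong refl)
    fix S assume "S \<in> Pow E"
    then have "finite S" "e \<notin> S" "insert e E - insert e S = E - S"
      using assms by (auto intro: finite_subset)
    then show "?t (insert e S) = p * (p ^ card S * (1 - p) ^ card (E - S) * F (insert e S))"
      by simp
  qed
  also have "sum ?t (Pow E) = (1 - p) * bernoulli_sum p E F"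
    unfolding bernoulli_sum_def sum_distrib_left
  proof (intro sum.cong refl)
    fix S assume "S \<in> Pow E"
    then have "insert e E - S = insert e (E - S)" "e \<notin> E - S" "finite (E - S)"
      using assms by auto
    then show "?t S = (1 - p) * (p ^ card S * (1 - p) ^ card (E - S) * F S)"
      by simp
  qed
  finally show ?thesis by simp
qed

lemma bernoulli_sum_cong:
  "(\<And>S. S \<subseteq> E \<Longrightarrow> F S = F' S) \<Longrightarrow> bernoulli_sum p E F = bernoulli_sum p E F'"
  by (simp add: bernoulli_sum_def)

lemma bernoulli_sum_mono:
  assumes "0 \<le> p" "p \<le> 1" and "\<And>S. S \<subseteq> E \<Longrightarrow> F S \<le> F' S"
  shows "bernoulli_sum p E F \<le> bernoulli_sum p E F'"
  unfolding bernoulli_sum_def using assms by (intro sum_mono mult_left_mono) auto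

lemma bernoulli_sum_cmult: "bernoulli_sum p E (\<lambda>S. c * F S) = c * bernoulli_sum p E F"
  by (simp add: bernoulli_sum_def sum_distrib_left mult_ac)

lemma bernoulli_sum_const:
  assumes "finite E"
  shows "bernoulli_sum p E (\<lambda>_. c) = c"
  using assms
proof (induction E)
  case empty
  then show ?case by (simp add: bernoulli_sum_def)
next
  case (insert e E)
  then show ?case by (simp add: bernoulli_sum_insert algebra_simps)
qed

section \<open>Stochastic comparison at two parameters\<close>

text \<open>The inductions below explore the cluster of a finite set \<open>A\<close> edge by edge. If no edge
  leaves \<open>A\<close> the cluster is \<open>A\<close>; otherwise an edge from \<open>x \<in> A\<close> to \<open>y \<notin> A\<close> is inspected
  and deleted, and \<open>y\<close> joins \<open>A\<close> if the edge is open.\<close>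

lemma exploration_induct [consumes 2, case_names closed explore]:
  assumes "finite E" and "\<forall>e\<in>E. card e = 2"
    and closed: "\<And>A E. finite E \<Longrightarrow> \<forall>e\<in>E. card e = 2 \<Longrightarrow>
      (\<And>S. S \<subseteq> E \<Longrightarrow> reach S A = A) \<Longrightarrow> P E A"
    and explore: "\<And>A E x y. finite E \<Longrightarrow> \<forall>e\<in>E. card e = 2 \<Longrightarrow> {x, y} \<notin> E \<Longrightarrow> x \<in> A \<Longrightarrow> y \<notin> A \<Longrightarrow>
      (\<And>B. P E B) \<Longrightarrow> P (insert {x, y} E) A"
  shows "P E A"
  using assms(1,2)
proof (induction "card E" arbitrary: E A rule: less_induct)
  case (less E A)
  show ?case
  proof (cases "\<exists>x\<in>A. \<exists>y. y \<notin> A \<and> {x, y} \<in> E")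
    case True
    then obtain x y where xy: "x \<in> A" "y \<notin> A" "{x, y} \<in> E" by auto
    have E: "E = insert {x, y} (E - {{x, y}})" using xy by auto
    have IH: "P (E - {{x, y}}) B" for B
      using less.prems xy card_Diff1_less[of E "{x, y}"] by (intro less.hyps) auto
    have "P (insert {x, y} (E - {{x, y}})) A"
      by (rule explore[of "E - {{x, y}}" x y A]) (use less.prems xy IH in simp_all)
    then show ?thesis using E by simp
  next
    case False
    have "reach S A = A" if "S \<subseteq> E" for S
      using False that by (intro equalityI subset_reach reach_subsetI) auto
    then show ?thesis by (intro closed less.prems) blast
  qed
qed

lemma finite_reach_doubletons:
  "finite E \<Longrightarrow> \<forall>e\<in>E. card e = 2 \<Longrightarrow> S \<subseteq> E \<Longrightarrow> finite A \<Longrightarrow> finite (reach S A)"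
  by (rule finite_reach) (auto intro: finite_subset, metis card.infinite subsetD zero_neq_numeral)

text \<open>The expectation of \<open>s ^ |C|\<close> is the probability that \<open>C\<close> contains no green vertex, if
  vertices are independently green with probability \<open>1 - s\<close>. Adding one starting vertex \<open>y\<close>
  costs at most the factor \<open>\<alpha>\<close>, because what \<open>y\<close> adds to the cluster is a cluster in the
  edges not yet explored.\<close>

lemma no_green_insert_vertex:
  fixes p s \<alpha> :: real
  assumes "finite E" and "\<forall>e\<in>E. card e = 2" and p: "0 \<le> p" "p \<le> 1" and s: "0 \<le> s" "s \<le> 1"
    and \<alpha>: "0 \<le> \<alpha>" "\<alpha> \<le> 1"
    and bound: "\<And>E'. E' \<subseteq> E \<Longrightarrow> \<alpha> \<le> bernoulli_sum p E' (\<lambda>S. s ^ card (reach S {y}))"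
    and "finite A"
  shows "\<alpha> * bernoulli_sum p E (\<lambda>S. s ^ card (reach S A))
           \<le> bernoulli_sum p E (\<lambda>S. s ^ card (reach S (insert y A)))"
  using assms(1,2) bound \<open>finite A\<close>
proof (induction E A rule: exploration_induct)
  case (closed A E)
  have "\<alpha> * bernoulli_sum p E (\<lambda>S. s ^ card (reach S A)) = \<alpha> * s ^ card A"
  proof -
    have "bernoulli_sum p E (\<lambda>S. s ^ card (reach S A)) = bernoulli_sum p E (\<lambda>S. s ^ card A)"
      by (intro bernoulli_sum_cong) (simp add: closed(3))
    then show ?thesis by (simp add: bernoulli_sum_const closed(1))
  qed
  also have "\<dots> \<le> s ^ card A * bernoulli_sum p E (\<lambda>S. s ^ card (reach S {y}))"
    using mult_left_mono[OF closed(4)[OF subset_refl], of "s ^ card A"] s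
    by (simp add: mult.commute)
  also have "\<dots> = bernoulli_sum p E (\<lambda>S. s ^ (card A + card (reach S {y})))"
    by (simp add: bernoulli_sum_cmult power_add)
  also have "\<dots> \<le> bernoulli_sum p E (\<lambda>S. s ^ card (reach S (insert y A)))"
  proof (rule bernoulli_sum_mono[OF p])
    fix S assume S: "S \<subseteq> E"
    have "reach S (insert y A) = A \<union> reach S {y}"
      using reach_Un[of S A "{y}"] closed(3)[OF S] by simp
    then show "s ^ (card A + card (reach S {y})) \<le> s ^ card (reach S (insert y A))"
      by (intro power_decreasing[OF _ s]) (simp add: card_Un_le)
  qed
  finally show ?case .
next
  case (explore A E x z)
  let ?g = "\<lambda>E A. bernoulli_sum p E (\<lambda>S. s ^ card (reach S A))"
  have sub: "\<alpha> \<le> bernoulli_sum p E' (\<lambda>S. s ^ card (reach S {y}))" if "E' \<subseteq> E" for E'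
    using explore.prems(1)[of E'] that by auto
  have IH: "\<alpha> * ?g E B \<le> ?g E (insert y B)" if "finite B" for B
    by (rule explore.IH[OF sub that])
  have g: "?g (insert {x, z} E) B = p * ?g E (insert z B) + (1 - p) * ?g E B" if "x \<in> B" for B
    by (simp only: bernoulli_sum_insert[OF explore.hyps(1,3)] reach_insert_edge[OF that])
  have "\<alpha> * ?g (insert {x, z} E) A = p * (\<alpha> * ?g E (insert z A)) + (1 - p) * (\<alpha> * ?g E A)"
    by (subst g[OF explore.hyps(4)]) (simp only: distrib_left mult.left_commute)
  also have "\<dots> \<le> p * ?g E (insert y (insert z A)) + (1 - p) * ?g E (insert y A)"
    using p explore.prems(2) by (intro add_mono mult_left_mono IH) auto
  also have "\<dots> = ?g (insert {x, z} E) (insert y A)"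
    using explore.hyps(4) by (subst g[of "insert y A"]) (simp_all only: insert_commute insertI2)
  finally show ?case .
qed

text \<open>Conditioned on the cluster of \<open>A\<close> containing no green vertex, each inspected edge is
  still open with probability at least \<open>p * \<alpha> \<ge> q\<close>: opening it lowers the conditional
  probability of seeing no green vertex at most by the factor \<open>\<alpha>\<close>. Hence the conditioned
  cluster at \<open>p\<close> is stochastically larger than the cluster at \<open>q\<close>.\<close>

lemma cluster_size_comparison:
  fixes p q s \<alpha> :: real
  assumes "finite E" and "\<forall>e\<in>E. card e = 2" and p: "0 \<le> p" "p \<le> 1" and s: "0 \<le> s" "s \<le> 1"
    and \<alpha>: "0 \<le> \<alpha>" "\<alpha> \<le> 1" and q: "0 \<le> q" "q \<le> p * \<alpha>"
    and bound: "\<And>E' y. E' \<subseteq> E \<Longrightarrow> \<alpha> \<le> bernoulli_sum p E' (\<lambda>S. s ^ card (reach S {y}))"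
    and "finite A"
  shows "bernoulli_sum q E (\<lambda>S. of_bool (k \<le> card (reach S A)))
           * bernoulli_sum p E (\<lambda>S. s ^ card (reach S A))
         \<le> bernoulli_sum p E (\<lambda>S. s ^ card (reach S A) * of_bool (k \<le> card (reach S A)))"
  using assms(1,2) bound \<open>finite A\<close>
proof (induction E A rule: exploration_induct)
  case (closed A E)
  have c: "bernoulli_sum p E (\<lambda>S. f (reach S A)) = f A" for p and f :: "'a set \<Rightarrow> real"
  proof -
    have "bernoulli_sum p E (\<lambda>S. f (reach S A)) = bernoulli_sum p E (\<lambda>S. f A)"
      by (intro bernoulli_sum_cong) (simp add: closed(3))
    then show ?thesis by (simp add: bernoulli_sum_const closed(1))
  qed
  show ?case by (simp add: c[of _ "\<lambda>B. s ^ card B"] c[of _ "\<lambda>B. of_bool (k \<le> card B)"]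
        c[of _ "\<lambda>B. s ^ card B * of_bool (k \<le> card B)"])
next
  case (explore A E x z)
  let ?g = "\<lambda>E A. bernoulli_sum p E (\<lambda>S. s ^ card (reach S A))"
  let ?P = "\<lambda>E A. bernoulli_sum q E (\<lambda>S. of_bool (k \<le> card (reach S A)))"
  let ?R = "\<lambda>E A. bernoulli_sum p E (\<lambda>S. s ^ card (reach S A) * of_bool (k \<le> card (reach S A)))"
  have sub: "\<alpha> \<le> bernoulli_sum p E' (\<lambda>S. s ^ card (reach S {y}))" if "E' \<subseteq> E" for E' y
    using explore.prems(1)[of E' y] that by auto
  have IH: "?P E B * ?g E B \<le> ?R E B" if "finite B" for B
    by (rule explore.IH[OF sub that])
  have q1: "q \<le> 1" using q p \<alpha> mult_mono[of p 1 \<alpha> 1] by simp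
  have rec: "bernoulli_sum q' (insert {x, z} E) (\<lambda>S. f (reach S A)) =
      q' * bernoulli_sum q' E (\<lambda>S. f (reach S (insert z A)))
      + (1 - q') * bernoulli_sum q' E (\<lambda>S. f (reach S A))" for q' and f :: "'a set \<Rightarrow> real"
    by (simp only: bernoulli_sum_insert[OF explore.hyps(1,3)] reach_insert_edge[OF explore.hyps(4)])
  define a b P1 P0 where "a = ?g E (insert z A)" and "b = ?g E A"
    and "P1 = ?P E (insert z A)" and "P0 = ?P E A"
  have le_card: "card (reach S A) \<le> card (reach S (insert z A))" if "S \<subseteq> E" for S
    using explore.hyps explore.prems(2) that by (intro card_mono finite_reach_doubletons reach_mono) auto
  have P: "P0 \<le> P1" unfolding P0_def P1_def
  proof (rule bernoulli_sum_mono[OF q(1) q1])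
    fix S assume "S \<subseteq> E"
    from le_card[OF this] show "(of_bool (k \<le> card (reach S A)) :: real)
        \<le> of_bool (k \<le> card (reach S (insert z A)))" by (simp add: of_bool_def)
  qed
  have ab: "a \<le> b" unfolding a_def b_def
    by (rule bernoulli_sum_mono[OF p]) (intro power_decreasing le_card s)
  have \<alpha>b: "\<alpha> * b \<le> a" unfolding a_def b_def
    by (intro no_green_insert_vertex p s \<alpha> sub explore.hyps explore.prems(2))
  have "0 = bernoulli_sum p E (\<lambda>S. 0)" by (simp add: bernoulli_sum_def)
  also have "\<dots> \<le> b" unfolding b_def by (rule bernoulli_sum_mono[OF p]) (simp add: s)
  finally have b0: "0 \<le> b" .
  have "p * a + (1 - p) * b \<le> b"
    using mult_left_mono[OF ab p(1)] by (simp add: algebra_simps)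
  then have "q * (p * a + (1 - p) * b) \<le> q * b" using q by (intro mult_left_mono)
  also have "\<dots> \<le> (p * \<alpha>) * b" by (rule mult_right_mono[OF q(2) b0])
  also have "\<dots> \<le> p * a" using mult_left_mono[OF \<alpha>b p(1)] by (simp add: mult_ac)
  finally have key: "q * (p * a + (1 - p) * b) \<le> p * a" .
  have "0 \<le> (P1 - P0) * (p * a - q * (p * a + (1 - p) * b))"
    using P key by (intro mult_nonneg_nonneg) auto
  then have "(q * P1 + (1 - q) * P0) * (p * a + (1 - p) * b)
      \<le> p * (P1 * a) + (1 - p) * (P0 * b)"
    by (simp add: algebra_simps)
  also have "\<dots> \<le> p * ?R E (insert z A) + (1 - p) * ?R E A"
    using p explore.prems(2) unfolding a_def b_def P1_def P0_def
    by (intro add_mono mult_left_mono IH) auto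
  finally show ?case
    unfolding a_def b_def P1_def P0_def
      rec[of q "\<lambda>B. of_bool (k \<le> card B)"] rec[of p "\<lambda>B. s ^ card B"]
      rec[of p "\<lambda>B. s ^ card B * of_bool (k \<le> card B)"]
    .
qed

text \<open>So the size of a cluster at \<open>q\<close> has an exponential tail as soon as, at \<open>p\<close>, clusters are
  uniformly unlikely to contain a green vertex.\<close>

lemma cluster_size_tail:
  fixes p q s \<alpha> :: real
  assumes "finite E" and "\<forall>e\<in>E. card e = 2" and p: "0 \<le> p" "p \<le> 1" and s: "0 \<le> s" "s \<le> 1"
    and \<alpha>: "0 < \<alpha>" "\<alpha> \<le> 1" and q: "0 \<le> q" "q \<le> p * \<alpha>"
    and bound: "\<And>E' y. E' \<subseteq> E \<Longrightarrow> \<alpha> \<le> bernoulli_sum p E' (\<lambda>S. s ^ card (reach S {y}))"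
  shows "bernoulli_sum q E (\<lambda>S. of_bool (k \<le> card (reach S {v}))) \<le> s ^ k / \<alpha>"
proof -
  let ?P = "bernoulli_sum q E (\<lambda>S. of_bool (k \<le> card (reach S {v})))"
  have q1: "q \<le> 1" using q p \<alpha> mult_mono[of p 1 \<alpha> 1] by simp
  have "0 = bernoulli_sum q E (\<lambda>S. 0)" by (simp add: bernoulli_sum_def)
  also have "\<dots> \<le> ?P" by (rule bernoulli_sum_mono[OF q(1) q1]) simp
  finally have "?P * \<alpha> \<le> ?P * bernoulli_sum p E (\<lambda>S. s ^ card (reach S {v}))"
    by (intro mult_left_mono bound) auto
  also have "\<dots> \<le> bernoulli_sum p E (\<lambda>S. s ^ card (reach S {v}) * of_bool (k \<le> card (reach S {v})))"
    using \<alpha> by (intro cluster_size_comparison[where \<alpha> = \<alpha>] assms(1,2) p s q bound) auto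
  also have "\<dots> \<le> bernoulli_sum p E (\<lambda>S. s ^ k)"
    by (rule bernoulli_sum_mono[OF p]) (simp add: of_bool_def power_decreasing s)
  also have "\<dots> = s ^ k" by (rule bernoulli_sum_const[OF assms(1)])
  finally show ?thesis using \<alpha> by (simp add: field_simps)
qed

lemma reach_image:
  assumes "inj \<phi>"
  shows "reach ((`) \<phi> ` S) (\<phi> ` A) = \<phi> ` reach S A"
proof
  show "reach ((`) \<phi> ` S) (\<phi> ` A) \<subseteq> \<phi> ` reach S A"
  proof (rule reach_subsetI)
    show "\<phi> ` A \<subseteq> \<phi> ` reach S A" by (intro image_mono subset_reach)
    fix c b assume "c \<in> \<phi> ` reach S A" and e: "{c, b} \<in> (`) \<phi> ` S"
    then obtain a e where a: "a \<in> reach S A" "c = \<phi> a" and e: "e \<in> S" "{\<phi> a, b} = \<phi> ` e" by auto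
    from e(2) have "b \<in> \<phi> ` e" by auto
    then obtain b' where b': "b = \<phi> b'" by auto
    have "\<phi> ` {a, b'} = \<phi> ` e" using e(2) b' by simp
    then have "{a, b'} = e" using assms by (simp only: inj_image_eq_iff)
    then have "b' \<in> reach S A" using reach_step[OF a(1)] e(1) by simp
    then show "b \<in> \<phi> ` reach S A" using b' by simp
  qed
  have "reach S A \<subseteq> \<phi> -` reach ((`) \<phi> ` S) (\<phi> ` A)"
  proof (rule reach_subsetI)
    show "A \<subseteq> \<phi> -` reach ((`) \<phi> ` S) (\<phi> ` A)" using subset_reach[of "\<phi> ` A"] by auto
    fix a b assume a: "a \<in> \<phi> -` reach ((`) \<phi> ` S) (\<phi> ` A)" and "{a, b} \<in> S"
    then have "\<phi> ` {a, b} \<in> (`) \<phi> ` S" by (intro imageI)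
    then show "b \<in> \<phi> -` reach ((`) \<phi> ` S) (\<phi> ` A)"
      using a by (auto intro: reach_step)
  qed
  then show "\<phi> ` reach S A \<subseteq> reach ((`) \<phi> ` S) (\<phi> ` A)" by auto
qed

text \<open>Without the edge \<open>{x, y}\<close> the cluster of \<open>v\<close> is still covered by the clusters of \<open>v\<close>, \<open>x\<close> and
  \<open>y\<close>, one of which is therefore infinite.\<close>

lemma infinite_reach_remove_finite:
  assumes "finite D" and "\<forall>e\<in>D. card e = 2" and "infinite (reach S {v})"
  shows "\<exists>w. infinite (reach (S - D) {w})"
  using assms(1,2)
proof (induction D)
  case empty
  then show ?case using assms(3) by auto
next
  case (insert e D)
  then obtain w where w: "infinite (reach (S - D) {w})" by auto
  obtain x y where e: "e = {x, y}" using insert.prems by (auto simp: card_2_iff)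
  let ?S = "S - insert e D"
  have "reach (S - D) {w} \<subseteq> reach (insert {x, y} ?S) {x, w}"
    using e by (intro reach_mono) auto
  also have "\<dots> = reach ?S {y, x, w}" by (simp add: reach_insert_edge)
  also have "\<dots> = reach ?S {y} \<union> reach ?S {x} \<union> reach ?S {w}"
    by (simp add: reach_Un[symmetric] insert_commute)
  finally have "reach (S - D) {w} \<subseteq> reach ?S {y} \<union> reach ?S {x} \<union> reach ?S {w}" .
  then show ?case using w by (meson finite_Un finite_subset)
qed

section \<open>Bond percolation on a countable graph\<close>

text \<open>For measurability it does not matter which \<open>\<sigma>\<close>-algebra the configurations carry, as long
  as the states of the edges in question are measurable; the zero-one law uses the
  \<open>\<sigma>\<close>-algebra generated by all but finitely many edges.\<close>

lemma sets_Collect_reach: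
  assumes "countable T" and e: "\<And>e. e \<in> T \<Longrightarrow> {\<omega> \<in> space N. \<omega> e} \<in> sets N"
  shows "{\<omega> \<in> space N. u \<in> reach {e \<in> T. \<omega> e} A} \<in> sets N"
proof -
  let ?\<F> = "{F. F \<subseteq> T \<and> finite F \<and> u \<in> reach F A}"
  have "u \<in> reach {e \<in> T. \<omega> e} A \<longleftrightarrow> (\<exists>F\<in>?\<F>. \<forall>e\<in>F. \<omega> e)" for \<omega>
  proof
    assume "u \<in> reach {e \<in> T. \<omega> e} A"
    from reach_finite_edges[OF this] show "\<exists>F\<in>?\<F>. \<forall>e\<in>F. \<omega> e" by auto
  next
    assume "\<exists>F\<in>?\<F>. \<forall>e\<in>F. \<omega> e"
    then obtain F where F: "F \<subseteq> {e \<in> T. \<omega> e}" "u \<in> reach F A" by auto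
    then show "u \<in> reach {e \<in> T. \<omega> e} A" using reach_mono[OF F(1) subset_refl] by auto
  qed
  then have "{\<omega> \<in> space N. u \<in> reach {e \<in> T. \<omega> e} A} = {\<omega> \<in> space N. \<exists>F\<in>?\<F>. \<forall>e\<in>F. \<omega> e}" by simp
  also have "\<dots> \<in> sets N"
  proof (rule sets.sets_Collect_countable_Ex')
    have "countable {F. finite F \<and> F \<subseteq> T}" by (rule countable_Collect_finite_subset[OF assms(1)])
    then show "countable ?\<F>" by (rule countable_subset[rotated]) auto
    show "{\<omega> \<in> space N. \<forall>e\<in>F. \<omega> e} \<in> sets N" if "F \<in> ?\<F>" for F
      using that by (intro sets.sets_Collect_countable_All' e) (auto intro: countable_finite)
  qed
  finally show ?thesis .
qed

lemma sets_Collect_reach_eq: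
  fixes A :: "'v::countable set"
  assumes "countable T" and "\<And>e. e \<in> T \<Longrightarrow> {\<omega> \<in> space N. \<omega> e} \<in> sets N"
  shows "{\<omega> \<in> space N. reach {e \<in> T. \<omega> e} A = B} \<in> sets N"
proof -
  have "{\<omega> \<in> space N. reach {e \<in> T. \<omega> e} A = B} =
        {\<omega> \<in> space N. \<forall>u. (u \<in> reach {e \<in> T. \<omega> e} A) = (u \<in> B)}"
    by (auto simp: set_eq_iff)
  also have "\<dots> \<in> sets N"
  proof (intro sets.sets_Collect_countable_All)
    fix u
    have "{\<omega> \<in> space N. u \<in> reach {e \<in> T. \<omega> e} A} \<in> sets N" by (rule sets_Collect_reach[OF assms])
    then show "{\<omega> \<in> space N. (u \<in> reach {e \<in> T. \<omega> e} A) = (u \<in> B)} \<in> sets N"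
      by (cases "u \<in> B") (auto intro: sets.sets_Collect_neg)
  qed
  finally show ?thesis .
qed

lemma sets_Collect_finite_reach:
  fixes A :: "'v::countable set"
  assumes "countable T" and "\<And>e. e \<in> T \<Longrightarrow> {\<omega> \<in> space N. \<omega> e} \<in> sets N"
  shows "{\<omega> \<in> space N. finite (reach {e \<in> T. \<omega> e} A) \<and> Q (reach {e \<in> T. \<omega> e} A)} \<in> sets N"
proof -
  have "{\<omega> \<in> space N. finite (reach {e \<in> T. \<omega> e} A) \<and> Q (reach {e \<in> T. \<omega> e} A)} =
    {\<omega> \<in> space N. \<exists>B\<in>{B. finite B \<and> Q B}. reach {e \<in> T. \<omega> e} A = B}" by auto
  also have "\<dots> \<in> sets N"
  proof (rule sets.sets_Collect_countable_Ex')
    have "countable {B :: 'v set. finite B}" by (rule countable_Collect_finite)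
    then show "countable {B :: 'v set. finite B \<and> Q B}" by (rule countable_subset[rotated]) auto
  qed (rule sets_Collect_reach_eq[OF assms])
  finally show ?thesis .
qed

locale countable_graph =
  fixes H :: "'v::countable graph"
  assumes card_edge: "e \<in> edges H \<Longrightarrow> card e = 2"
begin

lemma countable_edges: "countable (edges H)"
proof (rule countable_subset)
  show "edges H \<subseteq> {B. finite B}"
    using card_edge by (auto intro!: card_ge_0_finite)
qed (rule countable_Collect_finite)

lemma finite_open_cluster_finite_edges:
  "finite E \<Longrightarrow> E \<subseteq> edges H \<Longrightarrow> finite (reach {e \<in> E. \<omega> e} {v})"
  by (rule finite_reach_doubletons[of E]) (auto simp: card_edge)

end

lemma open_cluster_cong:
  "(\<And>e. e \<in> edges H \<Longrightarrow> \<omega> e = \<omega>' e) \<Longrightarrow> open_cluster H \<omega> v = open_cluster H \<omega>' v"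
  unfolding open_cluster_eq_reach by (metis (mono_tags, lifting) Collect_cong)

lemma self_in_open_cluster: "v \<in> open_cluster H \<omega> v"
  by (simp add: open_cluster_def)

lemma card_open_cluster_pos: "finite (open_cluster H \<omega> v) \<Longrightarrow> 1 \<le> card (open_cluster H \<omega> v)"
  using self_in_open_cluster[of v H \<omega>] by (metis One_nat_def Suc_leI card_gt_0_iff empty_iff)

lemma prob_space_percolation: "prob_space (percolation H p)"
  unfolding percolation_def by (intro prob_space_PiM prob_space_measure_pmf)

lemma sets_edge_open: "e \<in> edges H \<Longrightarrow> {\<omega> \<in> space (percolation H p). \<omega> e} \<in> sets (percolation H p)"
  unfolding percolation_def by (rule sets_Collect_single') auto

lemma measurable_percolation_restrict:
  assumes "f \<in> T \<rightarrow> edges H"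
  shows "(\<lambda>\<omega>. \<lambda>e\<in>T. \<omega> (f e)) \<in> percolation H p \<rightarrow>\<^sub>M PiM T (\<lambda>_. measure_pmf (bernoulli_pmf p))"
  unfolding percolation_def using assms
  by (intro measurable_restrict measurable_component_singleton) auto

lemma distr_percolation_reindex:
  assumes "inj_on f (edges H')" and "f \<in> edges H' \<rightarrow> edges H"
  shows "distr (percolation H p) (percolation H' p) (\<lambda>\<omega>. \<lambda>e\<in>edges H'. \<omega> (f e)) = percolation H' p"
  unfolding percolation_def
  by (rule distr_PiM_reindex[OF _ assms]) (rule prob_space_measure_pmf)

lemma indep_vars_edges:
  "prob_space.indep_vars (percolation H p) (\<lambda>_. measure_pmf (bernoulli_pmf p)) (\<lambda>e \<omega>. \<omega> e) (edges H)"
proof -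
  interpret P: prob_space "percolation H p" by (rule prob_space_percolation)
  interpret PP: product_prob_space "\<lambda>_. measure_pmf (bernoulli_pmf p)" "edges H"
    by unfold_locales
  show ?thesis
  proof (cases "edges H = {}")
    case True
    then show ?thesis by (simp add: P.indep_vars_def P.indep_sets_def)
  next
    case False
    have rv: "(\<lambda>\<omega>. \<omega> e) \<in> percolation H p \<rightarrow>\<^sub>M measure_pmf (bernoulli_pmf p)" if "e \<in> edges H" for e
      unfolding percolation_def using that by (rule measurable_component_singleton)
    have "distr (percolation H p) (\<Pi>\<^sub>M e\<in>edges H. measure_pmf (bernoulli_pmf p)) (\<lambda>\<omega>. \<lambda>e\<in>edges H. \<omega> e)
        = distr (percolation H p) (percolation H p) (\<lambda>\<omega>. \<omega>)"
      by (intro distr_cong) (auto simp: percolation_def space_PiM)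
    also have "\<dots> = (\<Pi>\<^sub>M e\<in>edges H. distr (percolation H p) (measure_pmf (bernoulli_pmf p)) (\<lambda>\<omega>. \<omega> e))"
      unfolding distr_id percolation_def
      by (intro PiM_cong refl) (simp add: PP.PiM_component)
    finally show ?thesis
      using P.indep_vars_iff_distr_eq_PiM'[OF False rv] by simp
  qed
qed

text \<open>Independence over disjoint sets of edges, in the multiplicative form in which the weights of
  clusters factorise.\<close>

lemma nn_integral_percolation_prod:
  fixes Z :: "'k \<Rightarrow> ('v set \<Rightarrow> bool) \<Rightarrow> ennreal"
  assumes "finite K" and J: "\<And>k. k \<in> K \<Longrightarrow> J k \<subseteq> edges H" and disj: "disjoint_family_on J K"
    and Z: "\<And>k. k \<in> K \<Longrightarrow> Z k \<in> borel_measurable (percolation H p)"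
    and dep: "\<And>k \<omega> \<omega>'. k \<in> K \<Longrightarrow> (\<And>e. e \<in> J k \<Longrightarrow> \<omega> e = \<omega>' e) \<Longrightarrow> Z k \<omega> = Z k \<omega>'"
  shows "(\<integral>\<^sup>+\<omega>. (\<Prod>k\<in>K. Z k \<omega>) \<partial>percolation H p) = (\<Prod>k\<in>K. \<integral>\<^sup>+\<omega>. Z k \<omega> \<partial>percolation H p)"
proof -
  interpret P: prob_space "percolation H p" by (rule prob_space_percolation)
  let ?M = "\<lambda>_. measure_pmf (bernoulli_pmf p)"
  \<comment> \<open>\<open>Z k\<close> is a function of the configuration on \<open>J k\<close>, extended by closed edges.\<close>
  define ext where "ext = (\<lambda>k \<omega>. \<lambda>e\<in>edges H. if e \<in> J k then \<omega> e else False)"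
  have ext: "ext k \<in> PiM (J k) ?M \<rightarrow>\<^sub>M percolation H p" for k
    unfolding ext_def percolation_def
    by (intro measurable_restrict) (auto intro: measurable_component_singleton)
  have "P.indep_vars (\<lambda>k. PiM (J k) ?M) (\<lambda>k \<omega>. restrict (\<lambda>e. \<omega> e) (J k)) K"
    by (rule P.indep_vars_restrict[OF indep_vars_edges J disj])
  then have "P.indep_vars (\<lambda>_. borel) (\<lambda>k \<omega>. Z k (ext k (restrict (\<lambda>e. \<omega> e) (J k)))) K"
    by (rule P.indep_vars_compose2) (rule measurable_compose[OF ext Z])
  moreover have "Z k (ext k (restrict (\<lambda>e. \<omega> e) (J k))) = Z k \<omega>" if "k \<in> K" for k \<omega>
    using J[OF that] by (intro dep that) (auto simp: ext_def)
  ultimately have "P.indep_vars (\<lambda>_. borel) Z K"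
    by (subst P.indep_vars_cong[OF refl _ refl,
          where Y = "\<lambda>k \<omega>. Z k (ext k (restrict (\<lambda>e. \<omega> e) (J k)))"]) auto
  then show ?thesis by (intro P.indep_vars_nn_integral \<open>finite K\<close>) auto
qed

lemma prob_open_edges:
  assumes "finite E" "E \<subseteq> edges H" and p: "0 \<le> p" "p \<le> 1"
  shows sets_open_edges: "{\<omega> \<in> space (percolation H p). Q {e \<in> E. \<omega> e}} \<in> sets (percolation H p)"
    and "measure (percolation H p) {\<omega> \<in> space (percolation H p). Q {e \<in> E. \<omega> e}}
           = bernoulli_sum p E (\<lambda>S. of_bool (Q S))"
proof -
  let ?M = "percolation H p"
  interpret P: prob_space ?M by (rule prob_space_percolation)
  interpret PP: product_prob_space "\<lambda>_. measure_pmf (bernoulli_pmf p)" "edges H"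
    by unfold_locales
  define A where "A S = {\<omega> \<in> space ?M. \<forall>e\<in>E. \<omega> e \<in> {e \<in> S}}" for S
  have A: "A S \<in> sets ?M" for S
    unfolding A_def percolation_def using assms
    by (intro sets.sets_Collect_countable_All' sets_Collect_single') (auto intro: countable_finite)
  have PA: "measure ?M (A S) = p ^ card S * (1 - p) ^ card (E - S)" if "S \<subseteq> E" for S
  proof -
    have "emeasure ?M (A S) = (\<Prod>e\<in>E. emeasure (measure_pmf (bernoulli_pmf p)) {e \<in> S})"
      unfolding A_def percolation_def using assms by (intro PP.emeasure_PiM_Collect) auto
    also have "\<dots> = (\<Prod>e\<in>E. ennreal (if e \<in> S then p else 1 - p))"
      using p by (intro prod.cong refl) (auto simp: emeasure_pmf_single)
    also have "\<dots> = ennreal (\<Prod>e\<in>E. if e \<in> S then p else 1 - p)"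
      using p by (intro prod_ennreal) auto
    also have "(\<Prod>e\<in>E. if e \<in> S then p else 1 - p) = p ^ card S * (1 - p) ^ card (E - S)"
      using that assms(1) by (simp add: prod.If_cases Int_absorb1 Diff_eq)
    finally show ?thesis using p by (simp add: measure_def)
  qed
  have eq: "{\<omega> \<in> space ?M. Q {e \<in> E. \<omega> e}} = (\<Union>S\<in>{S\<in>Pow E. Q S}. A S)"
  proof (intro equalityI subsetI)
    fix \<omega> assume \<omega>: "\<omega> \<in> {\<omega> \<in> space ?M. Q {e \<in> E. \<omega> e}}"
    then show "\<omega> \<in> (\<Union>S\<in>{S\<in>Pow E. Q S}. A S)"
      by (intro UN_I[of "{e \<in> E. \<omega> e}"]) (auto simp: A_def)
  next
    fix \<omega> assume "\<omega> \<in> (\<Union>S\<in>{S\<in>Pow E. Q S}. A S)"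
    then obtain S where S: "S \<subseteq> E" "Q S" "\<omega> \<in> A S" by auto
    then have "{e \<in> E. \<omega> e} = S" by (auto simp: A_def)
    then show "\<omega> \<in> {\<omega> \<in> space ?M. Q {e \<in> E. \<omega> e}}" using S by (auto simp: A_def)
  qed
  show "{\<omega> \<in> space ?M. Q {e \<in> E. \<omega> e}} \<in> sets ?M"
    unfolding eq using assms A by (intro sets.finite_UN) auto
  have "measure ?M {\<omega> \<in> space ?M. Q {e \<in> E. \<omega> e}} = (\<Sum>S\<in>{S\<in>Pow E. Q S}. measure ?M (A S))"
    unfolding eq
  proof (rule P.finite_measure_finite_Union)
    show "disjoint_family_on A {S\<in>Pow E. Q S}"
      unfolding disjoint_family_on_def
    proof (intro ballI impI)
      fix S T assume "S \<in> {S\<in>Pow E. Q S}" "T \<in> {S\<in>Pow E. Q S}" "S \<noteq> T"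
      then obtain e where "e \<in> E" "(e \<in> S) \<noteq> (e \<in> T)" by blast
      then show "A S \<inter> A T = {}" by (auto simp: A_def)
    qed
  qed (use assms A in auto)
  also have "\<dots> = (\<Sum>S\<in>{S\<in>Pow E. Q S}. p ^ card S * (1 - p) ^ card (E - S))"
    using PA by (intro sum.cong) auto
  also have "\<dots> = bernoulli_sum p E (\<lambda>S. of_bool (Q S))"
    unfolding bernoulli_sum_def using assms(1)
    by (intro sum.mono_neutral_cong_left) auto
  finally show "measure ?M {\<omega> \<in> space ?M. Q {e \<in> E. \<omega> e}} = bernoulli_sum p E (\<lambda>S. of_bool (Q S))" .
qed

context countable_graph
begin

lemma sets_Collect_finite_cluster:
  "{\<omega> \<in> space (percolation H p). finite (open_cluster H \<omega> v) \<and> Q (open_cluster H \<omega> v)}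
     \<in> sets (percolation H p)"
  unfolding open_cluster_eq_reach
  by (rule sets_Collect_finite_reach[OF countable_edges sets_edge_open])

lemma sets_Collect_cluster_eq:
  "{\<omega> \<in> space (percolation H p). open_cluster H \<omega> v = B} \<in> sets (percolation H p)"
  unfolding open_cluster_eq_reach
  by (rule sets_Collect_reach_eq[OF countable_edges sets_edge_open])

lemma measurable_finite_cluster [measurable]:
  fixes f :: "'v set \<Rightarrow> ennreal"
  shows "(\<lambda>\<omega>. if finite (open_cluster H \<omega> v) then f (open_cluster H \<omega> v) else c)
           \<in> borel_measurable (percolation H p)"
proof -
  let ?M = "percolation H p"
  let ?T = "insert None (Some ` {B :: 'v set. finite B})"
  let ?g = "\<lambda>\<omega>. if finite (open_cluster H \<omega> v) then Some (open_cluster H \<omega> v) else None"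
  have T: "countable ?T" using countable_Collect_finite by auto
  have "?g -` {a} \<inter> space ?M \<in> sets ?M" if "a \<in> ?T" for a
  proof (cases a)
    case None
    have "?g -` {a} \<inter> space ?M = space ?M - {\<omega> \<in> space ?M. finite (open_cluster H \<omega> v) \<and> True}"
      using None by (auto split: if_splits)
    then show ?thesis using sets_Collect_finite_cluster[of p v "\<lambda>_. True"] by auto
  next
    case (Some B)
    then have "?g -` {a} \<inter> space ?M = {\<omega> \<in> space ?M. open_cluster H \<omega> v = B}"
      using that by (auto split: if_splits)
    then show ?thesis using sets_Collect_cluster_eq by auto
  qed
  then have "?g \<in> ?M \<rightarrow>\<^sub>M count_space ?T"
    by (subst measurable_count_space_eq_countable[OF T]) auto
  moreover have "(\<lambda>a. case a of None \<Rightarrow> c | Some B \<Rightarrow> f B) \<in> count_space ?T \<rightarrow>\<^sub>M borel"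
    by simp
  ultimately have "(\<lambda>\<omega>. case ?g \<omega> of None \<Rightarrow> c | Some B \<Rightarrow> f B) \<in> borel_measurable ?M"
    by (rule measurable_compose)
  also have "(\<lambda>\<omega>. case ?g \<omega> of None \<Rightarrow> c | Some B \<Rightarrow> f B) =
      (\<lambda>\<omega>. if finite (open_cluster H \<omega> v) then f (open_cluster H \<omega> v) else c)" by auto
  finally show ?thesis .
qed

end

section \<open>Kolmogorov's law for the existence of an infinite cluster\<close>

context countable_graph
begin

text \<open>Closing finitely many edges does not destroy the last infinite cluster, so its existence
  is a tail event.\<close>

lemma prob_infinite_cluster_0_1:
  "measure (percolation H p) {\<omega> \<in> space (percolation H p). \<exists>v. infinite (open_cluster H \<omega> v)} = 0 \<or>
   measure (percolation H p) {\<omega> \<in> space (percolation H p). \<exists>v. infinite (open_cluster H \<omega> v)} = 1"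
proof -
  let ?M = "percolation H p"
  interpret P: prob_space ?M by (rule prob_space_percolation)
  let ?ix = "to_nat_on (edges H)"
  let ?B = "\<lambda>_. measure_pmf (bernoulli_pmf p)"
  let ?J = "\<lambda>i. {e \<in> edges H. ?ix e = i}"
  define A where "A i = {(\<lambda>\<omega>. restrict (\<lambda>e. \<omega> e) (?J i)) -` X \<inter> space ?M | X. X \<in> sets (PiM (?J i) ?B)}"
    for i
  have "P.indep_vars (\<lambda>i. PiM (?J i) ?B) (\<lambda>i \<omega>. restrict (\<lambda>e. \<omega> e) (?J i)) UNIV"
    by (rule P.indep_vars_restrict[OF indep_vars_edges]) (auto simp: disjoint_family_on_def)
  then have indep: "P.indep_sets (\<lambda>i. sigma_sets (space ?M) (A i)) UNIV"
    by (simp add: P.indep_vars_def A_def)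
  let ?X = "{\<omega> \<in> space ?M. \<exists>v. infinite (open_cluster H \<omega> v)}"
  have A: "A i \<subseteq> Pow (space ?M)" for i by (auto simp: A_def)
  have "?X \<in> P.tail_events (\<lambda>i. sigma_sets (space ?M) (A i))"
    unfolding P.tail_events_def
  proof
    fix n
    let ?G = "\<Union>i\<in>{n..}. sigma_sets (space ?M) (A i)"
    define N where "N = sigma (space ?M) ?G"
    have G: "?G \<subseteq> Pow (space ?M)" using sigma_sets_into_sp[OF A] by blast
    have N: "space N = space ?M" "sets N = sigma_sets (space ?M) ?G"
      using G by (simp_all add: N_def)
    let ?T = "{e \<in> edges H. n \<le> ?ix e}"
    have e: "{\<omega> \<in> space N. \<omega> e} \<in> sets N" if "e \<in> ?T" for e
    proof -
      let ?i = "?ix e"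
      have "{\<omega> \<in> space N. \<omega> e} =
        (\<lambda>\<omega>. restrict (\<lambda>e. \<omega> e) (?J ?i)) -` {x \<in> space (PiM (?J ?i) ?B). x e} \<inter> space ?M"
        using that by (auto simp: N space_PiM)
      also have "\<dots> \<in> A ?i"
      proof -
        have "{x \<in> space (PiM (?J ?i) ?B). x e} \<in> sets (PiM (?J ?i) ?B)"
          using that by (intro sets_Collect_single') auto
        then show ?thesis unfolding A_def by blast
      qed
      finally have "{\<omega> \<in> space N. \<omega> e} \<in> ?G" using that by (auto intro: sigma_sets.Basic)
      then show ?thesis unfolding N by (rule sigma_sets.Basic)
    qed
    have fin: "finite (edges H - ?T)"
    proof (rule inj_on_finite[of ?ix])
      show "inj_on ?ix (edges H - ?T)"
        using inj_on_to_nat_on[OF countable_edges] by (rule inj_on_subset) auto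
      show "?ix ` (edges H - ?T) \<subseteq> {..<n}" by auto
      show "finite {..<n}" by simp
    qed
    have "(\<exists>v. infinite (open_cluster H \<omega> v)) \<longleftrightarrow> (\<exists>v. \<not> (finite (reach {e \<in> ?T. \<omega> e} {v}) \<and> True))" for \<omega>
    proof
      assume "\<exists>v. infinite (open_cluster H \<omega> v)"
      then obtain v where "infinite (reach {e \<in> edges H. \<omega> e} {v})"
        by (auto simp: open_cluster_eq_reach)
      from infinite_reach_remove_finite[OF fin _ this] card_edge
      obtain w where "infinite (reach ({e \<in> edges H. \<omega> e} - (edges H - ?T)) {w})" by auto
      moreover have "{e \<in> edges H. \<omega> e} - (edges H - ?T) = {e \<in> ?T. \<omega> e}" by auto
      ultimately show "\<exists>v. \<not> (finite (reach {e \<in> ?T. \<omega> e} {v}) \<and> True)" by auto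
    next
      assume "\<exists>v. \<not> (finite (reach {e \<in> ?T. \<omega> e} {v}) \<and> True)"
      then obtain v where "infinite (reach {e \<in> ?T. \<omega> e} {v})" by auto
      moreover have "reach {e \<in> ?T. \<omega> e} {v} \<subseteq> open_cluster H \<omega> v"
        unfolding open_cluster_eq_reach by (rule reach_mono) auto
      ultimately show "\<exists>v. infinite (open_cluster H \<omega> v)" by (auto dest: finite_subset)
    qed
    then have "?X = {\<omega> \<in> space N. \<exists>v. \<not> (finite (reach {e \<in> ?T. \<omega> e} {v}) \<and> True)}"
      by (simp add: N)
    also have "\<dots> \<in> sets N"
    proof (intro sets.sets_Collect_countable_Ex sets.sets_Collect_neg)
      show "{\<omega> \<in> space N. finite (reach {e \<in> ?T. \<omega> e} {v}) \<and> True} \<in> sets N" for v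
        using countable_edges by (intro sets_Collect_finite_reach e) auto
    qed
    finally show "?X \<in> sigma_sets (space ?M) ?G" by (simp add: N)
  qed
  then show ?thesis
    by (intro P.kolmogorov_0_1_law[OF _ indep] sigma_algebra_sigma_sets A)
qed

section \<open>Exponential decay of the cluster size below the critical point\<close>

lemma sets_large_cluster:
  "{\<omega> \<in> space (percolation H p). \<not> (finite (open_cluster H \<omega> v) \<and> card (open_cluster H \<omega> v) < k)}
     \<in> sets (percolation H p)"
  by (intro sets.sets_Collect_neg sets_Collect_finite_cluster[where Q = "\<lambda>C. card C < k"])

lemma large_cluster_finite_edges:
  assumes "finite E" "E \<subseteq> edges H" "k \<le> card (reach {e \<in> E. \<omega> e} {v})"
  shows "\<not> (finite (open_cluster H \<omega> v) \<and> card (open_cluster H \<omega> v) < k)"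
proof
  assume C: "finite (open_cluster H \<omega> v) \<and> card (open_cluster H \<omega> v) < k"
  have "reach {e \<in> E. \<omega> e} {v} \<subseteq> open_cluster H \<omega> v"
    unfolding open_cluster_eq_reach using assms(2) by (intro reach_mono) auto
  then have "card (reach {e \<in> E. \<omega> e} {v}) \<le> card (open_cluster H \<omega> v)"
    using C by (intro card_mono) auto
  then show False using C assms(3) by linarith
qed

text \<open>That a cluster has at least \<open>k\<close> vertices is witnessed by finitely many open edges, so bounds that
  hold uniformly over finite sets of edges pass to the whole graph.\<close>

lemma large_cluster_le:
  assumes le: "\<And>E. finite E \<Longrightarrow> E \<subseteq> edges H \<Longrightarrow>
      measure (percolation H p) {\<omega> \<in> space (percolation H p). k \<le> card (reach {e \<in> E. \<omega> e} {v})} \<le> c"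
    and p: "0 \<le> p" "p \<le> 1"
  shows "measure (percolation H p) {\<omega> \<in> space (percolation H p).
      \<not> (finite (open_cluster H \<omega> v) \<and> card (open_cluster H \<omega> v) < k)} \<le> c"
proof -
  let ?M = "percolation H p"
  interpret P: prob_space ?M by (rule prob_space_percolation)
  let ?ix = "to_nat_on (edges H)"
  define E where "E n = {e \<in> edges H. ?ix e < n}" for n
  have E: "finite (E n)" "E n \<subseteq> edges H" for n
  proof -
    show "finite (E n)"
      using inj_on_to_nat_on[OF countable_edges]
      by (intro inj_on_finite[of ?ix "E n" "{..<n}"]) (auto simp: E_def intro: inj_on_subset)
  qed (auto simp: E_def)
  define A where "A n = {\<omega> \<in> space ?M. k \<le> card (reach {e \<in> E n. \<omega> e} {v})}" for n
  have A: "A n \<in> sets ?M" for n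
    unfolding A_def using E p by (rule sets_open_edges)
  have "incseq A"
  proof (rule incseq_SucI, rule subsetI)
    fix n \<omega> assume \<omega>: "\<omega> \<in> A n"
    have "reach {e \<in> E n. \<omega> e} {v} \<subseteq> reach {e \<in> E (Suc n). \<omega> e} {v}"
      by (rule reach_mono) (auto simp: E_def)
    then have "card (reach {e \<in> E n. \<omega> e} {v}) \<le> card (reach {e \<in> E (Suc n). \<omega> e} {v})"
      by (intro card_mono finite_open_cluster_finite_edges E)
    then show "\<omega> \<in> A (Suc n)" using \<omega> by (auto simp: A_def)
  qed
  moreover have "(\<Union>n. A n) = {\<omega> \<in> space ?M. \<not> (finite (open_cluster H \<omega> v) \<and> card (open_cluster H \<omega> v) < k)}"
    (is "_ = ?L")
  proof (intro equalityI subsetI)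
    fix \<omega> assume "\<omega> \<in> (\<Union>n. A n)"
    then show "\<omega> \<in> ?L" using large_cluster_finite_edges[OF E] by (auto simp: A_def)
  next
    fix \<omega> assume \<omega>: "\<omega> \<in> ?L"
    have "\<exists>B\<subseteq>open_cluster H \<omega> v. finite B \<and> card B = k"
    proof (cases "finite (open_cluster H \<omega> v)")
      case True
      then have "k \<le> card (open_cluster H \<omega> v)" using \<omega> by auto
      from obtain_subset_with_card_n[OF this] True show ?thesis by (metis finite_subset)
    next
      case False
      then show ?thesis using infinite_arbitrarily_large by blast
    qed
    then obtain B where B: "B \<subseteq> open_cluster H \<omega> v" "finite B" "card B = k" by auto
    have "\<forall>b\<in>B. \<exists>F\<subseteq>{e \<in> edges H. \<omega> e}. finite F \<and> b \<in> reach F {v}"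
    proof
      fix b assume "b \<in> B"
      then have "b \<in> reach {e \<in> edges H. \<omega> e} {v}" using B(1) by (auto simp: open_cluster_eq_reach)
      then show "\<exists>F\<subseteq>{e \<in> edges H. \<omega> e}. finite F \<and> b \<in> reach F {v}"
        by (rule reach_finite_edges)
    qed
    then obtain F where F: "\<And>b. b \<in> B \<Longrightarrow> F b \<subseteq> {e \<in> edges H. \<omega> e} \<and> finite (F b) \<and> b \<in> reach (F b) {v}"
      by metis
    let ?F = "\<Union>b\<in>B. F b"
    have fin: "finite ?F" using B(2) F by blast
    obtain n where n: "\<forall>i\<in>?ix ` ?F. i < n"
      using finite_nat_set_iff_bounded[of "?ix ` ?F"] fin by auto
    have "b \<in> reach {e \<in> E n. \<omega> e} {v}" if "b \<in> B" for b
    proof -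
      have "F b \<subseteq> {e \<in> E n. \<omega> e}" using F[OF that] n that by (auto simp: E_def)
      from reach_mono[OF this subset_refl] F[OF that] show ?thesis by auto
    qed
    then have "card B \<le> card (reach {e \<in> E n. \<omega> e} {v})"
      by (intro card_mono finite_open_cluster_finite_edges E) auto
    then show "\<omega> \<in> (\<Union>n. A n)" using B(3) \<omega> by (auto simp: A_def)
  qed
  ultimately have "(\<lambda>n. measure ?M (A n)) \<longlonglongrightarrow> measure ?M ?L"
    using P.finite_Lim_measure_incseq[of A] A by auto
  then show ?thesis
    by (rule LIMSEQ_le_const2) (unfold A_def, intro exI allI impI le E)
qed

text \<open>If the cluster sizes at \<open>p\<close> are uniformly tight, clusters are uniformly unlikely to meet
  a sufficiently sparse set of green vertices, and the comparison of the cluster conditioned to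
  avoid green with the cluster at \<open>q < p\<close> yields an exponential tail at \<open>q\<close>.\<close>

lemma exponential_cluster_tail:
  assumes q: "0 \<le> q" "q < p" "p \<le> 1"
    and tight: "\<And>\<epsilon>. 0 < \<epsilon> \<Longrightarrow> \<exists>N. \<forall>y. measure (percolation H p) {\<omega> \<in> space (percolation H p).
      \<not> (finite (open_cluster H \<omega> y) \<and> card (open_cluster H \<omega> y) < N)} \<le> \<epsilon>"
  shows "\<exists>s K. 0 < s \<and> s < 1 \<and> (\<forall>k v. measure (percolation H q) {\<omega> \<in> space (percolation H q).
      \<not> (finite (open_cluster H \<omega> v) \<and> card (open_cluster H \<omega> v) < k)} \<le> K * s ^ k)"
proof -
  interpret P: prob_space "percolation H p" by (rule prob_space_percolation)
  have p: "0 \<le> p" "p \<le> 1" "0 < p" using q by auto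
  define \<rho> \<alpha> where "\<rho> = q / p" and "\<alpha> = (\<rho> + 1) / 2"
  have \<rho>: "0 \<le> \<rho>" "\<rho> < 1" "p * \<rho> = q" using q p by (auto simp: \<rho>_def)
  then have \<alpha>: "0 < \<alpha>" "\<alpha> < 1" "\<rho> \<le> \<alpha>" by (auto simp: \<alpha>_def)
  then have q\<alpha>: "q \<le> p * \<alpha>" using mult_left_mono[of \<rho> \<alpha> p] p \<rho>(3) by simp
  \<comment> \<open>The factor \<open>\<alpha> < 1\<close> is shared between \<open>s ^ N\<close> and the probability \<open>(1 + \<alpha>) / 2\<close> of a cluster
    with fewer than \<open>N\<close> vertices.\<close>
  define \<beta> where "\<beta> = \<alpha> / ((1 + \<alpha>) / 2)"
  have \<beta>: "0 < \<beta>" "\<beta> < 1" "\<beta> * ((1 + \<alpha>) / 2) = \<alpha>" using \<alpha> by (auto simp: \<beta>_def field_simps)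
  obtain N where N: "measure (percolation H p) {\<omega> \<in> space (percolation H p).
      \<not> (finite (open_cluster H \<omega> y) \<and> card (open_cluster H \<omega> y) < N)} \<le> (1 - \<alpha>) / 2" for y
    using tight[of "(1 - \<alpha>) / 2"] \<alpha> by auto
  define s where "s = 1 - (1 - \<beta>) / (real N + 1)"
  have "(1 - \<beta>) / (real N + 1) \<le> (1 - \<beta>) / 1" using \<beta> by (intro divide_left_mono) auto
  then have s: "0 < s" "s < 1" using \<beta> by (auto simp: s_def)
  have "1 + real N * (- ((1 - \<beta>) / (real N + 1))) \<le> (1 + - ((1 - \<beta>) / (real N + 1))) ^ N"
    using s by (intro Bernoulli_inequality) (simp add: s_def)
  moreover have "real N * ((1 - \<beta>) / (real N + 1)) \<le> 1 - \<beta>"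
    using \<beta> by (simp add: field_simps)
  ultimately have sN: "\<beta> \<le> s ^ N" by (simp add: s_def)
  have bound: "\<alpha> \<le> bernoulli_sum p E (\<lambda>S. s ^ card (reach S {y}))" if E: "finite E" "E \<subseteq> edges H" for E y
  proof -
    let ?L = "{\<omega> \<in> space (percolation H p).
      \<not> (finite (open_cluster H \<omega> y) \<and> card (open_cluster H \<omega> y) < N)}"
    let ?S = "{\<omega> \<in> space (percolation H p). card (reach {e \<in> E. \<omega> e} {y}) < N}"
    have "space (percolation H p) - ?L \<subseteq> ?S"
      using large_cluster_finite_edges[OF E] by (auto simp: not_le[symmetric])
    then have "1 - measure (percolation H p) ?L \<le> measure (percolation H p) ?S"
      using sets_large_cluster
      by (subst P.prob_compl[symmetric])
        (auto intro!: P.finite_measure_mono sets_open_edges E p)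
    then have "(1 + \<alpha>) / 2 \<le> measure (percolation H p) ?S" using N[of y] by (simp add: field_simps)
    also have "\<dots> = bernoulli_sum p E (\<lambda>S. of_bool (card (reach S {y}) < N))"
      by (rule prob_open_edges[OF E p(1,2)])
    finally have "\<beta> * ((1 + \<alpha>) / 2) \<le> s ^ N * bernoulli_sum p E (\<lambda>S. of_bool (card (reach S {y}) < N))"
      using sN \<beta> \<alpha> by (intro mult_mono) auto
    also have "\<dots> = bernoulli_sum p E (\<lambda>S. s ^ N * of_bool (card (reach S {y}) < N))"
      by (simp add: bernoulli_sum_cmult)
    also have "\<dots> \<le> bernoulli_sum p E (\<lambda>S. s ^ card (reach S {y}))"
      using s by (intro bernoulli_sum_mono p) (auto intro: power_decreasing)
    finally show ?thesis using \<beta> by simp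
  qed
  have "measure (percolation H q) {\<omega> \<in> space (percolation H q).
      \<not> (finite (open_cluster H \<omega> v) \<and> card (open_cluster H \<omega> v) < k)} \<le> 1 / \<alpha> * s ^ k" for k v
  proof (rule large_cluster_le)
    fix E assume E: "finite E" "E \<subseteq> edges H"
    have "measure (percolation H q) {\<omega> \<in> space (percolation H q). k \<le> card (reach {e \<in> E. \<omega> e} {v})}
        = bernoulli_sum q E (\<lambda>S. of_bool (k \<le> card (reach S {v})))"
      using q by (intro prob_open_edges E) auto
    also have "\<dots> \<le> s ^ k / \<alpha>"
    proof (rule cluster_size_tail)
      show "\<alpha> \<le> bernoulli_sum p E' (\<lambda>S. s ^ card (reach S {y}))" if "E' \<subseteq> E" for E' y
        using that E by (intro bound) (auto intro: finite_subset)
    qed (use E card_edge q p s \<alpha> q\<alpha> in auto)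
    finally show "measure (percolation H q) {\<omega> \<in> space (percolation H q).
        k \<le> card (reach {e \<in> E. \<omega> e} {v})} \<le> 1 / \<alpha> * s ^ k" by simp
  qed (use q in auto)
  then show ?thesis using s by blast
qed

end

section \<open>Generating functions of cluster sizes\<close>

text \<open>The expectation of \<open>u ^ |C|\<close> on the event that \<open>C\<close> is finite. Values in \<^typ>\<open>ennreal\<close> allow
  \<open>u > 1\<close> before convergence is known.\<close>

definition cluster_gf :: "'v graph \<Rightarrow> real \<Rightarrow> 'v \<Rightarrow> ennreal \<Rightarrow> ennreal" where
  "cluster_gf H p v u = (\<integral>\<^sup>+\<omega>. (if finite (open_cluster H \<omega> v) then u ^ card (open_cluster H \<omega> v) else 0)
     \<partial>percolation H p)"

text \<open>A random set that is finite takes one of countably many values, over which the expectation can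
  be decomposed.\<close>

lemma nn_integral_finite_set_valued:
  fixes F :: "'a \<Rightarrow> 'v::countable set \<Rightarrow> ennreal"
  assumes "\<And>B. finite B \<Longrightarrow> (\<lambda>\<omega>. F \<omega> B) \<in> borel_measurable M"
    and C: "\<And>B. {\<omega> \<in> space M. C \<omega> = B} \<in> sets M"
  shows "(\<integral>\<^sup>+\<omega>. (if finite (C \<omega>) then F \<omega> (C \<omega>) else 0) \<partial>M) =
    (\<integral>\<^sup>+B. (\<integral>\<^sup>+\<omega>. F \<omega> B * indicator {\<omega> \<in> space M. C \<omega> = B} \<omega> \<partial>M) \<partial>count_space {B :: 'v set. finite B})"
proof -
  let ?\<B> = "{B :: 'v set. finite B}"
  have "(\<integral>\<^sup>+\<omega>. (if finite (C \<omega>) then F \<omega> (C \<omega>) else 0) \<partial>M) =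
    (\<integral>\<^sup>+\<omega>. (\<integral>\<^sup>+B. F \<omega> B * indicator {\<omega> \<in> space M. C \<omega> = B} \<omega> \<partial>count_space ?\<B>) \<partial>M)"
  proof (rule nn_integral_cong)
    fix \<omega> assume \<omega>: "\<omega> \<in> space M"
    have "(\<integral>\<^sup>+B. F \<omega> B * indicator {\<omega> \<in> space M. C \<omega> = B} \<omega> \<partial>count_space ?\<B>) =
      (\<integral>\<^sup>+B. F \<omega> B * indicator {C \<omega>} B \<partial>count_space ?\<B>)"
      using \<omega> by (intro nn_integral_cong) (auto simp: indicator_def)
    also have "\<dots> = (if finite (C \<omega>) then F \<omega> (C \<omega>) else 0)"
    proof (cases "finite (C \<omega>)")
      case True
      then show ?thesis by (subst nn_integral_indicator_singleton) auto
    next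
      case False
      then have "(\<integral>\<^sup>+B. F \<omega> B * indicator {C \<omega>} B \<partial>count_space ?\<B>) = (\<integral>\<^sup>+B. 0 \<partial>count_space ?\<B>)"
        by (intro nn_integral_cong) (auto simp: indicator_def)
      then show ?thesis using False by simp
    qed
    finally show "(if finite (C \<omega>) then F \<omega> (C \<omega>) else 0) =
        (\<integral>\<^sup>+B. F \<omega> B * indicator {\<omega> \<in> space M. C \<omega> = B} \<omega> \<partial>count_space ?\<B>)" by simp
  qed
  also have "\<dots> = (\<integral>\<^sup>+B. (\<integral>\<^sup>+\<omega>. F \<omega> B * indicator {\<omega> \<in> space M. C \<omega> = B} \<omega> \<partial>M) \<partial>count_space ?\<B>)"
    using assms by (intro nn_integral_count_space_nn_integral countable_Collect_finite)
      (auto intro!: borel_measurable_times_ennreal)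
  finally show ?thesis .
qed

lemma nn_integral_percolation_pullback:
  fixes \<phi> :: "('w set \<Rightarrow> bool) \<Rightarrow> ennreal"
  assumes f: "inj_on f (edges H')" "f \<in> edges H' \<rightarrow> edges H"
    and \<phi>: "\<phi> \<in> borel_measurable (percolation H' p)"
    and dep: "\<And>\<omega> \<omega>'. (\<And>e. e \<in> edges H' \<Longrightarrow> \<omega> e = \<omega>' e) \<Longrightarrow> \<phi> \<omega> = \<phi> \<omega>'"
  shows measurable_percolation_pullback: "(\<lambda>\<omega>. \<phi> (\<lambda>e. \<omega> (f e))) \<in> borel_measurable (percolation H p)"
    and "(\<integral>\<^sup>+\<omega>. \<phi> (\<lambda>e. \<omega> (f e)) \<partial>percolation H p) = (\<integral>\<^sup>+\<omega>. \<phi> \<omega> \<partial>percolation H' p)"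
proof -
  let ?r = "\<lambda>\<omega>. \<lambda>e\<in>edges H'. \<omega> (f e)"
  have eq: "\<phi> (\<lambda>e. \<omega> (f e)) = \<phi> (?r \<omega>)" for \<omega> by (rule dep) simp
  have r: "?r \<in> percolation H p \<rightarrow>\<^sub>M percolation H' p"
    using measurable_percolation_restrict[OF f(2)] by (simp add: percolation_def)
  show "(\<lambda>\<omega>. \<phi> (\<lambda>e. \<omega> (f e))) \<in> borel_measurable (percolation H p)"
    unfolding eq by (rule measurable_compose[OF r \<phi>])
  have "(\<integral>\<^sup>+\<omega>. \<phi> \<omega> \<partial>percolation H' p) = (\<integral>\<^sup>+\<omega>. \<phi> \<omega> \<partial>distr (percolation H p) (percolation H' p) ?r)"
    by (simp only: distr_percolation_reindex[OF f])
  also have "\<dots> = (\<integral>\<^sup>+\<omega>. \<phi> (?r \<omega>) \<partial>percolation H p)"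
    by (rule nn_integral_distr[OF r]) (simp add: \<phi>)
  finally show "(\<integral>\<^sup>+\<omega>. \<phi> (\<lambda>e. \<omega> (f e)) \<partial>percolation H p) = (\<integral>\<^sup>+\<omega>. \<phi> \<omega> \<partial>percolation H' p)"
    by (simp add: eq)
qed

lemma reach_reach_subset: "B \<subseteq> reach S A \<Longrightarrow> reach S B \<subseteq> reach S A"
  by (rule reach_subsetI) (auto intro: reach_step)

section \<open>The graph consisting of the lattice and its trees\<close>

lemma lattice_countable_graph: "countable_graph (lattice :: (int ^ 'd) graph)"
proof
  fix e :: "(int ^ 'd) set" assume "e \<in> edges lattice"
  then obtain x y :: "int ^ 'd" where e: "e = {x, y}" "(\<Sum>i\<in>UNIV. \<bar>x $ i - y $ i\<bar>) = 1"
    by (auto simp: lattice_def)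
  then have "x \<noteq> y" by auto
  then show "card e = 2" using e by simp
qed

lemma rooted_tree_countable_graph: "countable_graph (rooted_tree r)"
  by unfold_locales (auto simp: rooted_tree_def)

interpretation lattice: countable_graph lattice by (rule lattice_countable_graph)
interpretation tree: countable_graph "rooted_tree r" for r by (rule rooted_tree_countable_graph)

lemma edges_lattice_with_trees:
  "edges (lattice_with_trees r) = (`) (\<lambda>x. (x, [])) ` edges lattice \<union> (\<Union>x. (`) (Pair x) ` edges (rooted_tree r))"
  by (simp add: lattice_with_trees_def)

lemma lattice_with_trees_countable_graph:
  "countable_graph (lattice_with_trees r :: ((int ^ 'd) \<times> nat list) graph)"
proof
  fix e :: "((int ^ 'd) \<times> nat list) set" assume "e \<in> edges (lattice_with_trees r)"
  then consider e' where "e = (\<lambda>x. (x, [])) ` e'" "e' \<in> edges lattice"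
    | x e' where "e = Pair x ` e'" "e' \<in> edges (rooted_tree r)"
    unfolding edges_lattice_with_trees by auto
  then show "card e = 2"
    by cases (simp_all add: card_image inj_on_def lattice.card_edge tree.card_edge)
qed

interpretation lattice_with_trees: countable_graph "lattice_with_trees r" for r
  by (rule lattice_with_trees_countable_graph)

text \<open>A path that enters a tree leaves it only through its root, so the lattice cluster and the
  tree clusters can be determined separately.\<close>

lemma open_cluster_lattice_with_trees:
  "open_cluster (lattice_with_trees r) \<omega> (z, []) =
     Sigma (open_cluster lattice (\<lambda>e. \<omega> ((\<lambda>x. (x, [])) ` e)) z)
           (\<lambda>x. open_cluster (rooted_tree r) (\<lambda>e. \<omega> (Pair x ` e)) [])"
proof -
  let ?\<rho> = "\<lambda>x :: int ^ 'd. (x, [] :: nat list)"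
  let ?L = "{e \<in> edges lattice. \<omega> (?\<rho> ` e)}"
  let ?T = "\<lambda>x. {e \<in> edges (rooted_tree r). \<omega> (Pair x ` e)}"
  let ?S = "{e \<in> edges (lattice_with_trees r). \<omega> e}"
  have S: "?S = (`) ?\<rho> ` ?L \<union> (\<Union>x. (`) (Pair x) ` ?T x)"
    unfolding edges_lattice_with_trees by auto
  have "reach ?S {?\<rho> z} = Sigma (reach ?L {z}) (\<lambda>x. reach (?T x) {[]})"
  proof
    show "reach ?S {?\<rho> z} \<subseteq> Sigma (reach ?L {z}) (\<lambda>x. reach (?T x) {[]})" (is "_ \<subseteq> ?B")
    proof (rule reach_subsetI)
      show "{?\<rho> z} \<subseteq> ?B" using subset_reach[of "{z}" ?L] subset_reach[of "{[]}"] by auto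
      fix a b assume a: "a \<in> ?B" and "{a, b} \<in> ?S"
      then consider e where "{a, b} = ?\<rho> ` e" "e \<in> ?L" | x e where "{a, b} = Pair x ` e" "e \<in> ?T x"
        unfolding S by blast
      then show "b \<in> ?B"
      proof cases
        case 1
        have "a \<in> ?\<rho> ` e" "b \<in> ?\<rho> ` e" using 1(1) by auto
        then obtain x y where xy: "a = ?\<rho> x" "b = ?\<rho> y" by auto
        have "?\<rho> ` {x, y} = ?\<rho> ` e" using 1(1) xy by simp
        then have "{x, y} = e" by (rule inj_image_eq_iff[THEN iffD1, rotated]) (simp add: inj_on_def)
        then have "y \<in> reach ?L {z}" using a xy 1(2) by (auto intro: reach_step)
        then show ?thesis using xy subset_reach[of "{[]}" "?T y"] by auto
      next
        case 2
        have "a \<in> Pair x ` e" "b \<in> Pair x ` e" using 2(1) by auto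
        then obtain v w where vw: "a = (x, v)" "b = (x, w)" by auto
        have "Pair x ` {v, w} = Pair x ` e" using 2(1) vw by simp
        then have "{v, w} = e" by (rule inj_image_eq_iff[THEN iffD1, rotated]) (simp add: inj_on_def)
        then have "w \<in> reach (?T x) {[]}" using a vw 2(2) by (auto intro: reach_step)
        then show ?thesis using vw a by auto
      qed
    qed
    show "?B \<subseteq> reach ?S {?\<rho> z}"
    proof (clarify)
      fix x w assume x: "x \<in> reach ?L {z}" and w: "w \<in> reach (?T x) {[]}"
      have "?\<rho> x \<in> ?\<rho> ` reach ?L {z}" using x by blast
      also have "\<dots> = reach ((`) ?\<rho> ` ?L) (?\<rho> ` {z})"
        by (rule reach_image[symmetric]) (simp add: inj_on_def)
      also have "\<dots> \<subseteq> reach ?S {?\<rho> z}" by (rule reach_mono) (auto simp: S)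
      finally have root: "reach ?S {?\<rho> x} \<subseteq> reach ?S {?\<rho> z}" by (intro reach_reach_subset) auto
      have "(x, w) \<in> Pair x ` reach (?T x) {[]}" using w by blast
      also have "\<dots> = reach ((`) (Pair x) ` ?T x) (Pair x ` {[]})"
        by (rule reach_image[symmetric]) (simp add: inj_on_def)
      also have "\<dots> \<subseteq> reach ?S {?\<rho> x}" by (rule reach_mono) (auto simp: S)
      finally show "(x, w) \<in> reach ?S {?\<rho> z}" using root by blast
    qed
  qed
  then show ?thesis by (simp only: open_cluster_eq_reach)
qed

text \<open>Both sides vanish if some fibre is infinite; this is why infinite clusters have weight \<open>0\<close>.\<close>

lemma weight_Sigma:
  fixes u :: ennreal
  assumes "\<And>x. x \<in> C \<Longrightarrow> D x \<noteq> {}"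
  shows "(if finite (Sigma C D) then u ^ card (Sigma C D) else 0) =
    (if finite C then \<Prod>x\<in>C. if finite (D x) then u ^ card (D x) else 0 else 0)"
proof (cases "finite C \<and> (\<forall>x\<in>C. finite (D x))")
  case True
  then show ?thesis by (simp add: power_sum)
next
  case False
  have "infinite (Sigma C D)"
  proof
    assume fin: "finite (Sigma C D)"
    have "C \<subseteq> fst ` Sigma C D" using assms by force
    moreover have "D x \<subseteq> snd ` Sigma C D" if "x \<in> C" for x using that by force
    ultimately show False using False fin by (meson finite_imageI finite_subset)
  qed
  then show ?thesis using False by (auto intro: prod_zero)
qed

text \<open>Given the cluster in the lattice, the trees hanging from it are independent copies of one
  tree, so the generating functions compose.\<close>

theorem cluster_gf_lattice_with_trees:
  "cluster_gf (lattice_with_trees r) p (z, []) u =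
     cluster_gf (lattice :: (int ^ 'd) graph) p z (cluster_gf (rooted_tree r) p [] u)"
proof -
  let ?G = "lattice_with_trees r :: ((int ^ 'd) \<times> nat list) graph"
  let ?L = "lattice :: (int ^ 'd) graph" and ?T = "rooted_tree r"
  let ?\<rho> = "\<lambda>x :: int ^ 'd. (x, [] :: nat list)"
  let ?M = "percolation ?G p"
  let ?f = "cluster_gf ?T p [] u"
  define C where "C \<omega> = open_cluster ?L (\<lambda>e. \<omega> (?\<rho> ` e)) z" for \<omega> :: "((int ^ 'd) \<times> nat list) set \<Rightarrow> bool"
  define D where "D \<omega> x = open_cluster ?T (\<lambda>e. \<omega> (Pair x ` e)) []"
    for \<omega> :: "((int ^ 'd) \<times> nat list) set \<Rightarrow> bool" and x
  define W where "W \<omega> x = (if finite (D \<omega> x) then u ^ card (D \<omega> x) else 0)" for \<omega> x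
  have inj\<rho>: "inj_on ((`) ?\<rho>) A" for A by (intro inj_on_subset[OF inj_on_image[of ?\<rho> UNIV]]) (auto simp: inj_on_def)
  have injP: "inj_on ((`) (Pair x)) A" for A and x :: "int ^ 'd"
    by (rule inj_onI) (simp add: inj_image_eq_iff inj_on_def)
  have \<rho>E: "(`) ?\<rho> \<in> edges ?L \<rightarrow> edges ?G" and PE: "(`) (Pair x) \<in> edges ?T \<rightarrow> edges ?G" for x
    by (auto simp: edges_lattice_with_trees)
  have W: "(\<lambda>\<omega>. W \<omega> x) \<in> borel_measurable ?M" "(\<integral>\<^sup>+\<omega>. W \<omega> x \<partial>?M) = ?f" for x
  proof -
    have dep: "(if finite (open_cluster ?T \<omega> []) then u ^ card (open_cluster ?T \<omega> []) else 0)
        = (if finite (open_cluster ?T \<omega>' []) then u ^ card (open_cluster ?T \<omega>' []) else 0)"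
      if "\<And>e. e \<in> edges ?T \<Longrightarrow> \<omega> e = \<omega>' e" for \<omega> \<omega>'
      using open_cluster_cong[of ?T \<omega> \<omega>'] that by simp
    show "(\<lambda>\<omega>. W \<omega> x) \<in> borel_measurable ?M" "(\<integral>\<^sup>+\<omega>. W \<omega> x \<partial>?M) = ?f"
      unfolding W_def D_def cluster_gf_def
      by (rule nn_integral_percolation_pullback[OF injP PE tree.measurable_finite_cluster], erule dep)+
  qed
  have dep: "C \<omega> = C \<omega>'" if "\<And>e. e \<in> (`) ?\<rho> ` edges ?L \<Longrightarrow> \<omega> e = \<omega>' e" for \<omega> \<omega>'
    unfolding C_def using that by (intro open_cluster_cong) auto
  have indC: "(\<lambda>\<omega>. indicator {\<omega>. C \<omega> = B} \<omega> :: ennreal) \<in> borel_measurable ?M"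
      "(\<integral>\<^sup>+\<omega>. indicator {\<omega>. C \<omega> = B} \<omega> \<partial>?M) =
       emeasure (percolation ?L p) {\<omega> \<in> space (percolation ?L p). open_cluster ?L \<omega> z = B}" for B
  proof -
    let ?\<phi> = "\<lambda>\<omega>. indicator {\<omega>. open_cluster ?L \<omega> z = B} \<omega> :: ennreal"
    have \<phi>: "?\<phi> \<in> borel_measurable (percolation ?L p)"
      using lattice.sets_Collect_cluster_eq by (intro borel_measurable_indicator') (auto simp: vimage_def Collect_conj_eq Int_commute)
    have d: "?\<phi> \<omega> = ?\<phi> \<omega>'" if "\<And>e. e \<in> edges ?L \<Longrightarrow> \<omega> e = \<omega>' e" for \<omega> \<omega>'
      using open_cluster_cong[of ?L \<omega> \<omega>'] that by (simp add: indicator_def)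
    have eq: "indicator {\<omega>. C \<omega> = B} \<omega> = ?\<phi> (\<lambda>e. \<omega> (?\<rho> ` e))" for \<omega>
      by (simp add: C_def indicator_def)
    show "(\<lambda>\<omega>. indicator {\<omega>. C \<omega> = B} \<omega> :: ennreal) \<in> borel_measurable ?M"
      unfolding eq by (rule nn_integral_percolation_pullback(1)[OF inj\<rho> \<rho>E \<phi>], erule d)
    have "(\<integral>\<^sup>+\<omega>. indicator {\<omega>. C \<omega> = B} \<omega> \<partial>?M) = (\<integral>\<^sup>+\<omega>. ?\<phi> \<omega> \<partial>percolation ?L p)"
      unfolding eq by (rule nn_integral_percolation_pullback(2)[OF inj\<rho> \<rho>E \<phi>], erule d)
    also have "\<dots> = (\<integral>\<^sup>+\<omega>. indicator {\<omega> \<in> space (percolation ?L p). open_cluster ?L \<omega> z = B} \<omega> \<partial>percolation ?L p)"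
      by (intro nn_integral_cong) (simp add: indicator_def)
    finally show "(\<integral>\<^sup>+\<omega>. indicator {\<omega>. C \<omega> = B} \<omega> \<partial>?M) =
       emeasure (percolation ?L p) {\<omega> \<in> space (percolation ?L p). open_cluster ?L \<omega> z = B}"
      unfolding nn_integral_indicator[OF lattice.sets_Collect_cluster_eq] .
  qed
  have setsC: "{\<omega> \<in> space ?M. C \<omega> = B} \<in> sets ?M" for B
    using borel_measurable_indicator_iff[THEN iffD1, OF indC(1)[of B]]
    by (simp add: Collect_conj_eq Int_commute)
  have block: "(\<integral>\<^sup>+\<omega>. (\<Prod>x\<in>B. W \<omega> x) * indicator {\<omega> \<in> space ?M. C \<omega> = B} \<omega> \<partial>?M) =
      ?f ^ card B * emeasure (percolation ?L p) {\<omega> \<in> space (percolation ?L p). open_cluster ?L \<omega> z = B}"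
    if B: "finite B" for B
  proof -
    let ?K = "insert None (Some ` B)"
    define J where "J k = (case k of None \<Rightarrow> (`) ?\<rho> ` edges ?L | Some x \<Rightarrow> (`) (Pair x) ` edges ?T)" for k
    define Z where "Z k \<omega> = (case k of None \<Rightarrow> indicator {\<omega>. C \<omega> = B} \<omega> | Some x \<Rightarrow> W \<omega> x)" for k \<omega>
    have prodK: "(\<Prod>k\<in>?K. g k) = g None * (\<Prod>x\<in>B. g (Some x))" for g :: "(int ^ 'd) option \<Rightarrow> ennreal"
      using B by (subst prod.insert) (auto simp: prod.reindex)
    have disj: "disjoint_family_on J ?K"
    proof -
      have 1: "?\<rho> ` e \<noteq> Pair x ` e'" if "e \<in> edges ?L" "e' \<in> edges ?T" for e e' x
      proof
        assume eq: "?\<rho> ` e = Pair x ` e'"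
        have "?\<rho> ` e \<subseteq> {?\<rho> x}" using eq by auto
        then have "e \<subseteq> {x}" by auto
        then show False using lattice.card_edge[OF that(1)] card_mono[of "{x}" e] by simp
      qed
      have 2: "x = y" if "Pair x ` e = Pair y ` e'" "e \<in> edges ?T" for x y :: "int ^ 'd" and e e'
      proof -
        have "e \<noteq> {}" using tree.card_edge[OF that(2)] by auto
        then show ?thesis using that(1) by auto
      qed
      show ?thesis unfolding disjoint_family_on_def J_def
        using 1 2 by (auto simp: eq_commute[of "Pair _ ` _" "?\<rho> ` _"] split: option.splits)
    qed
    have "(\<integral>\<^sup>+\<omega>. (\<Prod>x\<in>B. W \<omega> x) * indicator {\<omega> \<in> space ?M. C \<omega> = B} \<omega> \<partial>?M) = (\<integral>\<^sup>+\<omega>. (\<Prod>k\<in>?K. Z k \<omega>) \<partial>?M)"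
      unfolding prodK by (intro nn_integral_cong) (simp add: Z_def indicator_def)
    also have "\<dots> = (\<Prod>k\<in>?K. \<integral>\<^sup>+\<omega>. Z k \<omega> \<partial>?M)"
    proof (rule nn_integral_percolation_prod[OF _ _ disj])
      show "finite ?K" using B by simp
      show "J k \<subseteq> edges ?G" for k by (auto simp: J_def edges_lattice_with_trees split: option.splits)
      show "Z k \<in> borel_measurable ?M" for k
        using indC(1) W(1) by (cases k) (simp_all add: Z_def[abs_def])
      show "Z k \<omega> = Z k \<omega>'" if "\<And>e. e \<in> J k \<Longrightarrow> \<omega> e = \<omega>' e" for k \<omega> \<omega>'
      proof (cases k)
        case None
        then show ?thesis using dep[of \<omega> \<omega>'] that by (simp add: Z_def J_def indicator_def)
      next
        case (Some x)
        then have "D \<omega> x = D \<omega>' x" unfolding D_def using that by (intro open_cluster_cong) (auto simp: J_def)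
        then show ?thesis using Some by (simp add: Z_def W_def)
      qed
    qed
    also have "\<dots> = ?f ^ card B * emeasure (percolation ?L p) {\<omega> \<in> space (percolation ?L p). open_cluster ?L \<omega> z = B}"
    proof -
      have "Z None = indicator {\<omega>. C \<omega> = B}" "Z (Some x) = (\<lambda>\<omega>. W \<omega> x)" for x
        by (auto simp: Z_def)
      then show ?thesis unfolding prodK using indC(2)[of B] by (simp add: W mult.commute)
    qed
    finally show ?thesis .
  qed
  have "cluster_gf ?G p (z, []) u = (\<integral>\<^sup>+\<omega>. (if finite (C \<omega>) then \<Prod>x\<in>C \<omega>. W \<omega> x else 0) \<partial>?M)"
    unfolding cluster_gf_def
  proof (rule nn_integral_cong)
    fix \<omega>
    have G: "open_cluster ?G \<omega> (z, []) = Sigma (C \<omega>) (D \<omega>)"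
      by (simp only: open_cluster_lattice_with_trees C_def D_def[abs_def])
    have "D \<omega> x \<noteq> {}" for x using self_in_open_cluster[of "[]" ?T] by (auto simp: D_def)
    then show "(if finite (open_cluster ?G \<omega> (z, [])) then u ^ card (open_cluster ?G \<omega> (z, [])) else 0)
        = (if finite (C \<omega>) then \<Prod>x\<in>C \<omega>. W \<omega> x else 0)"
      unfolding G W_def by (intro weight_Sigma)
  qed
  also have "\<dots> = (\<integral>\<^sup>+B. (\<integral>\<^sup>+\<omega>. (\<Prod>x\<in>B. W \<omega> x) * indicator {\<omega> \<in> space ?M. C \<omega> = B} \<omega> \<partial>?M)
      \<partial>count_space {B. finite B})"
    using W by (intro nn_integral_finite_set_valued setsC) auto
  also have "\<dots> = (\<integral>\<^sup>+B. ?f ^ card B *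
      emeasure (percolation ?L p) {\<omega> \<in> space (percolation ?L p). open_cluster ?L \<omega> z = B} \<partial>count_space {B. finite B})"
    using block by (intro nn_integral_cong) auto
  also have "\<dots> = (\<integral>\<^sup>+B. (\<integral>\<^sup>+\<omega>. ?f ^ card B * indicator {\<omega> \<in> space (percolation ?L p). open_cluster ?L \<omega> z = B} \<omega>
      \<partial>percolation ?L p) \<partial>count_space {B. finite B})"
    by (intro nn_integral_cong nn_integral_cmult_indicator[symmetric] lattice.sets_Collect_cluster_eq)
  also have "\<dots> = cluster_gf ?L p z ?f"
    unfolding cluster_gf_def
    by (rule nn_integral_finite_set_valued[symmetric]) (auto intro: lattice.sets_Collect_cluster_eq)
  finally show ?thesis .
qed

section \<open>The generating function of the tree\<close>

text \<open>Only clusters of height less than \<open>n\<close> are counted. Unlike the full generating function,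
  which is merely one solution of a fixed-point equation, these truncations are determined by
  their recursion.\<close>

definition tree_gf_below :: "nat \<Rightarrow> real \<Rightarrow> nat \<Rightarrow> ennreal \<Rightarrow> ennreal" where
  "tree_gf_below r p n u = (\<integral>\<^sup>+\<omega>. (let D = open_cluster (rooted_tree r) \<omega> [] in
     if finite D \<and> (\<forall>w\<in>D. length w < n) then u ^ card D else 0) \<partial>percolation (rooted_tree r) p)"

lemma emeasure_edge:
  assumes "e \<in> edges H" "0 \<le> p" "p \<le> 1"
  shows "emeasure (percolation H p) {\<omega> \<in> space (percolation H p). \<omega> e} = ennreal p"
    and "emeasure (percolation H p) {\<omega> \<in> space (percolation H p). \<not> \<omega> e} = ennreal (1 - p)"
proof -
  interpret PP: product_prob_space "\<lambda>_. measure_pmf (bernoulli_pmf p)" "edges H"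
    by unfold_locales
  show "emeasure (percolation H p) {\<omega> \<in> space (percolation H p). \<omega> e} = ennreal p"
    using PP.emeasure_PiM_Collect_single[of e "{True}"] assms
    by (simp add: percolation_def emeasure_pmf_single)
  show "emeasure (percolation H p) {\<omega> \<in> space (percolation H p). \<not> \<omega> e} = ennreal (1 - p)"
    using PP.emeasure_PiM_Collect_single[of e "{False}"] assms
    by (simp add: percolation_def emeasure_pmf_single)
qed

lemma tree_edgeI: "w \<in> lists {..<r} \<Longrightarrow> j < r \<Longrightarrow> {w, w @ [j]} \<in> edges (rooted_tree r)"
  unfolding rooted_tree_def snd_conv by blast

lemma Cons_image_edge:
  assumes "k < r" "e \<in> edges (rooted_tree r)"
  shows "(#) k ` e \<in> edges (rooted_tree r)"
proof -
  from assms obtain w j where w: "e = {w, w @ [j]}" "w \<in> lists {..<r}" "j < r"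
    by (auto simp: rooted_tree_def)
  have "(#) k ` e = {k # w, (k # w) @ [j]}" using w by auto
  then show ?thesis using w assms(1) tree_edgeI[of "k # w" r j] by simp
qed

lemma root_edge: "k < r \<Longrightarrow> {[], [k]} \<in> edges (rooted_tree r)"
  using tree_edgeI[of "[]" r k] by simp

text \<open>A path that enters a branch at the root leaves it only through the root, so the branches can be
  explored separately.\<close>

lemma open_cluster_tree_decomp:
  "open_cluster (rooted_tree r) \<omega> [] = insert [] (\<Union>k\<in>{k. k < r \<and> \<omega> {[], [k]}}.
     (#) k ` open_cluster (rooted_tree r) (\<lambda>e. \<omega> ((#) k ` e)) [])"
proof -
  let ?T = "{e \<in> edges (rooted_tree r). \<omega> e}"
  let ?S = "\<lambda>k. {e \<in> edges (rooted_tree r). \<omega> ((#) k ` e)}"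
  let ?B = "insert [] (\<Union>k\<in>{k. k < r \<and> \<omega> {[], [k]}}. (#) k ` reach (?S k) {[]})"
  have "reach ?T {[]} = ?B"
  proof
    show "reach ?T {[]} \<subseteq> ?B"
    proof (rule reach_subsetI)
      fix a b assume a: "a \<in> ?B" and ab: "{a, b} \<in> ?T"
      then obtain v j where v: "{a, b} = {v, v @ [j]}" "v \<in> lists {..<r}" "j < r"
        by (auto simp: rooted_tree_def)
      show "b \<in> ?B"
      proof (cases a)
        case Nil
        then have b: "b = [j]" using v(1) by (auto simp: doubleton_eq_iff)
        then have "\<omega> {[], [j]}" using ab Nil by simp
        moreover have "[] \<in> reach (?S j) {[]}" using subset_reach[of "{[]}"] by auto
        ultimately show ?thesis using b v(3) by auto
      next
        case (Cons k w)
        with a have k: "k < r" "\<omega> {[], [k]}" and w: "w \<in> reach (?S k) {[]}" by auto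
        show ?thesis
        proof (cases "b = []")
          case False
          then obtain w' where b: "b = k # w'" and w': "{w, w'} \<in> edges (rooted_tree r)"
          proof (cases "a = v")
            case True
            then have "b = v @ [j]" using v(1) by (auto simp: doubleton_eq_iff)
            then show ?thesis using True Cons v(2,3) tree_edgeI[of w r j]
              by (intro that[of "w @ [j]"]) (auto simp: in_lists_conv_set)
          next
            case False
            then have *: "a = v @ [j]" "b = v" using v(1) by (auto simp: doubleton_eq_iff)
            then obtain v' where v': "v = k # v'" "w = v' @ [j]" using Cons \<open>b \<noteq> []\<close> by (cases v) auto
            have "{w, v'} = {v', v' @ [j]}" using v' by auto
            then show ?thesis using * v' v(2,3) tree_edgeI[of v' r j] 
              by (intro that[of v']) (auto simp: in_lists_conv_set)
          qed
          have "(#) k ` {w, w'} = {a, b}" using Cons b by simp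
          then have "{w, w'} \<in> ?S k" using w' ab by simp
          then have "w' \<in> reach (?S k) {[]}" using w by (rule reach_step[rotated])
          then show ?thesis using b k by auto
        qed simp
      qed
    qed simp
    show "?B \<subseteq> reach ?T {[]}"
    proof -
      have nil: "[] \<in> reach ?T {[]}" using subset_reach[of "{[]}"] by auto
      have "(#) k ` reach (?S k) {[]} \<subseteq> reach ?T {[]}" if k: "k < r" "\<omega> {[], [k]}" for k
      proof -
        have "(#) k ` reach (?S k) {[]} = reach ((`) ((#) k) ` ?S k) ((#) k ` {[]})"
          by (rule reach_image[symmetric]) simp
        also have "\<dots> \<subseteq> reach ?T {[k]}"
          using Cons_image_edge[OF k(1)] by (intro reach_mono) auto
        also have "\<dots> \<subseteq> reach ?T {[]}"
          using reach_step[OF nil, of "[k]"] k root_edge by (intro reach_reach_subset) auto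
        finally show ?thesis .
      qed
      then show ?thesis using nil by blast
    qed
  qed
  then show ?thesis by (simp only: open_cluster_eq_reach)
qed

lemma weight_tree_decomp:
  fixes u :: ennreal and Dk :: "nat \<Rightarrow> nat list set"
  assumes D: "D = insert [] (\<Union>k\<in>{k. k < r \<and> opened k}. (#) k ` Dk k)"
  shows "(if finite D \<and> (\<forall>w\<in>D. length w < Suc n) then u ^ card D else 0) =
    u * (\<Prod>k<r. if opened k then (if finite (Dk k) \<and> (\<forall>w\<in>Dk k. length w < n) then u ^ card (Dk k) else 0) else 1)"
proof -
  let ?K = "{k. k < r \<and> opened k}"
  let ?g = "\<lambda>k. if finite (Dk k) \<and> (\<forall>w\<in>Dk k. length w < n) then u ^ card (Dk k) else 0"
  have K: "finite ?K" by simp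
  have len: "(\<forall>w\<in>D. length w < Suc n) \<longleftrightarrow> (\<forall>k\<in>?K. \<forall>w\<in>Dk k. length w < n)"
    unfolding D by auto
  have fin: "finite D \<longleftrightarrow> (\<forall>k\<in>?K. finite (Dk k))"
    unfolding D by (auto simp: finite_image_iff)
  have prod: "(\<Prod>k<r. if opened k then ?g k else 1) = (\<Prod>k\<in>?K. ?g k)"
    by (rule prod.mono_neutral_cong_right) auto
  show ?thesis
  proof (cases "finite D \<and> (\<forall>w\<in>D. length w < Suc n)")
    case True
    have "card D = Suc (card (\<Union>k\<in>?K. (#) k ` Dk k))"
      unfolding D using True by (subst card_insert_disjoint) (auto simp: D)
    also have "card (\<Union>k\<in>?K. (#) k ` Dk k) = (\<Sum>k\<in>?K. card ((#) k ` Dk k))"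
      using True fin by (intro card_UN_disjoint) auto
    also have "\<dots> = (\<Sum>k\<in>?K. card (Dk k))" by (simp add: card_image)
    finally have "u ^ card D = u * (\<Prod>k\<in>?K. u ^ card (Dk k))" by (simp add: power_sum)
    also have "(\<Prod>k\<in>?K. u ^ card (Dk k)) = (\<Prod>k\<in>?K. ?g k)"
      using True fin len by (intro prod.cong) auto
    finally show ?thesis using True prod by simp
  next
    case False
    then obtain k where k: "k \<in> ?K" "\<not> (finite (Dk k) \<and> (\<forall>w\<in>Dk k. length w < n))"
      using fin len by blast
    have "?g k = 0" by (rule if_not_P[OF k(2)])
    with k(1) have "(\<Prod>k\<in>?K. ?g k) = 0" using K by (intro prod_zero) auto
    then show ?thesis using False prod by auto
  qed
qed

lemma tree_gf_below_0: "tree_gf_below r p 0 u = 0"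
proof -
  have "open_cluster (rooted_tree r) \<omega> [] \<noteq> {}" for \<omega>
    using self_in_open_cluster[of "[]" "rooted_tree r" \<omega>] by auto
  then show ?thesis by (simp add: tree_gf_below_def Let_def)
qed

text \<open>The branches at the root are independent. A branch contributes the factor \<open>1\<close> if its first edge
  is closed and otherwise an independent copy of the quantity for height \<open>n\<close>.\<close>

lemma tree_gf_below_Suc:
  assumes p: "0 \<le> p" "p \<le> 1"
  shows "tree_gf_below r p (Suc n) u = u * (ennreal (1 - p) + ennreal p * tree_gf_below r p n u) ^ r"
proof -
  let ?T = "rooted_tree r"
  let ?M = "percolation ?T p"
  define w where "w n D = (if \<forall>w\<in>D. length w < n then u ^ card D else 0)" for n and D :: "nat list set"
  define V where "V n \<omega> = (if finite (open_cluster ?T \<omega> []) then w n (open_cluster ?T \<omega> []) else 0)" for n \<omega>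
  have V_eq: "V n \<omega> = (let D = open_cluster ?T \<omega> [] in
     if finite D \<and> (\<forall>w\<in>D. length w < n) then u ^ card D else 0)" for n \<omega>
    by (simp add: V_def w_def Let_def)
  have gf: "tree_gf_below r p n u = (\<integral>\<^sup>+\<omega>. V n \<omega> \<partial>?M)" for n
    by (simp add: tree_gf_below_def V_eq)
  have V: "V n \<in> borel_measurable ?M" for n
    unfolding V_def[abs_def] by (rule tree.measurable_finite_cluster)
  have depV: "V n \<omega> = V n \<omega>'" if "\<And>e. e \<in> edges ?T \<Longrightarrow> \<omega> e = \<omega>' e" for n \<omega> \<omega>'
    using open_cluster_cong[of ?T \<omega> \<omega>'] that by (simp add: V_def)
  define Z where "Z k \<omega> = (if \<omega> {[], [k]} then V n (\<lambda>e. \<omega> ((#) k ` e)) else 1)" for k and \<omega> :: "nat list set \<Rightarrow> bool"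
  have inj: "inj_on ((`) ((#) k)) A" for k :: nat and A
    by (rule inj_onI) (simp add: inj_image_eq_iff)
  have child: "(`) ((#) k) \<in> edges ?T \<rightarrow> edges ?T" if "k < r" for k
    using Cons_image_edge[OF that] by auto
  have Vk: "(\<lambda>\<omega>. V n (\<lambda>e. \<omega> ((#) k ` e))) \<in> borel_measurable ?M"
      "(\<integral>\<^sup>+\<omega>. V n (\<lambda>e. \<omega> ((#) k ` e)) \<partial>?M) = tree_gf_below r p n u" if "k < r" for k
    unfolding gf by (rule nn_integral_percolation_pullback[OF inj child[OF that] V], erule depV)+
  have ind: "(\<lambda>\<omega>. indicator {\<omega>. \<omega> {[], [k]}} \<omega> :: ennreal) \<in> borel_measurable ?M"
      "(\<integral>\<^sup>+\<omega>. indicator {\<omega>. \<omega> {[], [k]}} \<omega> \<partial>?M) = ennreal p"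
      "(\<lambda>\<omega>. indicator {\<omega>. \<not> \<omega> {[], [k]}} \<omega> :: ennreal) \<in> borel_measurable ?M"
      "(\<integral>\<^sup>+\<omega>. indicator {\<omega>. \<not> \<omega> {[], [k]}} \<omega> \<partial>?M) = ennreal (1 - p)" if "k < r" for k
  proof -
    have s: "{\<omega> \<in> space ?M. \<omega> {[], [k]}} \<in> sets ?M" by (rule sets_edge_open[OF root_edge[OF that]])
    then have s': "{\<omega> \<in> space ?M. \<not> \<omega> {[], [k]}} \<in> sets ?M" by (rule sets.sets_Collect_neg)
    show "(\<lambda>\<omega>. indicator {\<omega>. \<omega> {[], [k]}} \<omega> :: ennreal) \<in> borel_measurable ?M"
      "(\<lambda>\<omega>. indicator {\<omega>. \<not> \<omega> {[], [k]}} \<omega> :: ennreal) \<in> borel_measurable ?M"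
      using s s' by (auto simp: borel_measurable_indicator_iff Collect_conj_eq Int_commute)
    have "(\<integral>\<^sup>+\<omega>. indicator {\<omega>. \<omega> {[], [k]}} \<omega> \<partial>?M) = (\<integral>\<^sup>+\<omega>. indicator {\<omega> \<in> space ?M. \<omega> {[], [k]}} \<omega> \<partial>?M)"
      by (intro nn_integral_cong) (simp add: indicator_def)
    then show "(\<integral>\<^sup>+\<omega>. indicator {\<omega>. \<omega> {[], [k]}} \<omega> \<partial>?M) = ennreal p"
      unfolding nn_integral_indicator[OF s] emeasure_edge(1)[OF root_edge[OF that] p] .
    have "(\<integral>\<^sup>+\<omega>. indicator {\<omega>. \<not> \<omega> {[], [k]}} \<omega> \<partial>?M) = (\<integral>\<^sup>+\<omega>. indicator {\<omega> \<in> space ?M. \<not> \<omega> {[], [k]}} \<omega> \<partial>?M)"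
      by (intro nn_integral_cong) (simp add: indicator_def)
    then show "(\<integral>\<^sup>+\<omega>. indicator {\<omega>. \<not> \<omega> {[], [k]}} \<omega> \<partial>?M) = ennreal (1 - p)"
      unfolding nn_integral_indicator[OF s'] emeasure_edge(2)[OF root_edge[OF that] p] .
  qed
  have Z_eq: "Z k \<omega> = indicator {\<omega>. \<not> \<omega> {[], [k]}} \<omega>
      + indicator {\<omega>. \<omega> {[], [k]}} \<omega> * V n (\<lambda>e. \<omega> ((#) k ` e))" for k \<omega>
    by (simp add: Z_def indicator_def)
  have Zm: "Z k \<in> borel_measurable ?M" if "k < r" for k
    unfolding Z_eq[abs_def] using ind(1,3)[OF that] Vk(1)[OF that]
    by (intro borel_measurable_add borel_measurable_times_ennreal)
  have ZI: "(\<integral>\<^sup>+\<omega>. Z k \<omega> \<partial>?M) = ennreal (1 - p) + ennreal p * tree_gf_below r p n u" if k: "k < r" for k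
  proof -
    define X where "X b \<omega> = (if b then indicator {\<omega>. \<omega> {[], [k]}} \<omega> else V n (\<lambda>e. \<omega> ((#) k ` e)))"
      for b and \<omega> :: "nat list set \<Rightarrow> bool"
    define J where "J b = (if b then {{[], [k]}} else (`) ((#) k) ` edges ?T)" for b
    have "(\<integral>\<^sup>+\<omega>. (\<Prod>b\<in>{True, False}. X b \<omega>) \<partial>?M) = (\<Prod>b\<in>{True, False}. \<integral>\<^sup>+\<omega>. X b \<omega> \<partial>?M)"
    proof (rule nn_integral_percolation_prod[where J = J])
      show "J b \<subseteq> edges ?T" for b using root_edge[OF k] Cons_image_edge[OF k] by (auto simp: J_def)
      have "{[], [k]} \<noteq> (#) k ` e" for e by auto
      then show "disjoint_family_on J {True, False}" by (auto simp: disjoint_family_on_def J_def)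
      show "X b \<in> borel_measurable ?M" for b
        unfolding X_def[abs_def] using ind(1)[OF k] Vk(1)[OF k] by (cases b) simp_all
      show "X b \<omega> = X b \<omega>'" if "\<And>e. e \<in> J b \<Longrightarrow> \<omega> e = \<omega>' e" for b \<omega> \<omega>'
      proof (cases b)
        case True
        then show ?thesis using that by (simp add: X_def J_def indicator_def)
      next
        case False
        then show ?thesis unfolding X_def using that by (auto simp: J_def intro!: depV)
      qed
    qed simp
    then have "(\<integral>\<^sup>+\<omega>. indicator {\<omega>. \<omega> {[], [k]}} \<omega> * V n (\<lambda>e. \<omega> ((#) k ` e)) \<partial>?M) =
        ennreal p * tree_gf_below r p n u"
      by (simp add: X_def ind(2)[OF k, simplified] Vk(2)[OF k])
    moreover have "(\<integral>\<^sup>+\<omega>. Z k \<omega> \<partial>?M) = (\<integral>\<^sup>+\<omega>. indicator {\<omega>. \<not> \<omega> {[], [k]}} \<omega> \<partial>?M)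
        + (\<integral>\<^sup>+\<omega>. indicator {\<omega>. \<omega> {[], [k]}} \<omega> * V n (\<lambda>e. \<omega> ((#) k ` e)) \<partial>?M)"
      unfolding Z_eq using ind(1,3)[OF k] Vk(1)[OF k]
      by (intro nn_integral_add borel_measurable_times_ennreal)
    ultimately show ?thesis using ind(4)[OF k] by simp
  qed
  define J where "J k = insert {[], [k]} ((`) ((#) k) ` edges ?T)" for k
  have J1: "\<exists>v. k # v \<in> e" "\<forall>w\<in>e. w = [] \<or> hd w = k" if eJ: "e \<in> J k" for e k
  proof -
    consider "e = {[], [k]}" | e' where "e = (#) k ` e'" "e' \<in> edges ?T"
      using eJ unfolding J_def by blast
    then have "(\<exists>v. k # v \<in> e) \<and> (\<forall>w\<in>e. w = [] \<or> hd w = k)"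
    proof cases
      case 2
      have "card e' = 2" by (rule tree.card_edge[OF 2(2)])
      then obtain v where "v \<in> e'" by fastforce
      then show ?thesis using 2(1) by auto
    qed auto
    then show "\<exists>v. k # v \<in> e" "\<forall>w\<in>e. w = [] \<or> hd w = k" by auto
  qed
  have indep: "(\<integral>\<^sup>+\<omega>. (\<Prod>k\<in>{..<r}. Z k \<omega>) \<partial>?M) = (\<Prod>k\<in>{..<r}. \<integral>\<^sup>+\<omega>. Z k \<omega> \<partial>?M)"
  proof (rule nn_integral_percolation_prod[where J = J])
    show "J k \<subseteq> edges ?T" if "k \<in> {..<r}" for k
      using root_edge Cons_image_edge that by (auto simp: J_def)
    show "disjoint_family_on J {..<r}"
      unfolding disjoint_family_on_def
    proof (intro ballI impI)
      fix k l :: nat assume "k \<noteq> l"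
      have False if "e \<in> J k" "e \<in> J l" for e
        using J1(1)[OF that(1)] J1(2)[OF that(2)] \<open>k \<noteq> l\<close> by auto
      then show "J k \<inter> J l = {}" by blast
    qed
    show "Z k \<omega> = Z k \<omega>'" if "\<And>e. e \<in> J k \<Longrightarrow> \<omega> e = \<omega>' e" for k \<omega> \<omega>'
    proof -
      have "\<omega> {[], [k]} = \<omega>' {[], [k]}" using that by (simp add: J_def)
      moreover have "V n (\<lambda>e. \<omega> ((#) k ` e)) = V n (\<lambda>e. \<omega>' ((#) k ` e))"
        using that by (intro depV) (simp add: J_def)
      ultimately show ?thesis by (simp add: Z_def)
    qed
  qed (use Zm in auto)
  have "V (Suc n) = (\<lambda>\<omega>. u * (\<Prod>k<r. Z k \<omega>))"
    unfolding fun_eq_iff V_eq Let_def Z_def by (intro allI weight_tree_decomp open_cluster_tree_decomp)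
  then have "tree_gf_below r p (Suc n) u = u * (\<integral>\<^sup>+\<omega>. (\<Prod>k<r. Z k \<omega>) \<partial>?M)"
    unfolding gf using Zm by (simp add: nn_integral_cmult borel_measurable_prod_ennreal)
  then show ?thesis unfolding indep by (simp add: ZI)
qed

lemma tree_gf_eq_SUP: "cluster_gf (rooted_tree r) p [] u = (SUP n. tree_gf_below r p n u)"
proof -
  let ?T = "rooted_tree r"
  let ?D = "\<lambda>\<omega>. open_cluster ?T \<omega> []"
  let ?V = "\<lambda>n \<omega>. if finite (?D \<omega>) then (if \<forall>w\<in>?D \<omega>. length w < n then u ^ card (?D \<omega>) else 0) else 0"
  have "(SUP n. tree_gf_below r p n u) = (SUP n. \<integral>\<^sup>+\<omega>. ?V n \<omega> \<partial>percolation ?T p)"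
    unfolding tree_gf_below_def Let_def by (intro SUP_cong refl nn_integral_cong) simp
  also have "\<dots> = (\<integral>\<^sup>+\<omega>. (SUP n. ?V n \<omega>) \<partial>percolation ?T p)"
  proof (rule nn_integral_monotone_convergence_SUP[symmetric])
    show "incseq ?V" by (auto simp: incseq_def le_fun_def intro: less_le_trans)
    show "?V n \<in> borel_measurable (percolation ?T p)" for n
      by (rule tree.measurable_finite_cluster[where f = "\<lambda>D. if \<forall>w\<in>D. length w < n then u ^ card D else 0"])
  qed
  also have "\<dots> = cluster_gf ?T p [] u"
    unfolding cluster_gf_def
  proof (intro nn_integral_cong antisym)
    fix \<omega>
    show "(SUP n. ?V n \<omega>) \<le> (if finite (?D \<omega>) then u ^ card (?D \<omega>) else 0)"
      by (intro SUP_least) auto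
    show "(if finite (?D \<omega>) then u ^ card (?D \<omega>) else 0) \<le> (SUP n. ?V n \<omega>)"
    proof (cases "finite (?D \<omega>)")
      case True
      then obtain n where "\<forall>i\<in>length ` ?D \<omega>. i < n"
        using finite_nat_set_iff_bounded[of "length ` ?D \<omega>"] by auto
      then have "u ^ card (?D \<omega>) = ?V n \<omega>" using True by auto
      also have "\<dots> \<le> (SUP n. ?V n \<omega>)" by (rule SUP_upper) simp
      finally show ?thesis using True by simp
    qed simp
  qed
  finally show ?thesis ..
qed

text \<open>Hence the generating function is the least solution of the fixed-point equation, and
  every supersolution is an upper bound.\<close>

lemma tree_gf_le_supersolution:
  assumes p: "0 \<le> p" "p \<le> 1" and v: "u * (ennreal (1 - p) + ennreal p * v) ^ r \<le> v"
  shows "cluster_gf (rooted_tree r) p [] u \<le> v"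
proof -
  have "tree_gf_below r p n u \<le> v" for n
  proof (induction n)
    case 0
    then show ?case by (simp add: tree_gf_below_0)
  next
    case (Suc n)
    have "tree_gf_below r p (Suc n) u \<le> u * (ennreal (1 - p) + ennreal p * v) ^ r"
      unfolding tree_gf_below_Suc[OF p]
      by (intro mult_left_mono power_mono add_left_mono Suc) auto
    then show ?case using v by (rule order_trans)
  qed
  then show ?thesis unfolding tree_gf_eq_SUP by (rule SUP_least)
qed

text \<open>For \<open>s \<le> 1\<close> the truncations stay in the unit interval, so the recursion passes to their limit.\<close>

lemma tree_gf_fixed_point:
  assumes p: "0 \<le> p" "p \<le> 1" and s: "0 \<le> s" "s \<le> 1"
  shows "\<exists>a. 0 \<le> a \<and> a \<le> 1 \<and> cluster_gf (rooted_tree r) p [] (ennreal s) = ennreal a \<and>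
    a = s * (1 - p + p * a) ^ r"
proof -
  define h where "h x = s * (1 - p + p * x) ^ r" for x
  have h_mono: "h x \<le> h y" if "0 \<le> x" "x \<le> y" for x y
    unfolding h_def using that p s by (intro mult_left_mono power_mono add_left_mono) auto
  have h0: "0 \<le> h x" if "0 \<le> x" for x unfolding h_def using that p s by simp
  define a where "a n = (h ^^ n) 0" for n
  have a_Suc: "a (Suc n) = h (a n)" for n by (simp add: a_def)
  have a0: "0 \<le> a n" for n by (induction n) (simp_all add: a_Suc h0, simp add: a_def)
  have a1: "a n \<le> 1" for n
  proof (induction n)
    case (Suc n)
    have "h (a n) \<le> h 1" using Suc a0 by (rule h_mono[rotated])
    then show ?case using s by (simp add: a_Suc h_def)
  qed (simp add: a_def)
  have inc: "incseq a"
  proof (rule incseq_SucI)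
    show "a n \<le> a (Suc n)" for n
    proof (induction n)
      case 0
      then show ?case using a0[of 1] by (simp add: a_def)
    next
      case (Suc n)
      then show ?case using h_mono[OF a0 Suc] by (simp add: a_Suc)
    qed
  qed
  obtain L where L: "a \<longlonglongrightarrow> L" using incseq_convergent[OF inc] a1 by blast
  have L01: "0 \<le> L" "L \<le> 1"
    using LIMSEQ_le_const[OF L] LIMSEQ_le_const2[OF L] a0 a1 by blast+
  have "(\<lambda>n. a (Suc n)) \<longlonglongrightarrow> h L"
    unfolding a_Suc h_def by (intro tendsto_intros L)
  moreover have "(\<lambda>n. a (Suc n)) \<longlonglongrightarrow> L" using L by (rule LIMSEQ_Suc)
  ultimately have fixed: "L = h L" using LIMSEQ_unique by blast
  have gf: "tree_gf_below r p n (ennreal s) = ennreal (a n)" for n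
  proof (induction n)
    case 0
    then show ?case by (simp add: tree_gf_below_0 a_def)
  next
    case (Suc n)
    have x0: "0 \<le> 1 - p + p * a n" using p a0[of n] by simp
    have "ennreal (1 - p) + ennreal p * ennreal (a n) = ennreal (1 - p + p * a n)"
      using p a0[of n] by (simp add: ennreal_mult)
    then show ?case
      unfolding tree_gf_below_Suc[OF p] Suc a_Suc h_def
      by (simp only: ennreal_power[OF x0] ennreal_mult[OF s(1) zero_le_power[OF x0]])
  qed
  have "(\<lambda>n. ennreal (a n)) \<longlonglongrightarrow> (SUP n. ennreal (a n))"
    using inc by (intro LIMSEQ_SUP) (auto simp: incseq_def intro: ennreal_leI)
  moreover have "(\<lambda>n. ennreal (a n)) \<longlonglongrightarrow> ennreal L" using L by (rule tendsto_ennrealI)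
  ultimately have "(SUP n. ennreal (a n)) = ennreal L" using LIMSEQ_unique by blast
  then show ?thesis using L01 fixed by (intro exI[of _ L]) (simp add: tree_gf_eq_SUP gf h_def)
qed

section \<open>The lattice below its critical point\<close>

lemma lattice_edge_translate:
  "(\<lambda>x. x + y) ` e \<in> edges lattice \<longleftrightarrow> e \<in> edges (lattice :: (int ^ 'd) graph)"
proof -
  have "(\<lambda>x. x + y) ` e \<in> edges lattice" if ed: "e \<in> edges lattice" for e and y :: "int ^ 'd"
  proof -
    obtain a b :: "int ^ 'd" where e: "e = {a, b}" "(\<Sum>i\<in>UNIV. \<bar>a $ i - b $ i\<bar>) = 1"
      using ed by (auto simp: lattice_def)
    have "(\<lambda>x. x + y) ` e = {a + y, b + y}" using e by auto
    moreover have "(\<Sum>i\<in>UNIV. \<bar>(a + y) $ i - (b + y) $ i\<bar>) = 1" using e by simp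
    ultimately show ?thesis unfolding lattice_def snd_conv by blast
  qed
  from this[of e y] this[of "(\<lambda>x. x + y) ` e" "- y"] show ?thesis by (auto simp: image_image)
qed

lemma lattice_translation_invariance:
  fixes y :: "int ^ 'd"
  shows "measure (percolation lattice p) {\<omega> \<in> space (percolation lattice p).
      \<not> (finite (open_cluster lattice \<omega> y) \<and> card (open_cluster lattice \<omega> y) < k)} =
    measure (percolation lattice p) {\<omega> \<in> space (percolation lattice p).
      \<not> (finite (open_cluster lattice \<omega> (0 :: int ^ 'd)) \<and> card (open_cluster lattice \<omega> (0 :: int ^ 'd)) < k)}"
proof -
  let ?L = "lattice :: (int ^ 'd) graph"
  let ?M = "percolation ?L p"
  let ?\<tau> = "\<lambda>x. x + y"
  let ?r = "\<lambda>\<omega>. \<lambda>e\<in>edges ?L. \<omega> (?\<tau> ` e)"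
  let ?A = "\<lambda>z. {\<omega> \<in> space ?M. \<not> (finite (open_cluster ?L \<omega> z) \<and> card (open_cluster ?L \<omega> z) < k)}"
  have inj: "inj ?\<tau>" by (simp add: inj_on_def)
  have f: "inj_on ((`) ?\<tau>) (edges ?L)" "(`) ?\<tau> \<in> edges ?L \<rightarrow> edges ?L"
    by (auto intro!: inj_onI simp: inj_image_eq_iff[OF inj] lattice_edge_translate)
  have r: "?r \<in> ?M \<rightarrow>\<^sub>M ?M"
    using measurable_percolation_restrict[OF f(2)] by (simp add: percolation_def)
  have cl: "open_cluster ?L \<omega> y = ?\<tau> ` open_cluster ?L (?r \<omega>) 0" for \<omega>
  proof -
    have "{e \<in> edges ?L. \<omega> e} = (`) ?\<tau> ` {e \<in> edges ?L. ?r \<omega> e}"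
    proof (intro equalityI subsetI)
      fix e assume e: "e \<in> {e \<in> edges ?L. \<omega> e}"
      have "e = ?\<tau> ` ((\<lambda>x. x - y) ` e)" by (simp add: image_image)
      then show "e \<in> (`) ?\<tau> ` {e \<in> edges ?L. ?r \<omega> e}"
        using e lattice_edge_translate[of y "(\<lambda>x. x - y) ` e"] by (intro image_eqI) auto
    qed (auto simp: lattice_edge_translate)
    then show ?thesis using reach_image[OF inj, of _ "{0}"] by (simp add: open_cluster_eq_reach)
  qed
  have "finite (open_cluster ?L \<omega> y) \<longleftrightarrow> finite (open_cluster ?L (?r \<omega>) 0)"
    "card (open_cluster ?L \<omega> y) = card (open_cluster ?L (?r \<omega>) 0)" for \<omega>
    unfolding cl using inj_on_subset[OF inj subset_UNIV] by (simp_all add: finite_image_iff card_image)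
  then have eq: "?r -` ?A 0 \<inter> space ?M = ?A y"
    using measurable_space[OF r] by auto
  have "measure ?M (?A y) = measure (distr ?M ?M ?r) (?A 0)"
    unfolding measure_distr[OF r lattice.sets_large_cluster] eq ..
  also have "\<dots> = measure ?M (?A 0)" by (simp only: distr_percolation_reindex[OF f])
  finally show ?thesis .
qed

text \<open>By the zero-one law, below the critical point there is almost surely no infinite cluster at
  all; translation invariance makes the resulting tightness uniform.\<close>

lemma lattice_clusters_tight:
  assumes p: "0 \<le> p" "p \<le> 1" and crit: "p < critical_probability (lattice :: (int ^ 'd) graph)"
    and "0 < \<epsilon>"
  shows "\<exists>N. \<forall>y. measure (percolation (lattice :: (int ^ 'd) graph) p) {\<omega> \<in> space (percolation lattice p).
      \<not> (finite (open_cluster lattice \<omega> y) \<and> card (open_cluster lattice \<omega> y) < N)} \<le> \<epsilon>"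
proof -
  let ?L = "lattice :: (int ^ 'd) graph"
  let ?M = "percolation ?L p"
  interpret P: prob_space ?M by (rule prob_space_percolation)
  let ?I = "{\<omega> \<in> space ?M. \<exists>v. infinite (open_cluster ?L \<omega> v)}"
  have "measure ?M ?I \<noteq> 1"
  proof
    assume "measure ?M ?I = 1"
    moreover have "verts ?L = UNIV" by (simp add: lattice_def)
    ultimately have "critical_probability ?L \<le> p"
      unfolding critical_probability_def using p by (intro cInf_lower bdd_belowI[of _ 0]) auto
    then show False using crit by simp
  qed
  then have I: "measure ?M ?I = 0" using lattice.prob_infinite_cluster_0_1 by blast
  have setsI: "?I \<in> sets ?M"
  proof -
    have "{\<omega> \<in> space ?M. \<exists>v. \<not> (finite (open_cluster ?L \<omega> v) \<and> True)} \<in> sets ?M"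
      by (intro sets.sets_Collect_countable_Ex sets.sets_Collect_neg
          lattice.sets_Collect_finite_cluster[where Q = "\<lambda>_. True"])
    then show ?thesis by simp
  qed
  define A where "A N = {\<omega> \<in> space ?M. \<not> (finite (open_cluster ?L \<omega> 0) \<and> card (open_cluster ?L \<omega> 0) < N)}" for N
  have A: "range A \<subseteq> sets ?M" unfolding A_def using lattice.sets_large_cluster by blast
  have "decseq A" by (auto simp: A_def decseq_def)
  then have lim: "(\<lambda>N. measure ?M (A N)) \<longlonglongrightarrow> measure ?M (\<Inter>N. A N)"
    by (rule P.finite_Lim_measure_decseq[OF A])
  have "(\<Inter>N. A N) \<subseteq> ?I"
  proof
    fix \<omega> assume \<omega>: "\<omega> \<in> (\<Inter>N. A N)"
    then have "\<omega> \<in> A (Suc (card (open_cluster ?L \<omega> 0)))" by blast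
    then show "\<omega> \<in> ?I" by (auto simp: A_def)
  qed
  then have "measure ?M (\<Inter>N. A N) \<le> 0" using P.finite_measure_mono[OF _ setsI] I by simp
  then have "(\<lambda>N. measure ?M (A N)) \<longlonglongrightarrow> 0" using lim by (simp add: measure_le_0_iff)
  then have "\<forall>\<^sub>F N in sequentially. measure ?M (A N) < \<epsilon>"
    using \<open>0 < \<epsilon>\<close> by (rule order_tendstoD)
  then obtain N where "measure ?M (A N) < \<epsilon>" by (auto simp: eventually_sequentially)
  then show ?thesis
    unfolding A_def by (intro exI[of _ N] allI) (subst lattice_translation_invariance, simp)
qed

lemma (in countable_graph) cluster_gf_1_eq_1:
  assumes "0 < s" "s < 1" and tail: "\<And>k. measure (percolation H p) {\<omega> \<in> space (percolation H p).
      \<not> (finite (open_cluster H \<omega> v) \<and> card (open_cluster H \<omega> v) < k)} \<le> K * s ^ k"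
  shows "cluster_gf H p v 1 = 1"
proof -
  let ?M = "percolation H p"
  interpret P: prob_space ?M by (rule prob_space_percolation)
  let ?F = "{\<omega> \<in> space ?M. finite (open_cluster H \<omega> v) \<and> True}"
  have F: "?F \<in> sets ?M" by (rule sets_Collect_finite_cluster)
  have "1 - measure ?M ?F \<le> K * s ^ k" for k
  proof -
    have "1 - measure ?M ?F = measure ?M (space ?M - ?F)" by (rule P.prob_compl[OF F, symmetric])
    also have "\<dots> \<le> measure ?M {\<omega> \<in> space ?M.
      \<not> (finite (open_cluster H \<omega> v) \<and> card (open_cluster H \<omega> v) < k)}"
      by (intro P.finite_measure_mono sets_large_cluster) auto
    finally show ?thesis using tail by (rule order_trans)
  qed
  moreover have "(\<lambda>k. K * s ^ k) \<longlonglongrightarrow> K * 0"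
    using assms by (intro tendsto_intros LIMSEQ_realpow_zero) auto
  ultimately have "1 - measure ?M ?F \<le> 0" by (intro LIMSEQ_le_const[of _ "K * 0", simplified]) auto
  then have "measure ?M ?F = 1" using P.prob_le_1[of ?F] by linarith
  moreover have "cluster_gf H p v 1 = (\<integral>\<^sup>+\<omega>. indicator ?F \<omega> \<partial>?M)"
    unfolding cluster_gf_def by (intro nn_integral_cong) (simp add: indicator_def)
  ultimately show ?thesis using F by (simp add: P.emeasure_eq_measure)
qed

text \<open>Bound \<open>t ^ |C|\<close> by the sum of \<open>t ^ k\<close> over \<open>k \<le> |C|\<close> and choose \<open>t > 1\<close> with \<open>t * s < 1\<close>.\<close>

lemma (in countable_graph) cluster_gf_finite_of_tail:
  assumes s: "0 < s" "s < 1" and tail: "\<And>k. measure (percolation H p) {\<omega> \<in> space (percolation H p).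
      \<not> (finite (open_cluster H \<omega> v) \<and> card (open_cluster H \<omega> v) < k)} \<le> K * s ^ k"
  shows "\<exists>t>1. cluster_gf H p v (ennreal t) < \<infinity>"
proof (intro exI conjI)
  let ?M = "percolation H p"
  interpret P: prob_space ?M by (rule prob_space_percolation)
  define t where "t = (1 + 1 / s) / 2"
  have "1 < 1 / s" using s by simp
  then show t1: "1 < t" unfolding t_def by simp
  have ts: "t * s < 1" "0 \<le> t * s" using s by (auto simp: t_def field_simps)
  have "0 \<le> K * s ^ 0" by (rule order_trans[OF measure_nonneg tail])
  then have K: "0 \<le> K" by simp
  let ?A = "\<lambda>k. {\<omega> \<in> space ?M. \<not> (finite (open_cluster H \<omega> v) \<and> card (open_cluster H \<omega> v) < k)}"
  have "cluster_gf H p v (ennreal t) \<le> (\<integral>\<^sup>+\<omega>. (\<Sum>k. ennreal (t ^ k) * indicator (?A k) \<omega>) \<partial>?M)"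
    unfolding cluster_gf_def
  proof (rule nn_integral_mono)
    fix \<omega> assume \<omega>: "\<omega> \<in> space ?M"
    show "(if finite (open_cluster H \<omega> v) then ennreal t ^ card (open_cluster H \<omega> v) else 0)
        \<le> (\<Sum>k. ennreal (t ^ k) * indicator (?A k) \<omega>)"
    proof (cases "finite (open_cluster H \<omega> v)")
      case True
      let ?c = "card (open_cluster H \<omega> v)"
      have "ennreal t ^ ?c = (\<Sum>k\<in>{?c}. ennreal (t ^ k) * indicator (?A k) \<omega>)"
        using \<omega> t1 by (simp add: ennreal_power)
      also have "\<dots> \<le> (\<Sum>k. ennreal (t ^ k) * indicator (?A k) \<omega>)"
        by (rule sum_le_suminf) auto
      finally show ?thesis using True by simp
    qed simp
  qed
  also have "\<dots> = (\<Sum>k. ennreal (t ^ k) * emeasure ?M (?A k))"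
    using sets_large_cluster
    by (subst nn_integral_suminf) (auto intro!: suminf_cong nn_integral_cmult_indicator)
  also have "\<dots> \<le> (\<Sum>k. ennreal (K * (t * s) ^ k))"
  proof (intro suminf_le)
    fix k
    have "ennreal (t ^ k) * emeasure ?M (?A k) = ennreal (t ^ k * measure ?M (?A k))"
      using t1 by (simp add: P.emeasure_eq_measure ennreal_mult)
    also have "\<dots> \<le> ennreal (t ^ k * (K * s ^ k))"
      using t1 by (intro ennreal_leI mult_left_mono tail) auto
    finally show "ennreal (t ^ k) * emeasure ?M (?A k) \<le> ennreal (K * (t * s) ^ k)"
      by (simp add: power_mult_distrib mult_ac)
  qed auto
  also have "\<dots> = ennreal (\<Sum>k. K * (t * s) ^ k)"
    using ts K by (intro suminf_ennreal2 summable_mult summable_geometric) auto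
  also have "\<dots> < \<infinity>" by simp
  finally show "cluster_gf H p v (ennreal t) < \<infinity>" .
qed

text \<open>The comparison needs a parameter \<open>p > q\<close> that is itself below the critical point.\<close>

theorem lattice_subcritical_gf:
  assumes q: "0 \<le> q" "q < 1" and crit: "q < critical_probability (lattice :: (int ^ 'd) graph)"
  shows "\<exists>t>1. cluster_gf (lattice :: (int ^ 'd) graph) q 0 (ennreal t) < \<infinity>"
    and "cluster_gf (lattice :: (int ^ 'd) graph) q 0 1 = 1"
proof -
  let ?L = "lattice :: (int ^ 'd) graph"
  define p where "p = (q + min 1 (critical_probability ?L)) / 2"
  have p: "0 \<le> p" "q < p" "p \<le> 1" "p < critical_probability ?L"
    using q crit by (auto simp: p_def min_def field_simps)
  have "\<exists>s K. 0 < s \<and> s < 1 \<and> (\<forall>k v. measure (percolation ?L q) {\<omega> \<in> space (percolation ?L q).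
      \<not> (finite (open_cluster ?L \<omega> v) \<and> card (open_cluster ?L \<omega> v) < k)} \<le> K * s ^ k)"
    by (rule lattice.exponential_cluster_tail[OF q(1) p(2,3) lattice_clusters_tight[OF p(1,3,4)]])
  then obtain s K where s: "0 < s" "s < 1" and
    tail: "\<forall>k v. measure (percolation ?L q) {\<omega> \<in> space (percolation ?L q).
      \<not> (finite (open_cluster ?L \<omega> v) \<and> card (open_cluster ?L \<omega> v) < k)} \<le> K * s ^ k"
    by (elim exE conjE)
  show "\<exists>t>1. cluster_gf ?L q 0 (ennreal t) < \<infinity>"
    by (rule lattice.cluster_gf_finite_of_tail[OF s tail[THEN spec, THEN spec]])
  show "cluster_gf ?L q 0 1 = 1"
    by (rule lattice.cluster_gf_1_eq_1[OF s tail[THEN spec, THEN spec]])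
qed

section \<open>Tails of cluster sizes from generating functions\<close>

context countable_graph
begin

lemma finite_tail_emeasure:
  "(\<integral>\<^sup>+\<omega>. indicator {\<omega>. finite (open_cluster H \<omega> v) \<and> n \<le> card (open_cluster H \<omega> v)} \<omega> \<partial>percolation H p)
     = ennreal (finite_tail H p v n)"
proof -
  interpret P: prob_space "percolation H p" by (rule prob_space_percolation)
  let ?A = "{\<omega> \<in> space (percolation H p). finite (open_cluster H \<omega> v) \<and> n \<le> card (open_cluster H \<omega> v)}"
  have "(\<integral>\<^sup>+\<omega>. indicator {\<omega>. finite (open_cluster H \<omega> v) \<and> n \<le> card (open_cluster H \<omega> v)} \<omega> \<partial>percolation H p)
      = (\<integral>\<^sup>+\<omega>. indicator ?A \<omega> \<partial>percolation H p)"
    by (intro nn_integral_cong) (simp add: indicator_def)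
  also have "\<dots> = emeasure (percolation H p) ?A"
    by (rule nn_integral_indicator[OF sets_Collect_finite_cluster])
  finally show ?thesis by (simp add: finite_tail_def P.emeasure_eq_measure)
qed

lemma measurable_tail_indicator:
  "(\<lambda>\<omega>. indicator {\<omega>. finite (open_cluster H \<omega> v) \<and> n \<le> card (open_cluster H \<omega> v)} \<omega> :: ennreal)
     \<in> borel_measurable (percolation H p)"
proof -
  have "(\<lambda>\<omega>. indicator {\<omega>. finite (open_cluster H \<omega> v) \<and> n \<le> card (open_cluster H \<omega> v)} \<omega> :: ennreal) =
    (\<lambda>\<omega>. if finite (open_cluster H \<omega> v) then of_bool (n \<le> card (open_cluster H \<omega> v)) else 0)"
    by (auto simp: indicator_def)
  then show ?thesis using measurable_finite_cluster[of v "\<lambda>C. of_bool (n \<le> card C)"] by simp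
qed

text \<open>Markov's inequality for \<open>s ^ |C|\<close> on the event that \<open>C\<close> is finite.\<close>

lemma finite_tail_le_gf:
  assumes "1 \<le> s" and gf: "cluster_gf H p v (ennreal s) \<le> ennreal K"
    and "0 \<le> K"
  shows "finite_tail H p v n \<le> K / s ^ n"
proof -
  let ?A = "{\<omega>. finite (open_cluster H \<omega> v) \<and> n \<le> card (open_cluster H \<omega> v)}"
  have "ennreal (s ^ n * finite_tail H p v n) = (\<integral>\<^sup>+\<omega>. ennreal (s ^ n) * indicator ?A \<omega> \<partial>percolation H p)"
    using assms(1) measurable_tail_indicator
    by (simp add: nn_integral_cmult finite_tail_emeasure ennreal_mult finite_tail_def)
  also have "\<dots> \<le> cluster_gf H p v (ennreal s)"
    unfolding cluster_gf_def using assms(1)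
    by (intro nn_integral_mono) (auto simp: indicator_def ennreal_power intro!: power_increasing)
  also note gf
  finally have "s ^ n * finite_tail H p v n \<le> K" using \<open>0 \<le> K\<close> by (simp add: ennreal_le_iff)
  then show ?thesis using assms(1) by (simp add: field_simps)
qed

lemma cluster_gf_mono: "u \<le> u' \<Longrightarrow> cluster_gf H p v u \<le> cluster_gf H p v u'"
  unfolding cluster_gf_def by (intro nn_integral_mono) (auto intro: power_mono)

lemma cluster_gf_1_le: "cluster_gf H p v 1 \<le> 1"
proof -
  interpret P: prob_space "percolation H p" by (rule prob_space_percolation)
  have "cluster_gf H p v 1 \<le> (\<integral>\<^sup>+\<omega>. 1 \<partial>percolation H p)"
    unfolding cluster_gf_def by (intro nn_integral_mono) simp
  then show ?thesis by (simp add: P.emeasure_space_1)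
qed

lemma cluster_gf_le_self:
  assumes "u \<le> 1"
  shows "cluster_gf H p v u \<le> u"
proof -
  interpret P: prob_space "percolation H p" by (rule prob_space_percolation)
  have "cluster_gf H p v u \<le> (\<integral>\<^sup>+\<omega>. u \<partial>percolation H p)"
    unfolding cluster_gf_def
  proof (rule nn_integral_mono)
    fix \<omega>
    have "u ^ card (open_cluster H \<omega> v) \<le> u ^ 1" if "finite (open_cluster H \<omega> v)"
      using card_open_cluster_pos[OF that] assms by (intro power_decreasing) auto
    then show "(if finite (open_cluster H \<omega> v) then u ^ card (open_cluster H \<omega> v) else 0) \<le> u" by simp
  qed
  then show ?thesis by (simp add: P.emeasure_space_1)
qed

text \<open>On the event \<open>n \<le> |C| < \<infinity>\<close> the weight \<open>s ^ |C|\<close> falls short of \<open>1\<close> by at least \<open>1 - s ^ n\<close>.\<close>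

lemma cluster_gf_plus_tail_le_1:
  assumes s: "0 \<le> s" "s \<le> 1"
  shows "cluster_gf H p v (ennreal s) + ennreal ((1 - s ^ n) * finite_tail H p v n) \<le> 1"
proof -
  let ?M = "percolation H p"
  interpret P: prob_space ?M by (rule prob_space_percolation)
  let ?A = "{\<omega>. finite (open_cluster H \<omega> v) \<and> n \<le> card (open_cluster H \<omega> v)}"
  let ?g = "\<lambda>\<omega>. if finite (open_cluster H \<omega> v) then ennreal s ^ card (open_cluster H \<omega> v) else 0"
  have sn: "0 \<le> 1 - s ^ n" using s by (simp add: power_le_one)
  have "ennreal ((1 - s ^ n) * finite_tail H p v n) = (\<integral>\<^sup>+\<omega>. ennreal (1 - s ^ n) * indicator ?A \<omega> \<partial>?M)"
    using sn measurable_tail_indicator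
    by (simp only: nn_integral_cmult finite_tail_emeasure) (simp add: ennreal_mult finite_tail_def)
  then have "cluster_gf H p v (ennreal s) + ennreal ((1 - s ^ n) * finite_tail H p v n) =
      (\<integral>\<^sup>+\<omega>. ?g \<omega> + ennreal (1 - s ^ n) * indicator ?A \<omega> \<partial>?M)"
    unfolding cluster_gf_def using measurable_tail_indicator measurable_finite_cluster[of v "\<lambda>C. ennreal s ^ card C"]
    by (subst nn_integral_add) (auto intro: borel_measurable_times_ennreal)
  also have "\<dots> \<le> (\<integral>\<^sup>+\<omega>. 1 \<partial>?M)"
  proof (rule nn_integral_mono)
    fix \<omega>
    let ?c = "card (open_cluster H \<omega> v)"
    have le1: "ennreal s ^ ?c \<le> 1" using s by (simp add: ennreal_power power_le_one)
    show "?g \<omega> + ennreal (1 - s ^ n) * indicator ?A \<omega> \<le> 1"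
    proof (cases "\<omega> \<in> ?A")
      case True
      then have "s ^ ?c \<le> s ^ n" using s by (intro power_decreasing) auto
      then have "ennreal (s ^ ?c + (1 - s ^ n)) \<le> ennreal 1" by (intro ennreal_leI) simp
      then have "ennreal (s ^ ?c) + ennreal (1 - s ^ n) \<le> 1"
        unfolding ennreal_plus[OF zero_le_power[OF s(1)] sn] by simp
      then show ?thesis using True s by (simp add: ennreal_power)
    qed (use le1 in auto)
  qed
  also have "\<dots> = 1" by (simp add: P.emeasure_space_1)
  finally show ?thesis .
qed

text \<open>At \<open>u = 1\<close> the generating function is the probability of a finite cluster.\<close>

lemma AE_finite_cluster:
  assumes "cluster_gf H p v 1 = 1"
  shows "AE \<omega> in percolation H p. finite (open_cluster H \<omega> v)"
proof -
  interpret P: prob_space "percolation H p" by (rule prob_space_percolation)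
  let ?F = "{\<omega> \<in> space (percolation H p). finite (open_cluster H \<omega> v) \<and> True}"
  have F: "?F \<in> sets (percolation H p)" by (rule sets_Collect_finite_cluster)
  have "cluster_gf H p v 1 = (\<integral>\<^sup>+\<omega>. indicator ?F \<omega> \<partial>percolation H p)"
    unfolding cluster_gf_def by (intro nn_integral_cong) (simp add: indicator_def)
  then have "emeasure (percolation H p) ?F = 1" using assms by (simp only: nn_integral_indicator[OF F])
  then have "P.prob ?F = 1" by (simp only: measure_def enn2real_1)
  then show ?thesis using P.prob_Collect_eq_1[OF F] by simp
qed

text \<open>Sizes below \<open>n\<close> cost at most \<open>1 - s ^ |C| \<le> (1 - s) * |C|\<close>, and the mean of \<open>|C|\<close> restricted to
  these sizes is at most the sum of the first \<open>n\<close> tail probabilities.\<close>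

lemma one_le_cluster_gf_plus_tail:
  assumes s: "0 \<le> s" "s \<le> 1" and fin: "cluster_gf H p v 1 = 1"
  shows "1 \<le> cluster_gf H p v (ennreal s)
    + ennreal (finite_tail H p v n + (1 - s) * (\<Sum>k=1..n. finite_tail H p v k))"
proof -
  let ?M = "percolation H p"
  interpret P: prob_space ?M by (rule prob_space_percolation)
  let ?A = "\<lambda>n. {\<omega>. finite (open_cluster H \<omega> v) \<and> n \<le> card (open_cluster H \<omega> v)}"
  let ?i = "\<lambda>n \<omega>. indicator (?A n) \<omega> :: ennreal"
  let ?g = "\<lambda>\<omega>. if finite (open_cluster H \<omega> v) then ennreal s ^ card (open_cluster H \<omega> v) else 0"
  note m = measurable_tail_indicator measurable_finite_cluster[of v "\<lambda>C. ennreal s ^ card C"]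
  have "1 = (\<integral>\<^sup>+\<omega>. 1 \<partial>?M)" by (simp add: P.emeasure_space_1)
  also have "\<dots> \<le> (\<integral>\<^sup>+\<omega>. ?g \<omega> + (?i n \<omega> + ennreal (1 - s) * (\<Sum>k=1..n. ?i k \<omega>)) \<partial>?M)"
  proof (rule nn_integral_mono_AE, use AE_finite_cluster[OF fin] in eventually_elim)
    fix \<omega> assume fin: "finite (open_cluster H \<omega> v)"
    let ?c = "card (open_cluster H \<omega> v)"
    show "1 \<le> ?g \<omega> + (?i n \<omega> + ennreal (1 - s) * (\<Sum>k=1..n. ?i k \<omega>))"
    proof (cases "n \<le> ?c")
      case True
      then have "?i n \<omega> = 1" using fin by simp
      then show ?thesis by (simp add: add_increasing add_increasing2)
    next
      case False
      have "(\<Sum>k=1..n. ?i k \<omega>) = (\<Sum>k=1..n. if k \<in> {1..?c} then 1 else 0)"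
        using fin by (intro sum.cong) (auto simp: indicator_def)
      also have "\<dots> = (\<Sum>k\<in>{1..n} \<inter> {1..?c}. 1)" by (rule sum.inter_restrict[symmetric]) simp
      also have "{1..n} \<inter> {1..?c} = {1..?c}" using False by auto
      also have "(\<Sum>k\<in>{1..?c}. 1 :: ennreal) = ennreal (real ?c)"
        by (simp add: ennreal_of_nat_eq_real_of_nat)
      finally have S: "(\<Sum>k=1..n. ?i k \<omega>) = ennreal (real ?c)" .
      have "1 + real ?c * (s - 1) \<le> (1 + (s - 1)) ^ ?c"
        using s by (intro Bernoulli_inequality) simp
      then have "1 \<le> s ^ ?c + (1 - s) * real ?c" by (simp add: algebra_simps)
      then have "ennreal 1 \<le> ennreal (s ^ ?c + (1 - s) * real ?c)" by (rule ennreal_leI)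
      also have "\<dots> = ennreal (s ^ ?c) + ennreal (1 - s) * ennreal (real ?c)"
        using s by (simp add: ennreal_mult)
      finally have "1 \<le> ?g \<omega> + ennreal (1 - s) * (\<Sum>k=1..n. ?i k \<omega>)"
        using fin s unfolding S by (simp add: ennreal_power)
      also have "\<dots> \<le> ?g \<omega> + (?i n \<omega> + ennreal (1 - s) * (\<Sum>k=1..n. ?i k \<omega>))"
        by (intro add_left_mono) (simp add: add_increasing)
      finally show ?thesis .
    qed
  qed
  also have "\<dots> = cluster_gf H p v (ennreal s)
      + (\<integral>\<^sup>+\<omega>. ?i n \<omega> + ennreal (1 - s) * (\<Sum>k=1..n. ?i k \<omega>) \<partial>?M)"
    unfolding cluster_gf_def
    by (intro nn_integral_add m borel_measurable_add borel_measurable_times_ennreal borel_measurable_sum) auto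
  also have "(\<integral>\<^sup>+\<omega>. ?i n \<omega> + ennreal (1 - s) * (\<Sum>k=1..n. ?i k \<omega>) \<partial>?M) =
      (\<integral>\<^sup>+\<omega>. ?i n \<omega> \<partial>?M) + (\<integral>\<^sup>+\<omega>. ennreal (1 - s) * (\<Sum>k=1..n. ?i k \<omega>) \<partial>?M)"
    by (intro nn_integral_add m borel_measurable_times_ennreal borel_measurable_sum) auto
  also have "(\<integral>\<^sup>+\<omega>. ennreal (1 - s) * (\<Sum>k=1..n. ?i k \<omega>) \<partial>?M) =
      ennreal (1 - s) * (\<Sum>k=1..n. \<integral>\<^sup>+\<omega>. ?i k \<omega> \<partial>?M)"
    by (subst nn_integral_cmult, intro borel_measurable_sum m, subst nn_integral_sum, intro m) auto
  also have "(\<integral>\<^sup>+\<omega>. ?i n \<omega> \<partial>?M) + ennreal (1 - s) * (\<Sum>k=1..n. \<integral>\<^sup>+\<omega>. ?i k \<omega> \<partial>?M) =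
      ennreal (finite_tail H p v n + (1 - s) * (\<Sum>k=1..n. finite_tail H p v k))"
    unfolding finite_tail_emeasure using s
    by (simp add: ennreal_mult sum_nonneg finite_tail_def sum_ennreal[symmetric] del: sum_ennreal)
  finally show ?thesis .
qed

text \<open>Exponential moments imply a finite mean, which makes the generating function at most
  linear in \<open>1 - a\<close> away from \<open>1\<close>.\<close>

lemma cluster_gf_linear_bound:
  assumes t: "1 < t" "cluster_gf H p v (ennreal t) < \<infinity>" and fin: "cluster_gf H p v 1 = 1"
  shows "\<exists>K\<ge>0. \<forall>a. 0 \<le> a \<longrightarrow> a \<le> 1 \<longrightarrow> 1 \<le> cluster_gf H p v (ennreal a) + ennreal ((1 - a) * K)"
proof -
  let ?M = "percolation H p"
  interpret P: prob_space ?M by (rule prob_space_percolation)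
  obtain T where T: "0 \<le> T" "cluster_gf H p v (ennreal t) = ennreal T"
    using t(2) by (cases "cluster_gf H p v (ennreal t)") auto
  let ?g = "\<lambda>a \<omega>. if finite (open_cluster H \<omega> v) then ennreal a ^ card (open_cluster H \<omega> v) else 0"
  note m = measurable_finite_cluster[of v "\<lambda>C. ennreal a ^ card C" for a]
  have "1 \<le> cluster_gf H p v (ennreal a) + ennreal ((1 - a) * (T / (t - 1)))" if a: "0 \<le> a" "a \<le> 1" for a
  proof -
    have "1 = (\<integral>\<^sup>+\<omega>. 1 \<partial>?M)" by (simp add: P.emeasure_space_1)
    also have "\<dots> \<le> (\<integral>\<^sup>+\<omega>. ?g a \<omega> + ennreal ((1 - a) / (t - 1)) * ?g t \<omega> \<partial>?M)"
    proof (rule nn_integral_mono_AE, use AE_finite_cluster[OF fin] in eventually_elim)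
      fix \<omega> assume fin: "finite (open_cluster H \<omega> v)"
      let ?c = "card (open_cluster H \<omega> v)"
      have "1 + real ?c * (a - 1) \<le> (1 + (a - 1)) ^ ?c"
        using a by (intro Bernoulli_inequality) simp
      moreover have "1 + real ?c * (t - 1) \<le> (1 + (t - 1)) ^ ?c"
        using t by (intro Bernoulli_inequality) simp
      then have "real ?c \<le> t ^ ?c / (t - 1)" using t by (simp add: field_simps)
      then have "(1 - a) * real ?c \<le> (1 - a) * (t ^ ?c / (t - 1))" using a by (intro mult_left_mono) auto
      ultimately have "1 \<le> a ^ ?c + (1 - a) / (t - 1) * t ^ ?c" by (simp add: algebra_simps)
      then have "ennreal 1 \<le> ennreal (a ^ ?c + (1 - a) / (t - 1) * t ^ ?c)" by (rule ennreal_leI)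
      also have "\<dots> = ennreal (a ^ ?c) + ennreal ((1 - a) / (t - 1)) * ennreal (t ^ ?c)"
        using a t by (simp add: ennreal_mult[symmetric])
      finally show "1 \<le> ?g a \<omega> + ennreal ((1 - a) / (t - 1)) * ?g t \<omega>"
        using fin a t by (simp add: ennreal_power)
    qed
    also have "\<dots> = cluster_gf H p v (ennreal a) + ennreal ((1 - a) / (t - 1)) * ennreal T"
      unfolding T(2)[symmetric] cluster_gf_def
      by (subst nn_integral_add) (simp_all add: m nn_integral_cmult borel_measurable_times_ennreal)
    also have "ennreal ((1 - a) / (t - 1)) * ennreal T = ennreal ((1 - a) * (T / (t - 1)))"
      using a t T by (simp add: ennreal_mult[symmetric])
    finally show ?thesis .
  qed
  then show ?thesis using t T by (intro exI[of _ "T / (t - 1)"]) auto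
qed

end

section \<open>Solutions of the fixed-point equation of the tree\<close>

lemma one_minus_power_ge:
  assumes "2 \<le> r" "0 \<le> x" "real r * x \<le> 1"
  shows "1 - real r * x + (real r)\<^sup>2 / 4 * x\<^sup>2 \<le> (1 - x) ^ r"
  using assms
proof (induction r rule: dec_induct)
  case base
  then show ?case by (simp add: power2_eq_square algebra_simps)
next
  case (step r)
  have rx: "real r * x \<le> 1" and x1: "x \<le> 1" "0 \<le> x"
    using step by (auto simp: algebra_simps intro: order_trans[OF _ step.prems(2)])
  have r: "2 \<le> real r" using step by simp
  have "0 \<le> x\<^sup>2 * (real r / 2 - 1 / 4 - real r * (real r * x) / 4)"
  proof (intro mult_nonneg_nonneg)
    have "real r * (real r * x) \<le> real r * 1" using rx by (intro mult_left_mono) auto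
    then show "0 \<le> real r / 2 - 1 / 4 - real r * (real r * x) / 4" using r by linarith
  qed simp
  then have "1 - real (Suc r) * x + (real (Suc r))\<^sup>2 / 4 * x\<^sup>2
      \<le> (1 - x) * (1 - real r * x + (real r)\<^sup>2 / 4 * x\<^sup>2)"
    by (simp add: power2_eq_square field_simps)
  also have "\<dots> \<le> (1 - x) * (1 - x) ^ r" using x1 step.IH rx by (intro mult_left_mono) auto
  finally show ?case by simp
qed

lemma one_minus_power_le:
  assumes "0 \<le> x" "x \<le> 1"
  shows "(1 - x) ^ r \<le> 1 - real r * x + (real r)\<^sup>2 / 2 * x\<^sup>2"
proof (induction r)
  case (Suc r)
  have "(1 - x) ^ Suc r \<le> (1 - x) * (1 - real r * x + (real r)\<^sup>2 / 2 * x\<^sup>2)"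
    using Suc assms by (simp add: mult_left_mono)
  also have "0 \<le> x\<^sup>2 / 2 + (real r)\<^sup>2 / 2 * x ^ 3" using assms by simp
  then have "(1 - x) * (1 - real r * x + (real r)\<^sup>2 / 2 * x\<^sup>2)
      \<le> 1 - real (Suc r) * x + (real (Suc r))\<^sup>2 / 2 * x\<^sup>2"
    by (simp add: power2_eq_square power3_eq_cube field_simps)
  finally show ?case .
qed simp

text \<open>At \<open>p = 1 / r\<close> the map \<open>y \<mapsto> 1 - (1 - y / r) ^ r\<close> is tangent to the identity at \<open>0\<close> with
  a nondegenerate quadratic term; this is the origin of the exponent \<open>1 / 2\<close>.\<close>

lemma critical_tree_gf:
  assumes r: "2 \<le> r" and s: "1 / 2 \<le> s" "s \<le> 1"
  shows "\<exists>a. 0 \<le> a \<and> a \<le> 1 \<and> cluster_gf (rooted_tree r) (1 / real r) [] (ennreal s) = ennreal a \<and>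
    sqrt (1 - s) / 2 \<le> 1 - a \<and> 1 - a \<le> 3 * sqrt (1 - s)"
proof -
  have p: "0 \<le> 1 / real r" "1 / real r \<le> 1" using r by auto
  obtain a where a: "0 \<le> a" "a \<le> 1" "cluster_gf (rooted_tree r) (1 / real r) [] (ennreal s) = ennreal a"
    "a = s * (1 - 1 / real r + 1 / real r * a) ^ r"
    using tree_gf_fixed_point[OF p, of s r] s by auto
  define y x where "y = 1 - a" and "x = y / real r"
  have y: "0 \<le> y" "y \<le> 1" using a by (auto simp: y_def)
  have rx: "real r * x = y" using r by (simp add: x_def)
  have x: "0 \<le> x" "x \<le> 1" using y r by (auto simp: x_def field_simps)
  have x': "1 - x = 1 - 1 / real r + 1 / real r * a"
    by (simp add: x_def y_def diff_divide_distrib)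
  have "1 - y = a" by (simp add: y_def)
  then have eq: "1 - y = s * (1 - x) ^ r" unfolding x' using a(4) by (rule trans)
  have r2: "(real r)\<^sup>2 * x\<^sup>2 = y\<^sup>2" using rx by (simp flip: power_mult_distrib)
  have "1 - y + y\<^sup>2 / 4 \<le> (1 - x) ^ r"
    using one_minus_power_ge[OF r x(1)] rx y r2 by (simp add: field_simps)
  then have "s * (1 - y + y\<^sup>2 / 4) \<le> 1 - y" unfolding eq using s by (intro mult_left_mono) auto
  then have "s * y\<^sup>2 / 4 \<le> (1 - s) * (1 - y)" by (simp add: algebra_simps)
  also have "\<dots> \<le> (1 - s) * 1" using s y by (intro mult_left_mono) auto
  finally have "s * y\<^sup>2 \<le> 4 * (1 - s)" by simp
  moreover have "1 / 2 * y\<^sup>2 \<le> s * y\<^sup>2" using s by (intro mult_right_mono) auto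
  ultimately have "y\<^sup>2 \<le> 9 * (1 - s)" using s by simp
  then have "sqrt (y\<^sup>2) \<le> sqrt (9 * (1 - s))" by (rule real_sqrt_le_mono)
  then have up: "y \<le> 3 * sqrt (1 - s)" using y real_sqrt_mult[of 9 "1 - s"] by simp
  have "(1 - x) ^ r \<le> 1 - y + y\<^sup>2 / 2"
    using one_minus_power_le[OF x, of r] rx r2 by (simp add: field_simps)
  then have "1 - y \<le> s * (1 - y + y\<^sup>2 / 2)" unfolding eq using s by (intro mult_left_mono) auto
  then have "(1 - s) * (1 - y) \<le> s * y\<^sup>2 / 2" by (simp add: algebra_simps)
  also have "\<dots> \<le> 1 * y\<^sup>2 / 2" using s by (intro divide_right_mono mult_right_mono) auto
  finally have low: "(1 - s) * (1 - y) \<le> y\<^sup>2 / 2" by simp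
  have "sqrt (1 - s) / 2 \<le> y"
  proof (cases "y \<le> 1 / 2")
    case True
    then have "(1 - s) * (1 / 2) \<le> (1 - s) * (1 - y)" using s by (intro mult_left_mono) auto
    then have "1 - s \<le> y\<^sup>2" using low by simp
    then have "sqrt (1 - s) \<le> y" using y by (intro real_le_lsqrt) auto
    then show ?thesis using y real_sqrt_ge_zero[of "1 - s"] s by simp
  next
    case False
    moreover have "sqrt (1 - s) \<le> 1" using s by simp
    ultimately show ?thesis by linarith
  qed
  then show ?thesis using a up by (intro exI[of _ a]) (simp add: y_def)
qed

text \<open>The map \<open>u \<mapsto> (1 - p + p * u) ^ r\<close> fixes \<open>1\<close> with slope \<open>r * p\<close>. If the slope exceeds \<open>1\<close>, the map
  lies below the diagonal at some \<open>u = 1 - y < 1\<close>, which leaves room for a factor \<open>s > 1\<close> that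
  keeps \<open>u\<close> a supersolution.\<close>

lemma supercritical_tree_gf:
  assumes p: "1 / real r < p" "p < 1" and r: "2 \<le> r"
  shows "\<exists>s>1. cluster_gf (rooted_tree r) p [] (ennreal s) \<le> 1"
proof -
  define m where "m = real r * p"
  have m: "1 < m" using p r by (simp add: m_def field_simps)
  \<comment> \<open>So small that the quadratic term of \<open>(1 - p * y) ^ r\<close> stays below the gain \<open>(m - 1) * y\<close>.\<close>
  define y where "y = min (1 / 2) ((m - 1) / m\<^sup>2)"
  have y: "0 < y" "y \<le> 1 / 2"
    unfolding y_def using m by (simp, intro min.cobounded1)
  have "y * m\<^sup>2 \<le> m - 1" using m mult_right_mono[of y "(m - 1) / m\<^sup>2" "m\<^sup>2"] by (simp add: y_def)
  then have "y * (y * m\<^sup>2 / 2) < y * (m - 1)" using m y by (intro mult_strict_left_mono) auto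
  moreover define h where "h = (1 - p * y) ^ r"
  have p0: "0 < p" using p(1) by (rule le_less_trans[rotated]) simp
  have py: "0 \<le> p * y" "p * y < 1" using p p0 y mult_strict_mono[of p 1 y 1] by auto
  then have "h \<le> 1 - real r * (p * y) + (real r)\<^sup>2 / 2 * (p * y)\<^sup>2"
    unfolding h_def by (intro one_minus_power_le) auto
  then have "h \<le> 1 - m * y + m\<^sup>2 / 2 * y\<^sup>2" by (simp add: m_def power_mult_distrib mult_ac)
  ultimately have hy: "h < 1 - y" by (simp add: algebra_simps power2_eq_square)
  have h0: "0 < h" using py by (simp add: h_def)
  define s where "s = (1 - y) / h"
  have s: "1 < s" "s * h = 1 - y" using hy h0 by (auto simp: s_def)
  have E: "ennreal (1 - p) + ennreal p * ennreal (1 - y) = ennreal (1 - p * y)"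
    using p p0 y by (simp add: ennreal_mult[symmetric] ennreal_plus[symmetric] algebra_simps del: ennreal_plus)
  have "ennreal s * (ennreal (1 - p) + ennreal p * ennreal (1 - y)) ^ r = ennreal (s * h)"
  proof -
    have X: "0 \<le> 1 - p * y" using py by simp
    show ?thesis unfolding E ennreal_power[OF X] h_def
      using s X by (intro ennreal_mult[symmetric]) auto
  qed
  then have "cluster_gf (rooted_tree r) p [] (ennreal s) \<le> ennreal (1 - y)"
    using s p p0 by (intro tree_gf_le_supersolution) auto
  also have "\<dots> \<le> 1" using y by simp
  finally show ?thesis using s by blast
qed

text \<open>If the slope is less than \<open>1\<close>, the map lies below the diagonal immediately to the right of \<open>1\<close>,
  so that the supersolution can be found below any \<open>t > 1\<close>.\<close>

lemma subcritical_tree_gf: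
  assumes p: "0 < p" "p < 1 / real r" and r: "2 \<le> r" and t: "1 < t"
  shows "\<exists>s>1. cluster_gf (rooted_tree r) p [] (ennreal s) \<le> ennreal t"
proof -
  define m where "m = real r * p"
  have m: "0 < m" "m < 1" using p r by (auto simp: m_def field_simps)
  have "1 / real r \<le> 1" using r by simp
  then have p1: "p < 1" using p by linarith
  define y where "y = min (t - 1) ((1 - m) / 2)"
  have y: "0 < y" "y \<le> t - 1" "y \<le> (1 - m) / 2"
    unfolding y_def using m t by (simp, intro min.cobounded1, intro min.cobounded2)
  have "m * y \<le> 1 * ((1 - m) / 2)" using m y by (intro mult_mono) auto
  then have my: "m * y < 1 - m" using m by simp
  \<comment> \<open>The bound \<open>h \<le> 1 / (1 - m * y)\<close> follows from Bernoulli's inequality for \<open>(1 - p * y) ^ r\<close>.\<close>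
  define h where "h = (1 + p * y) ^ r"
  have "p * y \<le> m * y" using r p y by (intro mult_right_mono) (auto simp: m_def)
  then have "p * y < 1" using my m by linarith
  with p y have py: "0 < p * y" "p * y < 1" by auto
  have "1 - m * y \<le> (1 - p * y) ^ r"
    using Bernoulli_inequality[of "- (p * y)" r] py by (simp add: m_def mult_ac)
  then have "h * (1 - m * y) \<le> h * (1 - p * y) ^ r" using py by (intro mult_left_mono) (auto simp: h_def)
  also have "\<dots> = ((1 + p * y) * (1 - p * y)) ^ r" by (simp add: h_def power_mult_distrib)
  also have "\<dots> \<le> 1"
  proof (rule power_le_one)
    have "(1 + p * y) * (1 - p * y) = 1 - (p * y)\<^sup>2" by (simp add: power2_eq_square algebra_simps)
    also have "\<dots> \<le> 1" by simp
    finally show "(1 + p * y) * (1 - p * y) \<le> 1" .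
  qed (use py in simp)
  also have "1 < (1 + y) * (1 - m * y)"
  proof -
    have "0 < y * (1 - m - m * y)" using y my by (intro mult_pos_pos) auto
    then show ?thesis by (simp add: algebra_simps)
  qed
  finally have hy: "h < 1 + y" using my m by simp
  have h0: "0 < h" using py by (simp add: h_def)
  define s where "s = (1 + y) / h"
  have s: "1 < s" "s * h = 1 + y" using hy h0 by (auto simp: s_def)
  have E: "ennreal (1 - p) + ennreal p * ennreal (1 + y) = ennreal (1 + p * y)"
    using p p1 y by (simp add: ennreal_mult[symmetric] ennreal_plus[symmetric] algebra_simps del: ennreal_plus)
  have "ennreal s * (ennreal (1 - p) + ennreal p * ennreal (1 + y)) ^ r = ennreal (s * h)"
  proof -
    have X: "0 \<le> 1 + p * y" using py by simp
    show ?thesis unfolding E ennreal_power[OF X] h_def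
      using s X by (intro ennreal_mult[symmetric]) auto
  qed
  then have "cluster_gf (rooted_tree r) p [] (ennreal s) \<le> ennreal (1 + y)"
    using s p p1 by (intro tree_gf_le_supersolution) auto
  also have "\<dots> \<le> ennreal t" using y by (intro ennreal_leI) simp
  finally show ?thesis using s by blast
qed

section \<open>A Tauberian argument\<close>

lemma sum_inverse_sqrt_le: "(\<Sum>k=1..n. 1 / sqrt (real k)) \<le> 2 * sqrt (real n)"
proof (induction n)
  case (Suc n)
  have "2 * (sqrt (real n) * sqrt (real (Suc n))) \<le> (sqrt (real n))\<^sup>2 + (sqrt (real (Suc n)))\<^sup>2"
    using sum_squares_bound[of "sqrt (real n)" "sqrt (real (Suc n))"] by simp
  then have "2 * sqrt (real n) + 1 / sqrt (real (Suc n)) \<le> 2 * sqrt (real (Suc n))"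
    by (simp add: field_simps)
  then show ?case using Suc by simp
qed simp

text \<open>The upper bound uses \<open>s = 1 - 1 / (2 n)\<close>. For the lower bound \<open>1 - s = \<delta> / n\<close> with \<open>\<delta>\<close>
  small: then the part of \<open>1 - g s\<close> due to values below \<open>n\<close>, which is at most
  \<open>(1 - s) * O(\<surd>n)\<close> by the upper bound, does not exhaust \<open>1 - g s \<ge> a * \<surd>(\<delta> / n)\<close>.\<close>

lemma tail_of_square_root_singularity:
  fixes \<tau> :: "nat \<Rightarrow> real" and g :: "real \<Rightarrow> real"
  assumes \<tau>: "\<And>n. 0 \<le> \<tau> n"
    and upper: "\<And>n s. 1 / 2 \<le> s \<Longrightarrow> s < 1 \<Longrightarrow> g s + (1 - s ^ n) * \<tau> n \<le> 1"
    and lower: "\<And>n s. 1 / 2 \<le> s \<Longrightarrow> s < 1 \<Longrightarrow> 1 \<le> g s + (\<tau> n + (1 - s) * (\<Sum>k=1..n. \<tau> k))"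
    and sing: "\<And>s. 1 / 2 \<le> s \<Longrightarrow> s < 1 \<Longrightarrow> a * sqrt (1 - s) \<le> 1 - g s"
      "\<And>s. 1 / 2 \<le> s \<Longrightarrow> s < 1 \<Longrightarrow> 1 - g s \<le> b * sqrt (1 - s)"
    and a: "0 < a"
  shows "\<exists>c>0. \<exists>C. \<forall>n\<ge>1. c / sqrt (real n) \<le> \<tau> n \<and> \<tau> n \<le> C / sqrt (real n)"
proof -
  have "a * sqrt (1 - 1 / 2) \<le> b * sqrt (1 - 1 / 2)" using sing[of "1 / 2"] by linarith
  then have b: "0 < b" using a by (simp add: mult_le_cancel_right)
  define \<kappa> where "\<kappa> = 1 - exp (- (1 / 2) :: real)"
  have \<kappa>: "0 < \<kappa>" by (simp add: \<kappa>_def)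
  define C where "C = b / \<kappa>"
  have C: "0 < C" using b \<kappa> by (simp add: C_def)
  have up: "\<tau> n \<le> C / sqrt (real n)" if n: "1 \<le> n" for n
  proof -
    define s where "s = 1 - 1 / 2 / real n"
    have s: "1 / 2 \<le> s" "s < 1" using n by (auto simp: s_def field_simps)
    have "s ^ n \<le> exp (- (1 / 2))"
      unfolding s_def using n by (intro exp_ge_one_minus_x_over_n_power_n) auto
    then have "\<kappa> * \<tau> n \<le> (1 - s ^ n) * \<tau> n" using \<tau> by (intro mult_right_mono) (auto simp: \<kappa>_def)
    also have "\<dots> \<le> b * sqrt (1 - s)" using upper[OF s, of n] sing(2)[OF s] by linarith
    also have "\<dots> \<le> b * sqrt (1 / real n)"
      using b n by (intro mult_left_mono real_sqrt_le_mono) (auto simp: s_def field_simps)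
    finally have "\<tau> n * \<kappa> \<le> b / sqrt (real n)" by (simp add: real_sqrt_divide mult.commute)
    then have "\<tau> n \<le> b / sqrt (real n) / \<kappa>" using \<kappa> by (simp only: pos_le_divide_eq)
    then show ?thesis by (simp add: C_def mult.commute)
  qed
  define \<eta> where "\<eta> = min (1 / 2) (a / (4 * C))"
  have \<eta>: "0 < \<eta>" "\<eta> \<le> 1 / 2" "\<eta> \<le> a / (4 * C)"
    unfolding \<eta>_def using a C by (simp, intro min.cobounded1, intro min.cobounded2)
  have "\<eta> * (2 * C) \<le> a / (4 * C) * (2 * C)" using \<eta> C by (intro mult_right_mono) auto
  then have "a / 2 \<le> a - 2 * C * \<eta>" using C by (simp add: field_simps)
  then have c: "0 < \<eta> * (a - 2 * C * \<eta>)" using \<eta> a by (intro mult_pos_pos) auto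
  have low: "\<eta> * (a - 2 * C * \<eta>) / sqrt (real n) \<le> \<tau> n" if n: "1 \<le> n" for n
  proof -
    define s where "s = 1 - \<eta>\<^sup>2 / real n"
    have "\<eta>\<^sup>2 \<le> (1 / 2)\<^sup>2" using \<eta> by (intro power_mono) auto
    then have "\<eta>\<^sup>2 \<le> 1 / 2 * real n" using n by (simp add: power2_eq_square)
    then have s: "1 / 2 \<le> s" "s < 1" using n \<eta> by (auto simp: s_def field_simps)
    have sq: "sqrt (1 - s) = \<eta> / sqrt (real n)" using \<eta> by (simp add: s_def real_sqrt_divide)
    have "(\<Sum>k=1..n. \<tau> k) \<le> (\<Sum>k=1..n. C * (1 / sqrt (real k)))"
      using up by (intro sum_mono) simp
    also have "\<dots> = C * (\<Sum>k=1..n. 1 / sqrt (real k))" by (rule sum_distrib_left[symmetric])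
    also have "\<dots> \<le> C * (2 * sqrt (real n))" using C by (intro mult_left_mono sum_inverse_sqrt_le) auto
    finally have "(1 - s) * (\<Sum>k=1..n. \<tau> k) \<le> (1 - s) * (C * (2 * sqrt (real n)))"
      using s by (intro mult_left_mono) auto
    also have "\<dots> = 2 * C * \<eta>\<^sup>2 * (sqrt (real n) / real n)" by (simp add: s_def)
    also have "\<dots> = 2 * C * \<eta>\<^sup>2 / sqrt (real n)"
      by (subst sqrt_divide_self_eq) (simp_all add: divide_inverse)
    finally have "a * (\<eta> / sqrt (real n)) \<le> \<tau> n + 2 * C * \<eta>\<^sup>2 / sqrt (real n)"
      using sing(1)[OF s] lower[OF s, of n] unfolding sq by linarith
    then show ?thesis by (simp add: algebra_simps diff_divide_distrib power2_eq_square)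
  qed
  show ?thesis using c up low by (intro exI[of _ "\<eta> * (a - 2 * C * \<eta>)"] conjI exI[of _ C]) auto
qed

text \<open>A constant \<open>K > 1\<close> in front of an exponential bound can be absorbed into the rate for large \<open>n\<close>;
  for the finitely many other \<open>n\<close> some bound \<open>\<rho> < 1\<close> is enough.\<close>

lemma exponential_bound_of_two_bounds:
  assumes s: "1 < s" and \<rho>: "0 < \<rho>" "\<rho> < (1 :: real)"
  shows "\<exists>\<nu>>0. \<forall>n x. 1 \<le> n \<longrightarrow> 0 \<le> x \<longrightarrow> x \<le> K / s ^ n \<longrightarrow> x \<le> \<rho> \<longrightarrow> x \<le> exp (- \<nu> * real n)"
proof -
  define K' where "K' = max K 1"
  define N where "N = nat \<lceil>2 * ln K' / ln s\<rceil> + 1"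
  have ls: "0 < ln s" using s by simp
  have lr: "ln \<rho> < 0" using \<rho> by simp
  define \<nu> where "\<nu> = min (ln s / 2) (- ln \<rho> / real N)"
  have \<nu>: "0 < \<nu>" "\<nu> \<le> ln s / 2" "\<nu> \<le> - ln \<rho> / real N"
  proof -
    have "0 < real N" by (simp add: N_def)
    then show "0 < \<nu>" using ls lr by (simp add: \<nu>_def divide_neg_pos)
  qed (unfold \<nu>_def, intro min.cobounded1, intro min.cobounded2)
  have "x \<le> exp (- \<nu> * real n)" if n: "1 \<le> n" and x: "0 \<le> x" "x \<le> K / s ^ n" "x \<le> \<rho>" for n x
  proof (cases "n \<ge> N")
    case True
    then have "2 * ln K' / ln s \<le> real n" unfolding N_def by linarith
    then have K: "ln K' \<le> real n * (ln s / 2)" using ls by (simp add: field_simps)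
    have "K / s ^ n \<le> K' / s ^ n" using s by (intro divide_right_mono) (auto simp: K'_def)
    then have "x \<le> K' / s ^ n" using x(2) by linarith
    also have "\<dots> = exp (ln K' - real n * ln s)"
    proof -
      have "0 < K'" by (simp add: K'_def)
      then show ?thesis using s by (simp add: exp_diff exp_of_nat_mult)
    qed
    also have "\<dots> \<le> exp (- \<nu> * real n)"
    proof -
      have "\<nu> * real n \<le> ln s / 2 * real n" using \<nu> by (intro mult_right_mono) auto
      then show ?thesis using K by (simp add: algebra_simps)
    qed
    finally show ?thesis .
  next
    case False
    have "\<nu> * real n \<le> - ln \<rho> / real N * real N" using \<nu> False by (intro mult_mono) auto
    then have "\<nu> * real n \<le> - ln \<rho>" using False by simp
    then have "exp (ln \<rho>) \<le> exp (- \<nu> * real n)" by simp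
    then show ?thesis using x(3) \<rho> by simp
  qed
  then show ?thesis using \<nu> by blast
qed

section \<open>Clusters of prescribed size\<close>

lemma finite_lattice_neighbours: "finite {e \<in> edges (lattice :: (int ^ 'd) graph). 0 \<in> e}"
proof (rule finite_subset)
  let ?B = "{x :: int ^ 'd. \<forall>i. x $ i \<in> {-1..1}}"
  have "?B \<subseteq> vec_lambda ` (UNIV \<rightarrow>\<^sub>E {-1..1})"
  proof
    fix x :: "int ^ 'd" assume "x \<in> ?B"
    then have "vec_nth x \<in> UNIV \<rightarrow>\<^sub>E {-1..1}" by auto
    then have "vec_lambda (vec_nth x) \<in> vec_lambda ` (UNIV \<rightarrow>\<^sub>E {-1..1})" by (rule imageI)
    then show "x \<in> vec_lambda ` (UNIV \<rightarrow>\<^sub>E {-1..1})" by simp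
  qed
  then have "finite ?B" by (rule finite_subset) (intro finite_imageI finite_PiE, auto)
  then show "finite ((\<lambda>x. {0, x}) ` ?B)" by simp
  show "{e \<in> edges (lattice :: (int ^ 'd) graph). 0 \<in> e} \<subseteq> (\<lambda>x. {0, x}) ` ?B"
  proof
    fix e :: "(int ^ 'd) set" assume e: "e \<in> {e \<in> edges lattice. 0 \<in> e}"
    have B: "x \<in> ?B" if "(\<Sum>i\<in>UNIV. \<bar>x $ i\<bar>) = 1" for x :: "int ^ 'd"
    proof -
      have "\<bar>x $ i\<bar> \<le> 1" for i
        unfolding that[symmetric] by (rule member_le_sum[of i UNIV "\<lambda>i. \<bar>x $ i\<bar>"]) auto
      then show ?thesis unfolding mem_Collect_eq atLeastAtMost_iff abs_le_iff
        by (simp add: minus_le_iff)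
    qed
    obtain x y :: "int ^ 'd" where xy: "e = {x, y}" "(\<Sum>i\<in>UNIV. \<bar>x $ i - y $ i\<bar>) = 1"
      using e by (auto simp: lattice_def)
    consider "x = 0" | "y = 0" using e xy by auto
    then show "e \<in> (\<lambda>x. {0, x}) ` ?B"
    proof cases
      case 1
      then have "y \<in> ?B" using xy by (intro B) simp
      then show ?thesis using xy 1 by auto
    next
      case 2
      then have "x \<in> ?B" using xy by (intro B) simp
      then show ?thesis using xy 2 by (auto simp: insert_commute)
    qed
  qed
qed

text \<open>With the edges of a path of \<open>n\<close> vertices going down the tree open and the remaining edges
  at these vertices closed, the cluster is this path. It is enough to fix the states of
  \<open>O(n)\<close> edges.\<close>

lemma prob_cluster_card_lower_bound:
  fixes p :: real
  assumes p: "0 < p" "p < 1" and r: "1 \<le> r"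
  shows "\<exists>\<nu>. \<forall>n\<ge>1. exp (- \<nu> * real n) \<le> measure (percolation (lattice_with_trees r) p)
    {\<omega> \<in> space (percolation (lattice_with_trees r :: ((int ^ 'd) \<times> nat list) graph) p).
      finite (open_cluster (lattice_with_trees r) \<omega> (0, [])) \<and>
      card (open_cluster (lattice_with_trees r) \<omega> (0, [])) = n}"
proof -
  let ?G = "lattice_with_trees r :: ((int ^ 'd) \<times> nat list) graph"
  let ?M = "percolation ?G p"
  interpret P: prob_space ?M by (rule prob_space_percolation)
  let ?\<rho> = "\<lambda>x :: int ^ 'd. (x, [] :: nat list)"
  let ?w = "\<lambda>i. (0 :: int ^ 'd, replicate i (0 :: nat))"
  define L where "L = (`) ?\<rho> ` {e \<in> edges (lattice :: (int ^ 'd) graph). 0 \<in> e}"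
  define J where "J n = L \<union> (\<lambda>(i, k). {?w i, (0, replicate i 0 @ [k])}) ` ({..<n} \<times> {..<r})" for n
  define \<kappa> where "\<kappa> = min p (1 - p)"
  have \<kappa>: "0 < \<kappa>" "\<kappa> \<le> p" "\<kappa> \<le> 1 - p" "\<kappa> < 1" using p by (auto simp: \<kappa>_def)
  have L: "finite L" unfolding L_def by (intro finite_imageI finite_lattice_neighbours)
  have tree_edge: "{(0, v), (0, v @ [k])} \<in> edges ?G" if "v \<in> lists {..<r}" "k < r" for v k
  proof -
    have "Pair 0 ` {v, v @ [k]} \<in> edges ?G"
      unfolding edges_lattice_with_trees using tree_edgeI[OF that] by blast
    then show ?thesis by simp
  qed
  have J: "finite (J n)" "J n \<subseteq> edges ?G" for n
  proof -
    show "finite (J n)" unfolding J_def using L by auto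
    have "L \<subseteq> edges ?G" by (auto simp: L_def edges_lattice_with_trees)
    moreover have "{?w i, (0, replicate i 0 @ [k])} \<in> edges ?G" if "k < r" for i k
      using that r by (intro tree_edge) auto
    ultimately show "J n \<subseteq> edges ?G" by (auto simp: J_def)
  qed
  have cardJ: "card (J n) \<le> (card L + r) * n" if n: "1 \<le> n" for n
  proof -
    have "card (J n) \<le> card L + card ((\<lambda>(i, k). {?w i, (0, replicate i 0 @ [k])}) ` ({..<n} \<times> {..<r}))"
      unfolding J_def by (rule card_Un_le)
    also have "\<dots> \<le> card L + card ({..<n} \<times> {..<r})" by (intro add_left_mono card_image_le) auto
    also have "\<dots> = card L * 1 + r * n" by simp
    also have "\<dots> \<le> card L * n + r * n" using n by (intro add_right_mono mult_left_mono) auto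
    finally show ?thesis by (simp add: algebra_simps)
  qed
  define Path where "Path n = (\<lambda>i. {?w i, ?w (Suc i)}) ` {i. Suc i < n}" for n
  have OJ: "Path n \<subseteq> J n" for n
  proof
    fix e assume "e \<in> Path n"
    then obtain i where i: "e = {?w i, ?w (Suc i)}" "Suc i < n" by (auto simp: Path_def)
    have "replicate (Suc i) (0 :: nat) = replicate i 0 @ [0]" by (simp add: replicate_append_same)
    then have "e = (\<lambda>(i, k). {?w i, (0, replicate i 0 @ [k])}) (i, 0)" using i by simp
    then show "e \<in> J n" unfolding J_def using i(2) r by (intro UnI2 image_eqI[of _ _ "(i, 0)"]) auto
  qed
  have cluster: "open_cluster ?G \<omega> (0, []) = ?w ` {..<n}"
    if n: "1 \<le> n" and \<omega>: "{e \<in> J n. \<omega> e} = Path n" for n \<omega>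
  proof -
    let ?S = "{e \<in> edges ?G. \<omega> e}"
    have sub: "reach ?S {(0, [])} \<subseteq> ?w ` {..<n}"
    proof (rule reach_subsetI)
      show "{(0, [])} \<subseteq> ?w ` {..<n}" using n by (auto intro: image_eqI[of _ _ 0])
      fix a b assume a: "a \<in> ?w ` {..<n}" and ab: "{a, b} \<in> ?S"
      then obtain i where i: "a = ?w i" "i < n" by auto
      show "b \<in> ?w ` {..<n}"
      proof (cases "{a, b} \<in> J n")
        case True
        then have "{a, b} \<in> Path n" using ab \<omega> by auto
        then obtain j where j: "{a, b} = {?w j, ?w (Suc j)}" "Suc j < n" by (auto simp: Path_def)
        have "b \<in> {?w j, ?w (Suc j)}" unfolding j(1)[symmetric] by simp
        also have "\<dots> = ?w ` {j, Suc j}" by blast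
        also have "\<dots> \<subseteq> ?w ` {..<n}" using j(2) by (intro image_mono) auto
        finally show ?thesis .
      next
        case False
        from ab consider e where "{a, b} = ?\<rho> ` e" "e \<in> edges lattice"
          | x e where "{a, b} = Pair x ` e" "e \<in> edges (rooted_tree r)"
          unfolding edges_lattice_with_trees by blast
        then show ?thesis
        proof cases
          case 1
          have "a \<in> ?\<rho> ` e" using 1(1) by auto
          then have "0 \<in> e" using i by auto
          then have "{a, b} \<in> L" unfolding L_def using 1 by blast
          then show ?thesis using False by (simp add: J_def)
        next
          case 2
          have "a \<in> Pair x ` e" using 2(1) by auto
          then have x: "x = 0" using i by auto
          obtain v k where v: "e = {v, v @ [k]}" "k < r" using 2(2) by (auto simp: rooted_tree_def)
          have ab': "{a, b} = {(0, v), (0, v @ [k])}" using 2(1) v x by simp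
          show ?thesis
          proof (cases "a = (0, v)")
            case True
            then have "v = replicate i 0" using i by simp
            then have "{a, b} = (\<lambda>(i, k). {?w i, (0, replicate i 0 @ [k])}) (i, k)" using ab' by simp
            then have "{a, b} \<in> J n" unfolding J_def using i(2) v(2) by (intro UnI2 image_eqI[of _ _ "(i, k)"]) auto
            then show ?thesis using False by simp
          next
            case F: False
            then have "a = (0, v @ [k])" "b = (0, v)" using ab' by (auto simp: doubleton_eq_iff)
            then have vk: "v @ [k] = replicate i 0" using i by simp
            then have "v = butlast (replicate i 0)" by (metis butlast_snoc)
            also have "\<dots> = replicate (i - 1) 0" by (simp add: butlast_conv_take)
            finally show ?thesis using \<open>b = (0, v)\<close> i(2) by (intro image_eqI[of _ _ "i - 1"]) auto
          qed
        qed
      qed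
    qed
    have Path_S: "Path n \<subseteq> ?S" using J(2)[of n] unfolding \<omega>[symmetric] by blast
    have "?w i \<in> reach ?S {(0, [])}" if "i < n" for i
      using that
    proof (induction i)
      case 0
      then show ?case using subset_reach[of "{(0, [])}"] by auto
    next
      case (Suc i)
      have "{?w i, ?w (Suc i)} \<in> Path n" unfolding Path_def using Suc.prems by blast
      then have "{?w i, ?w (Suc i)} \<in> ?S" by (rule subsetD[OF Path_S])
      then show ?case by (rule reach_step[OF Suc.IH[OF Suc_lessD[OF Suc.prems]]])
    qed
    with sub show ?thesis unfolding open_cluster_eq_reach by blast
  qed
  define \<nu> where "\<nu> = - real (card L + r) * ln \<kappa>"
  have "exp (- \<nu> * real n) \<le> measure ?M {\<omega> \<in> space ?M.
      finite (open_cluster ?G \<omega> (0, [])) \<and> card (open_cluster ?G \<omega> (0, [])) = n}" if n: "1 \<le> n" for n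
  proof -
    have "exp (- \<nu> * real n) = exp (real ((card L + r) * n) * ln \<kappa>)"
      by (simp add: \<nu>_def algebra_simps)
    also have "\<dots> = \<kappa> ^ ((card L + r) * n)" unfolding exp_of_nat_mult using \<kappa> by simp
    also have "\<dots> \<le> \<kappa> ^ card (J n)" using \<kappa> cardJ[OF n] by (intro power_decreasing) auto
    also have "card (J n) = card (Path n) + card (J n - Path n)"
      using J(1) OJ card_Diff_subset[of "Path n" "J n"] card_mono[of "J n" "Path n"] finite_subset by fastforce
    also have "\<kappa> ^ (card (Path n) + card (J n - Path n)) \<le> p ^ card (Path n) * (1 - p) ^ card (J n - Path n)"
      unfolding power_add using \<kappa> by (intro mult_mono power_mono) auto
    also have "\<dots> = (\<Sum>S\<in>{Path n}. p ^ card S * (1 - p) ^ card (J n - S) * of_bool (S = Path n))" by simp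
    also have "\<dots> \<le> bernoulli_sum p (J n) (\<lambda>S. of_bool (S = Path n))"
      unfolding bernoulli_sum_def using J(1) OJ p by (intro sum_mono2) auto
    also have "\<dots> = measure ?M {\<omega> \<in> space ?M. {e \<in> J n. \<omega> e} = Path n}"
      using J p by (intro prob_open_edges(2)[symmetric]) auto
    also have "\<dots> \<le> measure ?M {\<omega> \<in> space ?M.
      finite (open_cluster ?G \<omega> (0, [])) \<and> card (open_cluster ?G \<omega> (0, [])) = n}"
    proof (rule P.finite_measure_mono)
      have "card (?w ` {..<n}) = n" by (subst card_image) (auto simp: inj_on_def)
      then show "{\<omega> \<in> space ?M. {e \<in> J n. \<omega> e} = Path n} \<subseteq> {\<omega> \<in> space ?M.
        finite (open_cluster ?G \<omega> (0, [])) \<and> card (open_cluster ?G \<omega> (0, [])) = n}"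
        using cluster[OF n] by auto
    qed (rule lattice_with_trees.sets_Collect_finite_cluster)
    finally show ?thesis .
  qed
  then show ?thesis by blast
qed

section \<open>The size of the cluster of the origin\<close>

text \<open>Below \<open>1 / r\<close> the generating function of the tree is close to \<open>1\<close> at some \<open>s > 1\<close>, and that of
  the lattice is finite near \<open>1\<close>. Above \<open>1 / r\<close> it is at most \<open>1\<close> at some \<open>s > 1\<close>, and the
  generating function of the lattice is at most \<open>1\<close> at arguments up to \<open>1\<close>.\<close>

lemma tail_noncritical:
  fixes p :: real
  assumes p: "0 < p" "p < 1" "p \<noteq> 1 / real r" and r: "2 \<le> r"
    and crit: "1 / real r < critical_probability (lattice :: (int ^ 'd) graph)"
  shows "\<exists>s>1. \<exists>K. \<forall>n. finite_tail (lattice_with_trees r :: ((int ^ 'd) \<times> nat list) graph) p (0, []) n \<le> K / s ^ n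
    \<and> (1 / real r < p \<longrightarrow> K \<le> 1)"
proof (cases "p < 1 / real r")
  case True
  let ?L = "lattice :: (int ^ 'd) graph"
  obtain t where t: "1 < t" "cluster_gf ?L p 0 (ennreal t) < \<infinity>"
    using lattice_subcritical_gf(1)[of p, where 'd = 'd] p crit True by auto
  obtain s where s: "1 < s" "cluster_gf (rooted_tree r) p [] (ennreal s) \<le> ennreal t"
    using subcritical_tree_gf[OF p(1) True r t(1)] by auto
  obtain K where K: "0 \<le> K" "cluster_gf ?L p 0 (ennreal t) = ennreal K"
    using t(2) by (cases "cluster_gf ?L p 0 (ennreal t)") auto
  have "cluster_gf (lattice_with_trees r) p (0 :: int ^ 'd, []) (ennreal s) \<le> ennreal K"
    unfolding cluster_gf_lattice_with_trees K(2)[symmetric] by (rule lattice.cluster_gf_mono[OF s(2)])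
  then have "finite_tail (lattice_with_trees r) p (0 :: int ^ 'd, []) n \<le> K / s ^ n" for n
    using s(1) K(1) by (intro lattice_with_trees.finite_tail_le_gf) auto
  then show ?thesis using s(1) True by (intro exI[of _ s] conjI exI[of _ K]) auto
next
  case False
  let ?L = "lattice :: (int ^ 'd) graph"
  obtain s where s: "1 < s" "cluster_gf (rooted_tree r) p [] (ennreal s) \<le> 1"
    using supercritical_tree_gf[of r p] p r False by auto
  have "cluster_gf (lattice_with_trees r) p (0 :: int ^ 'd, []) (ennreal s) \<le> cluster_gf ?L p 0 1"
    unfolding cluster_gf_lattice_with_trees by (rule lattice.cluster_gf_mono[OF s(2)])
  also have "\<dots> \<le> ennreal 1" using lattice.cluster_gf_1_le by simp
  finally have "finite_tail (lattice_with_trees r) p (0 :: int ^ 'd, []) n \<le> 1 / s ^ n" for n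
    using s(1) by (intro lattice_with_trees.finite_tail_le_gf) auto
  then show ?thesis using s(1) by (intro exI[of _ s] conjI exI[of _ 1]) auto
qed

text \<open>The lattice cluster has a finite mean, so composing with its generating function preserves the
  square-root singularity of the tree.\<close>

lemma tail_critical:
  assumes r: "2 \<le> r" and crit: "1 / real r < critical_probability (lattice :: (int ^ 'd) graph)"
  shows "\<exists>c>0. \<exists>C. \<forall>n\<ge>1.
    c / sqrt (real n) \<le> finite_tail (lattice_with_trees r :: ((int ^ 'd) \<times> nat list) graph) (1 / real r) (0, []) n \<and>
    finite_tail (lattice_with_trees r :: ((int ^ 'd) \<times> nat list) graph) (1 / real r) (0, []) n \<le> C / sqrt (real n)"
proof -
  let ?L = "lattice :: (int ^ 'd) graph" and ?p = "1 / real r"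
  let ?G = "lattice_with_trees r :: ((int ^ 'd) \<times> nat list) graph"
  let ?\<tau> = "finite_tail ?G ?p (0, [])"
  have p: "0 \<le> ?p" "?p < 1" using r by auto
  obtain t where t: "1 < t" "cluster_gf ?L ?p 0 (ennreal t) < \<infinity>"
    using lattice_subcritical_gf(1)[OF p crit] by auto
  have L1: "cluster_gf ?L ?p 0 1 = 1" by (rule lattice_subcritical_gf(2)[OF p crit])
  obtain K where K: "0 \<le> K" "\<And>a. 0 \<le> a \<Longrightarrow> a \<le> 1 \<Longrightarrow> 1 \<le> cluster_gf ?L ?p 0 (ennreal a) + ennreal ((1 - a) * K)"
    using lattice.cluster_gf_linear_bound[OF t L1] by auto
  have "\<exists>a. 0 \<le> a \<and> a \<le> 1 \<and> cluster_gf (rooted_tree r) ?p [] (ennreal 1) = ennreal a \<and>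
    sqrt (1 - 1) / 2 \<le> 1 - a \<and> 1 - a \<le> 3 * sqrt (1 - 1)"
    by (rule critical_tree_gf[OF r]) auto
  then have "cluster_gf (rooted_tree r) ?p [] 1 = 1" by auto
  then have G1: "cluster_gf ?G ?p (0, []) 1 = 1" by (simp add: cluster_gf_lattice_with_trees L1)
  define g where "g s = enn2real (cluster_gf ?G ?p (0, []) (ennreal s))" for s
  have gf: "cluster_gf ?G ?p (0, []) (ennreal s) = ennreal (g s)" and g0: "0 \<le> g s" if "s \<le> 1" for s
  proof -
    have "cluster_gf ?G ?p (0, []) (ennreal s) \<le> 1"
      using that lattice_with_trees.cluster_gf_mono[of "ennreal s" 1 r ?p "(0 :: int ^ 'd, [])"] unfolding G1 by simp
    then have "cluster_gf ?G ?p (0, []) (ennreal s) < \<top>" by (rule le_less_trans) simp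
    then show "cluster_gf ?G ?p (0, []) (ennreal s) = ennreal (g s)" by (simp add: g_def)
  qed (simp add: g_def)
  have \<tau>: "0 \<le> ?\<tau> n" for n by (simp add: finite_tail_def)
  have sing: "1 / 2 * sqrt (1 - s) \<le> 1 - g s \<and> 1 - g s \<le> 3 * K * sqrt (1 - s)"
    if s: "1 / 2 \<le> s" "s < 1" for s
  proof -
    obtain a where a: "0 \<le> a" "a \<le> 1" "cluster_gf (rooted_tree r) ?p [] (ennreal s) = ennreal a"
      "sqrt (1 - s) / 2 \<le> 1 - a" "1 - a \<le> 3 * sqrt (1 - s)"
      using critical_tree_gf[OF r, of s] s by auto
    have ga: "ennreal (g s) = cluster_gf ?L ?p 0 (ennreal a)"
      using gf[of s] s by (simp add: cluster_gf_lattice_with_trees a(3))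
    also have "\<dots> \<le> ennreal a" using a by (intro lattice.cluster_gf_le_self) simp
    finally have "g s \<le> a" using a(1) by (simp add: ennreal_le_iff)
    moreover have "ennreal 1 \<le> ennreal (g s + (1 - a) * K)"
      using K(2)[OF a(1,2)] g0[of s] s a K(1) unfolding ga[symmetric] by (simp add: ennreal_plus[symmetric] del: ennreal_plus)
    then have "1 \<le> g s + (1 - a) * K"
      using g0[of s] s a K(1) by (subst (asm) ennreal_le_iff) auto
    moreover have "(1 - a) * K \<le> 3 * sqrt (1 - s) * K" using a(5) K(1) by (rule mult_right_mono)
    ultimately show ?thesis using a(4) by (simp add: mult_ac)
  qed
  show ?thesis
  proof (rule tail_of_square_root_singularity[where \<tau> = ?\<tau> and g = g and a = "1 / 2" and b = "3 * K"])
    fix n s assume s: "1 / 2 \<le> s" "s < (1 :: real)"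
    have sn: "0 \<le> (1 - s ^ n) * ?\<tau> n" using s \<tau> by (simp add: power_le_one)
    have "ennreal (g s + (1 - s ^ n) * ?\<tau> n) \<le> ennreal 1"
      using lattice_with_trees.cluster_gf_plus_tail_le_1[of s r ?p "(0 :: int ^ 'd, [])" n] s gf[of s] g0[of s] sn
      by (simp add: ennreal_plus)
    then show "g s + (1 - s ^ n) * ?\<tau> n \<le> 1" by (subst (asm) ennreal_le_iff) auto
    have S: "0 \<le> ?\<tau> n + (1 - s) * (\<Sum>k=1..n. ?\<tau> k)"
      using s \<tau> by (intro add_nonneg_nonneg mult_nonneg_nonneg sum_nonneg) auto
    have "ennreal 1 \<le> ennreal (g s + (?\<tau> n + (1 - s) * (\<Sum>k=1..n. ?\<tau> k)))"
      using lattice_with_trees.one_le_cluster_gf_plus_tail[of s r ?p "(0 :: int ^ 'd, [])" n] s gf[of s] G1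
      by (subst ennreal_plus[OF g0 S]) auto
    then show "1 \<le> g s + (?\<tau> n + (1 - s) * (\<Sum>k=1..n. ?\<tau> k))"
      using g0[of s] s S by (subst (asm) ennreal_le_iff) auto
  qed (use \<tau> sing in auto)
qed

theorem theorem10:
  fixes r :: nat and G :: "((int ^ 'd) \<times> nat list) graph"
  assumes "CARD('d) \<ge> 2" and "r \<ge> 2"
    and "G = lattice_with_trees r"
    and "critical_probability (lattice :: (int ^ 'd) graph) > 1 / real r"
  shows "(\<forall>p. 0 < p \<and> p < 1 \<and> p \<noteq> 1 / real r \<longrightarrow>
            (\<exists>\<nu>1 \<nu>2 :: real. \<nu>2 > 0 \<and>
              (\<forall>n::nat. n \<ge> 1 \<longrightarrow>
                 exp (- \<nu>1 * real n) \<le> finite_tail G p (0, []) n \<and>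
                 (\<not> (n = 1 \<and> p < 1 / real r) \<longrightarrow>
                    finite_tail G p (0, []) n \<le> exp (- \<nu>2 * real n))))) \<and>
         (\<forall>p. p = 1 / real r \<longrightarrow>
            (\<exists>c1 :: real. c1 > 0 \<and>
              (\<exists>c2 :: real \<Rightarrow> real. \<forall>\<epsilon>>0. \<forall>n::nat. n \<ge> 1 \<longrightarrow>
                 c1 / real n powr (1 / 2) \<le> finite_tail G p (0, []) n \<and>
                 finite_tail G p (0, []) n \<le> c2 \<epsilon> / real n powr (1 / 2 - \<epsilon>))))"
proof (intro conjI allI impI)
  fix p :: real assume p: "0 < p \<and> p < 1 \<and> p \<noteq> 1 / real r"
  let ?M = "percolation G p"
  interpret P: prob_space ?M by (rule prob_space_percolation)
  let ?E = "\<lambda>n. {\<omega> \<in> space ?M. finite (open_cluster G \<omega> (0, [])) \<and> card (open_cluster G \<omega> (0, [])) = n}"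
  let ?\<tau> = "finite_tail G p (0, [])"
  obtain \<nu>1 where \<nu>1: "\<And>n. 1 \<le> n \<Longrightarrow> exp (- \<nu>1 * real n) \<le> measure ?M (?E n)"
    using prob_cluster_card_lower_bound[of p r, where 'd = 'd] p assms by auto
  have setsE: "?E n \<in> sets ?M" for n
    unfolding assms(3) by (rule lattice_with_trees.sets_Collect_finite_cluster)
  have sets\<tau>: "{\<omega> \<in> space ?M. finite (open_cluster G \<omega> (0, [])) \<and> n \<le> card (open_cluster G \<omega> (0, []))} \<in> sets ?M" for n
    unfolding assms(3) by (rule lattice_with_trees.sets_Collect_finite_cluster)
  have low: "exp (- \<nu>1 * real n) \<le> ?\<tau> n" if "1 \<le> n" for n
    using \<nu>1[OF that] P.finite_measure_mono[OF _ sets\<tau>, of "?E n" n] unfolding finite_tail_def by force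
  obtain s K where sK: "1 < s" "\<And>n. ?\<tau> n \<le> K / s ^ n" "1 / real r < p \<Longrightarrow> K \<le> 1"
    using tail_noncritical[of p r, where 'd = 'd] p assms by auto
  have \<tau>0: "0 \<le> ?\<tau> n" for n by (simp add: finite_tail_def)
  show "\<exists>\<nu>1 \<nu>2 :: real. \<nu>2 > 0 \<and> (\<forall>n::nat. n \<ge> 1 \<longrightarrow> exp (- \<nu>1 * real n) \<le> ?\<tau> n \<and>
      (\<not> (n = 1 \<and> p < 1 / real r) \<longrightarrow> ?\<tau> n \<le> exp (- \<nu>2 * real n)))"
  proof (cases "p < 1 / real r")
    case True
    define \<rho> where "\<rho> = max (1 / 2) (1 - exp (- \<nu>1))"
    have \<rho>: "0 < \<rho>" "\<rho> < 1" by (auto simp: \<rho>_def)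
    \<comment> \<open>The cluster is a single vertex with positive probability.\<close>
    have le\<rho>: "?\<tau> n \<le> \<rho>" if "2 \<le> n" for n
    proof -
      have "?\<tau> n \<le> measure ?M (space ?M - ?E 1)"
        unfolding finite_tail_def using that setsE by (intro P.finite_measure_mono) auto
      also have "\<dots> = 1 - measure ?M (?E 1)" by (rule P.prob_compl[OF setsE])
      also have "\<dots> \<le> \<rho>" using \<nu>1[of 1] by (simp add: \<rho>_def)
      finally show ?thesis .
    qed
    obtain \<nu>2 where \<nu>2: "0 < \<nu>2"
      "\<And>n x. 1 \<le> n \<Longrightarrow> 0 \<le> x \<Longrightarrow> x \<le> K / s ^ n \<Longrightarrow> x \<le> \<rho> \<Longrightarrow> x \<le> exp (- \<nu>2 * real n)"
      using exponential_bound_of_two_bounds[OF sK(1) \<rho>, of K] by auto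
    show ?thesis
      using \<nu>2 low sK(2) le\<rho> \<tau>0 True by (intro exI[of _ \<nu>1] exI[of _ \<nu>2]) auto
  next
    case False
    then have K: "K \<le> 1" using p by (intro sK(3)) auto
    have "?\<tau> n \<le> exp (- ln s * real n)" for n
    proof -
      have "K / s ^ n \<le> 1 / s ^ n" using sK(1) K by (intro divide_right_mono) auto
      then have "?\<tau> n \<le> 1 / s ^ n" using sK(2)[of n] by linarith
      also have "\<dots> = exp (- ln s * real n)" using sK(1) by (simp add: exp_minus exp_of_nat2_mult divide_inverse)
      finally show ?thesis .
    qed
    then show ?thesis using low sK(1) by (intro exI[of _ \<nu>1] exI[of _ "ln s"]) auto
  qed
next
  fix p :: real assume p: "p = 1 / real r"
  let ?\<tau> = "finite_tail G p (0, [])"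
  obtain c C where c: "0 < c" "\<And>n. 1 \<le> n \<Longrightarrow> c / sqrt (real n) \<le> ?\<tau> n" "\<And>n. 1 \<le> n \<Longrightarrow> ?\<tau> n \<le> C / sqrt (real n)"
    using tail_critical[of r, where 'd = 'd] assms unfolding p by auto
  have "0 \<le> ?\<tau> 1" by (simp add: finite_tail_def)
  then have C: "0 \<le> C" using c(3)[of 1] by simp
  have "?\<tau> n \<le> C / real n powr (1 / 2 - \<epsilon>)" if "0 < \<epsilon>" "1 \<le> n" for \<epsilon> n
  proof -
    have "real n powr (1 / 2 - \<epsilon>) \<le> real n powr (1 / 2)" using that by (intro powr_mono) auto
    then have "C / real n powr (1 / 2) \<le> C / real n powr (1 / 2 - \<epsilon>)"
      using C that by (intro divide_left_mono) auto
    then show ?thesis using c(3)[OF that(2)] by (simp add: powr_half_sqrt)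
  qed
  moreover have "c / real n powr (1 / 2) \<le> ?\<tau> n" if "1 \<le> n" for n
    using c(2)[OF that] by (simp add: powr_half_sqrt)
  ultimately show "\<exists>c1 :: real. c1 > 0 \<and> (\<exists>c2 :: real \<Rightarrow> real. \<forall>\<epsilon>>0. \<forall>n::nat. n \<ge> 1 \<longrightarrow>
      c1 / real n powr (1 / 2) \<le> ?\<tau> n \<and> ?\<tau> n \<le> c2 \<epsilon> / real n powr (1 / 2 - \<epsilon>))"
    using c(1) by (intro exI[of _ c] conjI exI[of _ "\<lambda>_. C"]) auto
qed

end
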